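(* Let $\mathcal{G}$ be a $\mathbb{Z}^d$-periodic graph with a positive $\mathbb{Z}^d$-periodic edge weight $\omega$ and a real $\mathbb{Z}^d$-periodic potential $Q$, let $\nu$ be the number of vertices of its fundamental graph, and let $\lambda_1(\cdot)\le\dots\le\lambda_\nu(\cdot)$ be the band functions and $\lambda_j^\pm$ the band edges of the Schrödinger operator $H=\Delta+Q$ on $\mathcal{G}$. Let $\mathfrak{t}=\{\mathfrak{t}_1,\dots,\mathfrak{t}_{d_o}\}\subset\mathbb{Z}^d$, $d_o<d$, be a primitive set, with chiral matrix $\mathcal{T}$. Then the spectrum of the Schrödinger operator $H_{\mathfrak{t}}=\Delta_{\mathfrak{t}}+Q$ on the subcovering graph $\mathcal{G}_{\mathfrak{t}}$ has the form $$\sigma(H_{\mathfrak{t}})=\bigcup_{j=1}^{\nu}\sigma_j(H_{\mathfrak{t}}),\qquad \sigma_j(H_{\mathfrak{t}})=\lambda_j(\mathcal{B}_{\mathfrak{t}})=\big[\lambda_j^-(\mathfrak{t}),\lambda_j^+(\mathfrak{t})\big]\subseteq\big[\lambda_j^-,\lambda_j^+\big],\quad j=1,\dots,\nu .$$ Moreover, the following hold for each $j\in\{1,\dots,\nu\}$ and each choice of sign $\pm$, where $K_j^\pm=\{k\in(-\pi,\pi]^d:\lambda_j(k)=\lambda_j^\pm\}$. (i) $\lambda_j^\pm(\mathfrak{t})=\lambda_j^\pm$ if and only if $\mathcal{T}k_o\in2\pi\mathbb{Z}^{d_o}$ for some $k_o\in K_j^\pm$. In particular: if $0\in K_j^\pm$,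 then $\lambda_j^\pm(\mathfrak{t})=\lambda_j^\pm$; and if $(\pi,\dots,\pi)\in K_j^\pm$ and the sum of the entries in each row of $\mathcal{T}$ is even, then $\lambda_j^\pm(\mathfrak{t})=\lambda_j^\pm$. (ii) Let $(\mathcal{G}_{\mathfrak{t}})$ be a sequence of subcoverings of $\mathcal{G}$ (with primitive sets $\mathfrak{t}$ of $d_o$ vectors) such that the smallest singular value $\tau$ of their $d_o\times d$ chiral matrices $\mathcal{T}$ goes to infinity. Then $$\lim_{\tau\to\infty}\lambda_j^\pm(\mathfrak{t})=\lambda_j^\pm .$$
   Context: **Periodic graphs.** $\mathcal{G}=(\mathcal{V},\mathcal{E})$ is a connected infinite graph (unoriented edges; multiple edges and loops allowed) embedded in $\mathbb{R}^d$. It is $\mathbb{Z}^d$-periodic: it is invariant under translation by every vector of the period lattice, identified with $\mathbb{Z}^d$ via a fixed basis in which all coordinates are written (so $\mathbb{Z}^d$ acts freely on vertices, $v\mapsto v+\mathfrak{a}$), and the quotient $\mathcal{G}_*=\mathcal{G}/\mathbb{Z}^d=(\mathcal{V}_*,\mathcal{E}_* )$, called the fundamental graph, is finite. Put $\nu=\#\mathcal{V}_*$. **Schrödinger operator.** Given $\omega:\mathcal{E}\to(0,\infty)$ and $Q:\mathcal{V}\to\mathbb{R}$, both invariant under translations by $\mathbb{Z}^d$, the operator $H=\Delta+Q$ acts on $\ell^2(\mathcal{V})$ by $$(Hf)(v)=\sum_{\mathbf{e}=\{v,u\}\in\mathcal{E}}\omega(\mathbf{e})\big(f(v)-f(u)\big)+Q(v)f(v).$$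 It is bounded and self-adjoint. **Band functions.** For $k\in\mathbb{R}^d$, the Floquet operator $H(k)$ is the operator given by the same formula on the $\nu$-dimensional space of functions $f:\mathcal{V}\to\mathbb{C}$ with $f(v+\mathfrak{a})=e^{i\langle\mathfrak{a},k\rangle}f(v)$ for all $v\in\mathcal{V}$, $\mathfrak{a}\in\mathbb{Z}^d$; this space is identified with $\ell^2(\mathcal{V}_* )$ by restricting to one vertex per $\mathbb{Z}^d$-orbit, and $H(k)$ is then self-adjoint. Its eigenvalues, counted with multiplicity, are $\lambda_1(k)\le\dots\le\lambda_\nu(k)$. The band functions $\lambda_j(\cdot)$ are continuous and $2\pi\mathbb{Z}^d$-periodic. With $\mathcal{B}=(-\pi,\pi]^d$, the band edges of $H$ are $\lambda_j^-=\min_{\mathcal{B}}\lambda_j$ and $\lambda_j^+=\max_{\mathcal{B}}\lambda_j$. **Primitive sets.** A set $\{\mathfrak{t}_1,\dots,\mathfrak{t}_{d_o}\}\subset\mathbb{Z}^d$, $d_o<d$, is primitive if it can be completed to a basis of $\mathbb{Z}^d$ (equivalently, it is a basis of the lattice $\mathbb{Z}^d\cap\mathrm{span}_{\mathbb{R}}(\mathfrak{t})$). **Subcoverings.** Let $\Gamma_{\mathfrak{t}}$ be the sublattice of $\mathbb{Z}^d$ with basis $\mathfrak{t}_1,\dots,\mathfrak{t}_{d_o}$. The subcovering graph is $\mathcal{G}_{\mathfrak{t}}=\mathcal{G}/\Gamma_{\mathfrak{t}}$, and $H_{\mathfrak{t}}=\Delta_{\mathfrak{t}}+Q$ is the Schrödinger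 operator on $\ell^2(\mathcal{V}/\Gamma_{\mathfrak{t}})$ given by the same formula on $\mathcal{G}_{\mathfrak{t}}$ with the induced weight and potential. The chiral matrix $\mathcal{T}$ is the $d_o\times d$ integer matrix whose rows are $\mathfrak{t}_1,\dots,\mathfrak{t}_{d_o}$. Put $$\mathcal{B}_{\mathfrak{t}}=\{k\in(-\pi,\pi]^d:\ \mathcal{T}k\in2\pi\mathbb{Z}^{d_o}\}.$$ The dispersion relation of $H_{\mathfrak{t}}$ is the restriction of $k\mapsto\{\lambda_j(k)\}$ to $\mathcal{B}_{\mathfrak{t}}$, and the band edges of $H_{\mathfrak{t}}$ are $\lambda_j^-(\mathfrak{t})=\min_{\mathcal{B}_{\mathfrak{t}}}\lambda_j$ and $\lambda_j^+(\mathfrak{t})=\max_{\mathcal{B}_{\mathfrak{t}}}\lambda_j$. The smallest singular value $\tau$ of $\mathcal{T}$ is the square root of the smallest eigenvalue of $\mathcal{T}\mathcal{T}^\top$. *)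

theory Defs
  imports "HOL-Analysis.Analysis" "HOL-Library.Function_Algebras"
begin

section \<open>Weighted multigraphs and Schroedinger operators\<close>

text \<open>
  An unoriented multigraph with edge weight and potential. Edges are abstract objects, so that
  multiple edges are allowed; \<open>ends G e\<close> is the set \<open>{u, v}\<close> of endpoints, which is a singleton
  exactly for loops.
\<close>

record ('v, 'e) wgraph =
  verts :: "'v set"
  edges :: "'e set"
  ends :: "'e \<Rightarrow> 'v set"
  weight :: "'e \<Rightarrow> real"
  pot :: "'v \<Rightarrow> real"

definition connected_graph :: "('v, 'e) wgraph \<Rightarrow> bool" where
  "connected_graph G \<longleftrightarrow>
     (\<forall>u\<in>verts G. \<forall>v\<in>verts G. (u, v) \<in> {(x, y). \<exists>e\<in>edges G. ends G e = {x, y}}\<^sup>*)"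

text \<open>
  The sum ranges over pairs of an edge at \<open>v\<close> and its other endpoint \<open>u\<close>, so parallel edges are
  counted separately. It is a finite sum for the graphs considered here.
\<close>

definition schroedinger :: "('v, 'e) wgraph \<Rightarrow> ('v \<Rightarrow> complex) \<Rightarrow> 'v \<Rightarrow> complex" where
  "schroedinger G f v =
     (\<Sum>(e, u) \<in> {(e, u). e \<in> edges G \<and> ends G e = {v, u}}.
        of_real (weight G e) * (f v - f u))
     + of_real (pot G v) * f v"


section \<open>Square-summable functions and the spectrum\<close>

text \<open>Functions on a carrier set \<open>S\<close> are represented by functions vanishing outside \<open>S\<close>.\<close>

definition ell2 :: "'v set \<Rightarrow> ('v \<Rightarrow> complex) set" where
  "ell2 S = {f. (\<forall>x. x \<notin> S \<longrightarrow> f x = 0) \<and> (\<lambda>x. (cmod (f x))\<^sup>2) summable_on S}"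

definition ell2_norm :: "'v set \<Rightarrow> ('v \<Rightarrow> complex) \<Rightarrow> real" where
  "ell2_norm S f = sqrt (\<Sum>\<^sub>\<infinity>x\<in>S. (cmod (f x))\<^sup>2)"

text \<open>
  The complement of the set of \<open>z\<close> for which \<open>A - z\<close> is a bijection of \<open>ell2 S\<close> with bounded inverse.
\<close>

definition spectrum_ell2 :: "'v set \<Rightarrow> (('v \<Rightarrow> complex) \<Rightarrow> 'v \<Rightarrow> complex) \<Rightarrow> complex set" where
  "spectrum_ell2 S A =
     {z. \<not> (bij_betw (\<lambda>f x. A f x - z * f x) (ell2 S) (ell2 S) \<and>
            (\<exists>C. \<forall>f\<in>ell2 S. ell2_norm S f \<le> C * ell2_norm S (\<lambda>x. A f x - z * f x)))}"


section \<open>Periodic graphs and their quotients\<close>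

text \<open>
  Vertices are points of \<open>real ^ 'd\<close>, written in the coordinates for which the period lattice
  is \<open>int ^ 'd\<close>. The translation of edges is given by the action \<open>shift\<close>.
\<close>

definition ivec :: "int ^ 'd \<Rightarrow> real ^ 'd" where
  "ivec a = (\<chi> i. real_of_int (a $ i))"

definition vorbit :: "(int ^ 'd) set \<Rightarrow> real ^ 'd \<Rightarrow> (real ^ 'd) set" where
  "vorbit L v = {v + ivec a | a. a \<in> L}"

definition eorbit :: "(int ^ 'd \<Rightarrow> 'e \<Rightarrow> 'e) \<Rightarrow> (int ^ 'd) set \<Rightarrow> 'e \<Rightarrow> 'e set" where
  "eorbit shift L e = {shift a e | a. a \<in> L}"

text \<open>
  The quotient by a subgroup \<open>L\<close> of the period lattice. Weight and potential are constant on
  orbits, so the choice of representatives does not matter.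
\<close>

definition quotient_graph ::
  "(real ^ 'd, 'e) wgraph \<Rightarrow> (int ^ 'd \<Rightarrow> 'e \<Rightarrow> 'e) \<Rightarrow> (int ^ 'd) set
     \<Rightarrow> ((real ^ 'd) set, 'e set) wgraph" where
  "quotient_graph G shift L =
     \<lparr> verts = vorbit L ` verts G,
       edges = eorbit shift L ` edges G,
       ends = (\<lambda>X. vorbit L ` (\<Union>e\<in>X. ends G e)),
       weight = (\<lambda>X. weight G (SOME e. e \<in> X)),
       pot = (\<lambda>U. pot G (SOME v. v \<in> U)) \<rparr>"

abbreviation fundamental_graph ::
  "(real ^ 'd, 'e) wgraph \<Rightarrow> (int ^ 'd \<Rightarrow> 'e \<Rightarrow> 'e) \<Rightarrow> ((real ^ 'd) set, 'e set) wgraph" where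
  "fundamental_graph G shift \<equiv> quotient_graph G shift UNIV"

locale periodic_schroedinger =
  fixes G :: "(real ^ 'd, 'e) wgraph"
    and shift :: "int ^ 'd \<Rightarrow> 'e \<Rightarrow> 'e"
  assumes infinite_verts: "infinite (verts G)"
    and ends: "\<And>e. e \<in> edges G \<Longrightarrow> \<exists>u\<in>verts G. \<exists>v\<in>verts G. ends G e = {u, v}"
    and connected: "connected_graph G"
    and verts_shift: "\<And>v a. v \<in> verts G \<Longrightarrow> v + ivec a \<in> verts G"
    and edges_shift: "\<And>e a. e \<in> edges G \<Longrightarrow> shift a e \<in> edges G"
    and shift_zero: "\<And>e. e \<in> edges G \<Longrightarrow> shift 0 e = e"
    and shift_add: "\<And>e a b. e \<in> edges G \<Longrightarrow> shift (a + b) e = shift a (shift b e)"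
    and ends_shift: "\<And>e a. e \<in> edges G \<Longrightarrow> ends G (shift a e) = (\<lambda>v. v + ivec a) ` ends G e"
    and finite_verts_fundamental: "finite (verts (fundamental_graph G shift))"
    and finite_edges_fundamental: "finite (edges (fundamental_graph G shift))"
    and weight_pos: "\<And>e. e \<in> edges G \<Longrightarrow> 0 < weight G e"
    and weight_shift: "\<And>e a. e \<in> edges G \<Longrightarrow> weight G (shift a e) = weight G e"
    and pot_shift: "\<And>v a. v \<in> verts G \<Longrightarrow> pot G (v + ivec a) = pot G v"


section \<open>Band functions and band edges\<close>

definition floquet_space :: "(real ^ 'd, 'e) wgraph \<Rightarrow> real ^ 'd \<Rightarrow> (real ^ 'd \<Rightarrow> complex) set" where
  "floquet_space G k =
     {f. (\<forall>v. v \<notin> verts G \<longrightarrow> f v = 0) \<and>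
         (\<forall>v\<in>verts G. \<forall>a. f (v + ivec a) = exp (\<i> * of_real (ivec a \<bullet> k)) * f v)}"

text \<open>
  The multiplicity of the real number \<open>x\<close> as an eigenvalue of the Floquet operator \<open>H(k)\<close>: the
  complex dimension of its eigenspace (zero if \<open>x\<close> is not an eigenvalue). As \<open>H(k)\<close> is
  self-adjoint, all eigenvalues are real and geometric and algebraic multiplicities agree.
\<close>

definition floquet_mult :: "(real ^ 'd, 'e) wgraph \<Rightarrow> real ^ 'd \<Rightarrow> real \<Rightarrow> nat" where
  "floquet_mult G k x =
     vector_space.dim (\<lambda>(c :: complex) f v. c * f v)
       {f \<in> floquet_space G k. schroedinger G f = (\<lambda>v. of_real x * f v)}"

definition floquet_eigenvalues :: "(real ^ 'd, 'e) wgraph \<Rightarrow> real ^ 'd \<Rightarrow> real list" where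
  "floquet_eigenvalues G k =
     (THE xs. sorted xs \<and> (\<forall>x. count_list xs x = floquet_mult G k x))"

text \<open>Band functions are numbered from 1.\<close>

definition band :: "(real ^ 'd, 'e) wgraph \<Rightarrow> nat \<Rightarrow> real ^ 'd \<Rightarrow> real" where
  "band G j k = floquet_eigenvalues G k ! (j - 1)"

definition band_min :: "(real ^ 'd, 'e) wgraph \<Rightarrow> (real ^ 'd) set \<Rightarrow> nat \<Rightarrow> real" where
  "band_min G K j = (LEAST x. x \<in> band G j ` K)"

definition band_max :: "(real ^ 'd, 'e) wgraph \<Rightarrow> (real ^ 'd) set \<Rightarrow> nat \<Rightarrow> real" where
  "band_max G K j = (GREATEST x. x \<in> band G j ` K)"

definition brillouin :: "(real ^ 'd) set" where
  "brillouin = {k. \<forall>i. - pi < k $ i \<and> k $ i \<le> pi}"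

definition min_points :: "(real ^ 'd, 'e) wgraph \<Rightarrow> nat \<Rightarrow> (real ^ 'd) set" where
  "min_points G j = {k \<in> brillouin. band G j k = band_min G brillouin j}"

definition max_points :: "(real ^ 'd, 'e) wgraph \<Rightarrow> nat \<Rightarrow> (real ^ 'd) set" where
  "max_points G j = {k \<in> brillouin. band G j k = band_max G brillouin j}"


section \<open>Primitive sets and subcoverings\<close>

definition lattice_basis :: "(int ^ 'd) set \<Rightarrow> bool" where
  "lattice_basis S \<longleftrightarrow> finite S \<and>
     (\<forall>x. \<exists>!c. (\<forall>s. s \<notin> S \<longrightarrow> c s = 0) \<and> x = (\<Sum>s\<in>S. c s *s s))"

text \<open>
  A set of \<open>CARD('o)\<close> lattice vectors is given by its chiral matrix, whose rows are these vectors.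
\<close>

definition primitive :: "int ^ 'd ^ 'o \<Rightarrow> bool" where
  "primitive T \<longleftrightarrow> CARD('o) < CARD('d) \<and> inj (\<lambda>i. row i T) \<and>
     (\<exists>S. rows T \<subseteq> S \<and> lattice_basis S)"

definition row_lattice :: "int ^ 'd ^ 'o \<Rightarrow> (int ^ 'd) set" where
  "row_lattice T = {\<Sum>i\<in>UNIV. m i *s row i T | m. True}"

abbreviation subcovering ::
  "(real ^ 'd, 'e) wgraph \<Rightarrow> (int ^ 'd \<Rightarrow> 'e \<Rightarrow> 'e) \<Rightarrow> int ^ 'd ^ 'o
     \<Rightarrow> ((real ^ 'd) set, 'e set) wgraph" where
  "subcovering G shift T \<equiv> quotient_graph G shift (row_lattice T)"

definition real_matrix :: "int ^ 'd ^ 'o \<Rightarrow> real ^ 'd ^ 'o" where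
  "real_matrix T = (\<chi> i j. real_of_int (T $ i $ j))"

definition two_pi_lattice :: "(real ^ 'o) set" where
  "two_pi_lattice = {(2 * pi) *\<^sub>R ivec n | n. True}"

definition brillouin_sub :: "int ^ 'd ^ 'o \<Rightarrow> (real ^ 'd) set" where
  "brillouin_sub T = {k \<in> brillouin. real_matrix T *v k \<in> two_pi_lattice}"

definition smallest_singular_value :: "int ^ 'd ^ 'o \<Rightarrow> real" where
  "smallest_singular_value T =
     sqrt (LEAST x. \<exists>v. v \<noteq> 0 \<and>
       (real_matrix T ** transpose (real_matrix T)) *v v = x *\<^sub>R v)"

end

theory Submission
  imports Defs
begin

text \<open>
  On Floquet functions with quasimomentum \<open>k\<close> the operator is a Hermitian matrix depending
  continuously and periodically on \<open>k\<close>, so Weyl's inequality makes the bands continuous. A basis of the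
  lattice extending the rows of \<open>T\<close> shows that, modulo \<open>2 * pi\<close>, the quasimomenta of the subcovering
  form the linear space orthogonal to these rows. This gives connectedness of the images of the bands;
  a least-norm solution of \<open>T x = r\<close> gives their density at scale \<open>1 / \<tau>\<close>.

  For the spectrum, no direct integral is needed: on finitely supported functions the Bloch
  transform can be sampled at finitely many quasimomenta, and Parseval on this grid bounds a
  polynomial of the operator by its supremum on the bands. Off the bands, \<open>I - s (H - z) (H - cnj z)\<close>
  is a contraction for small \<open>s\<close>, and a Neumann series inverts \<open>H - z\<close>. On the bands, truncated Bloch
  eigenfunctions contradict a bounded inverse.
\<close>

section \<open>Hermitian matrices indexed by a finite set\<close>

text \<open>The parameter \<open>z\<close> may lie in a gap between two bands, where
  \<open>1 - c * (H - z)\<close> is contractive for no \<open>c\<close>. The quadratic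
  \<open>1 - s * |x - z|^2\<close> is small on all bands at once: band values are real and lie at
  distance between some \<open>e > 0\<close> and some \<open>M\<close> from \<open>z\<close>, so
  \<open>s = 1 / M^2\<close> gives the contraction constant \<open>1 - e^2 / M^2\<close>. Its two
  commuting factors give injectivity and surjectivity of \<open>H - z\<close> separately.

  Sampling is exact because a finitely supported function and its image under the polynomial lie in
  one finite box; a grid with more points per direction than the box is wide makes the characters
  orthogonal. Locality (each value of \<open>H f\<close> depends on finitely many values of
  \<open>f\<close>) replaces limits in the passage to square-summable functions.

  Primitivity acts through a splitting of the period lattice: the basis vectors outside the rows
  span a complement, which is the period lattice of the subcovering. Vectors are functions on a set
  that depends on the graph, so eigenvectors are found by minimising the quadratic form over a
  compact set of functions.\<close>

lemma underdetermined_system_nontrivial: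
  fixes a :: "'j \<Rightarrow> 'i \<Rightarrow> 'f::field"
  assumes "finite J" "finite I" "card J < card I"
  shows "\<exists>c. (\<exists>i\<in>I. c i \<noteq> 0) \<and> (\<forall>i. i \<notin> I \<longrightarrow> c i = 0) \<and> (\<forall>j\<in>J. (\<Sum>i\<in>I. a j i * c i) = 0)"
  using assms
proof (induction J arbitrary: I a rule: finite_induct)
  case empty
  then obtain i where i: "i \<in> I" by fastforce
  show ?case
    by (rule exI[of _ "\<lambda>x. if x = i then 1 else 0"]) (use i in auto)
next
  case (insert j J)
  show ?case
  proof (cases "\<forall>i\<in>I. a j i = 0")
    case True
    from insert.IH[OF insert.prems(1), of a] insert.prems(2) insert.hyps
    obtain c where c: "\<exists>i\<in>I. c i \<noteq> 0" "\<forall>i. i \<notin> I \<longrightarrow> c i = 0" "\<forall>j\<in>J. (\<Sum>i\<in>I. a j i * c i) = 0"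
      by auto
    have "(\<Sum>i\<in>I. a j i * c i) = 0"
      using True by simp
    then show ?thesis
      using c by auto
  next
    case False
    then obtain l where l: "l \<in> I" "a j l \<noteq> 0" by auto
    define I' where "I' = I - {l}"
    have I': "finite I'" "card J < card I'" "l \<notin> I'"
      using insert.prems insert.hyps l by (auto simp: I'_def)
    have I: "I = insert l I'"
      using l by (auto simp: I'_def)
    \<comment> \<open>Gaussian elimination: equation \<open>j\<close> is solved for the unknown
      \<open>l\<close>, and \<open>b\<close> holds the coefficients of the other equations after
      substitution.\<close>
    define b where "b = (\<lambda>h i. a h i - a h l * a j i / a j l)"
    from insert.IH[OF I'(1,2), of b]
    obtain c where c: "\<exists>i\<in>I'. c i \<noteq> 0" "\<forall>i. i \<notin> I' \<longrightarrow> c i = 0" "\<forall>h\<in>J. (\<Sum>i\<in>I'. b h i * c i) = 0"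
      by blast
    define t where "t = - (\<Sum>i\<in>I'. a j i * c i) / a j l"
    define c' where "c' = c(l := t)"
    have s: "(\<Sum>i\<in>I. a h i * c' i) = a h l * t + (\<Sum>i\<in>I'. a h i * c i)" for h
    proof -
      have "(\<Sum>i\<in>I'. a h i * c' i) = (\<Sum>i\<in>I'. a h i * c i)"
        using I'(3) by (intro sum.cong) (auto simp: c'_def)
      then show ?thesis
        using I' by (simp add: I c'_def)
    qed
    have "(\<Sum>i\<in>I. a j i * c' i) = 0"
      unfolding s using l by (simp add: t_def)
    moreover have "(\<Sum>i\<in>I. a h i * c' i) = 0" if "h \<in> J" for h
    proof -
      have "0 = (\<Sum>i\<in>I'. b h i * c i)"
        using c(3) that by simp
      also have "\<dots> = (\<Sum>i\<in>I'. a h i * c i) - (\<Sum>i\<in>I'. a h l / a j l * (a j i * c i))"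
        unfolding sum_subtractf[symmetric] by (intro sum.cong) (auto simp: b_def algebra_simps)
      also have "\<dots> = (\<Sum>i\<in>I'. a h i * c i) - a h l / a j l * (\<Sum>i\<in>I'. a j i * c i)"
        by (simp add: sum_distrib_left)
      finally show ?thesis
        unfolding s by (simp add: t_def)
    qed
    moreover have "\<exists>i\<in>I. c' i \<noteq> 0" "\<forall>i. i \<notin> I \<longrightarrow> c' i = 0"
      using c(1,2) I'(3) by (auto simp: I c'_def)
    ultimately show ?thesis
      by (intro exI[of _ c']) auto
  qed
qed

text \<open>The index set will be the set of orbit representatives, which depends on the graph and
  is not a type; hence vectors and matrices are functions, paired over a set
  \<open>R\<close>.\<close>

definition finner :: "'a set \<Rightarrow> ('a \<Rightarrow> complex) \<Rightarrow> ('a \<Rightarrow> complex) \<Rightarrow> complex" where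
  "finner R f g = (\<Sum>x\<in>R. f x * cnj (g x))"

definition mat_op :: "'a set \<Rightarrow> ('a \<Rightarrow> 'a \<Rightarrow> complex) \<Rightarrow> ('a \<Rightarrow> complex) \<Rightarrow> 'a \<Rightarrow> complex" where
  "mat_op R M f x = (if x \<in> R then \<Sum>y\<in>R. M x y * f y else 0)"

definition hermitian_on :: "'a set \<Rightarrow> ('a \<Rightarrow> 'a \<Rightarrow> complex) \<Rightarrow> bool" where
  "hermitian_on R M \<longleftrightarrow> (\<forall>x\<in>R. \<forall>y\<in>R. M x y = cnj (M y x))"

lemma finner_add_left: "finner R (\<lambda>x. f x + g x) h = finner R f h + finner R g h"
  by (simp add: finner_def ring_distribs sum.distrib)

lemma finner_diff_left: "finner R (\<lambda>x. f x - g x) h = finner R f h - finner R g h"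
  by (simp add: finner_def ring_distribs sum_subtractf)

lemma finner_scale_left: "finner R (\<lambda>x. c * f x) h = c * finner R f h"
  by (simp add: finner_def sum_distrib_left mult_ac)

lemma finner_sum_left: "finner R (\<lambda>x. \<Sum>i\<in>I. c i * f i x) h = (\<Sum>i\<in>I. c i * finner R (f i) h)"
  by (simp add: finner_def sum_distrib_left sum_distrib_right mult_ac) (rule sum.swap)

lemma cnj_finner: "cnj (finner R f g) = finner R g f"
  by (simp add: finner_def mult_ac)

lemma finner_add_right: "finner R h (\<lambda>x. f x + g x) = finner R h f + finner R h g"
  by (simp add: finner_def ring_distribs sum.distrib)

lemma finner_diff_right: "finner R h (\<lambda>x. f x - g x) = finner R h f - finner R h g"
  by (simp add: finner_def ring_distribs sum_subtractf)

lemma finner_scale_right: "finner R h (\<lambda>x. c * f x) = cnj c * finner R h f"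
  by (simp add: finner_def sum_distrib_left mult_ac)

lemma finner_self: "finner R f f = of_real (\<Sum>x\<in>R. (cmod (f x))\<^sup>2)"
  unfolding finner_def of_real_sum
  by (intro sum.cong) (auto simp: complex_norm_square[symmetric])

lemma finner_self_eq_0:
  assumes "finite R" "finner R f f = 0" "x \<in> R"
  shows "f x = 0"
proof -
  have "(\<Sum>x\<in>R. (cmod (f x))\<^sup>2) = 0"
    using assms(2) unfolding finner_self of_real_eq_0_iff .
  then show ?thesis
    using assms by (simp add: sum_nonneg_eq_0_iff)
qed

lemma finner_cong:
  "(\<And>x. x \<in> R \<Longrightarrow> f x = f' x) \<Longrightarrow> (\<And>x. x \<in> R \<Longrightarrow> g x = g' x) \<Longrightarrow> finner R f g = finner R f' g'"
  by (simp add: finner_def)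

lemma mat_op_hermitian:
  assumes "hermitian_on R M"
  shows "finner R (mat_op R M f) g = finner R f (mat_op R M g)"
proof -
  have "finner R (mat_op R M f) g = (\<Sum>x\<in>R. \<Sum>y\<in>R. M x y * f y * cnj (g x))"
    by (simp add: finner_def mat_op_def sum_distrib_right)
  also have "\<dots> = (\<Sum>y\<in>R. \<Sum>x\<in>R. M x y * f y * cnj (g x))"
    by (rule sum.swap)
  also have "\<dots> = (\<Sum>y\<in>R. \<Sum>x\<in>R. f y * cnj (M y x * g x))"
  proof (intro sum.cong refl)
    fix x y assume "x \<in> R" "y \<in> R"
    then have "M x y = cnj (M y x)"
      using assms unfolding hermitian_on_def by blast
    then show "M x y * f y * cnj (g x) = f y * cnj (M y x * g x)"
      by (simp add: mult_ac)
  qed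
  also have "\<dots> = finner R f (mat_op R M g)"
    by (simp add: finner_def mat_op_def sum_distrib_left)
  finally show ?thesis .
qed

lemma mat_op_lincomb:
  "mat_op R M (\<lambda>x. \<Sum>i\<in>I. c i * f i x) x = (\<Sum>i\<in>I. c i * mat_op R M (f i) x)"
proof (cases "x \<in> R")
  case True
  have "mat_op R M (\<lambda>x. \<Sum>i\<in>I. c i * f i x) x = (\<Sum>y\<in>R. \<Sum>i\<in>I. c i * (M x y * f i y))"
    using True by (simp add: mat_op_def sum_distrib_left mult.left_commute)
  also have "\<dots> = (\<Sum>i\<in>I. \<Sum>y\<in>R. c i * (M x y * f i y))"
    by (rule sum.swap)
  finally show ?thesis
    using True by (simp add: mat_op_def sum_distrib_left)
qed (simp add: mat_op_def)

section \<open>Spectral theorem by successive minimisation\<close>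

lemma compact_supported_ball:
  assumes "finite R"
  shows "compact {f :: 'a \<Rightarrow> complex. (\<forall>x\<in>R. cmod (f x) \<le> 1) \<and> (\<forall>x. x \<notin> R \<longrightarrow> f x = 0)}"
proof -
  define S :: "'a \<Rightarrow> complex set" where "S = (\<lambda>x. if x \<in> R then cball 0 1 else {0})"
  \<comment> \<open>Tychonoff in the product topology: a closed disc for each point of
    \<open>R\<close>, a single point elsewhere. This stands in for finite-dimensional
    compactness.\<close>
  have "compactin (product_topology (\<lambda>_. euclidean) UNIV) (PiE UNIV S)"
    by (auto simp: compactin_PiE S_def)
  then have "compact (PiE UNIV S)"
    by (simp add: euclidean_product_topology)
  also have "PiE UNIV S = {f. (\<forall>x\<in>R. cmod (f x) \<le> 1) \<and> (\<forall>x. x \<notin> R \<longrightarrow> f x = 0)}"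
    by (auto simp: S_def PiE_def Pi_def split: if_splits)
  finally show ?thesis .
qed

lemma continuous_on_finner [continuous_intros]:
  assumes "\<And>x. x \<in> R \<Longrightarrow> continuous_on S (\<lambda>g. F g x)" "\<And>x. x \<in> R \<Longrightarrow> continuous_on S (\<lambda>g. E g x)"
  shows "continuous_on S (\<lambda>g. finner R (F g) (E g))"
  unfolding finner_def using assms by (intro continuous_intros) auto

text \<open>The first-variation argument at a minimum: a quadratic gain cannot compensate a linear
  loss for small steps. It serves both the Hermitian forms and the Gram matrix of the rows.\<close>

lemma first_order_term_zero:
  fixes a s :: real
  assumes key: "\<And>t. 2 * t * a \<le> t * t * s" and "0 \<le> a"
  shows "a = 0"
proof (rule ccontr)
  assume "a \<noteq> 0"
  with assms have pos: "a > 0" by simp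
  have "2 * a \<le> s" using key[of 1] by simp
  with pos have "s > 0" by simp
  \<comment> \<open>The step \<open>a / s\<close> minimises
    \<open>t * t * s - 2 * t * a\<close>.\<close>
  have "2 * (a / s) * a \<le> (a / s) * (a / s) * s"
    by (rule key)
  then have "2 * (a * a / s) \<le> a * a / s"
    using \<open>s > 0\<close> by simp
  moreover have "a * a / s > 0"
    using pos \<open>s > 0\<close> by simp
  ultimately show False by simp
qed

text \<open>The eigenvector minimises the quadratic form over unit vectors orthogonal to the
  eigenvectors already found. The residual of its eigenvalue equation satisfies the same
  constraints, so it is an allowed direction of variation and must vanish. The minimum property
  itself is returned because the ordering of the eigenvalues and Weyl's inequality rest on
  it.\<close>

lemma hermitian_constrained_minimum:
  assumes R: "finite R" and M: "hermitian_on R M"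
    and u: "\<And>i. i < (m::nat) \<Longrightarrow> (\<forall>x\<in>R. mat_op R M (u i) x = of_real (\<mu> i) * u i x)"
    and m: "m < card R"
  shows "\<exists>g l. (\<forall>x. x \<notin> R \<longrightarrow> g x = 0) \<and> finner R g g = 1 \<and> (\<forall>i<m. finner R g (u i) = 0) \<and>
           (\<forall>x\<in>R. mat_op R M g x = of_real l * g x) \<and>
           (\<forall>h. (\<forall>i<m. finner R h (u i) = 0) \<longrightarrow>
              l * Re (finner R h h) \<le> Re (finner R (mat_op R M h) h))"
proof -
  define B where "B = {f :: 'a \<Rightarrow> complex. (\<forall>x\<in>R. cmod (f x) \<le> 1) \<and> (\<forall>x. x \<notin> R \<longrightarrow> f x = 0)}"
  define W where "W = {f. finner R f f = 1} \<inter> (\<Inter>i\<in>{..<m}. {f. finner R f (u i) = 0})"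
  define Q where "Q = (\<lambda>f. Re (finner R (mat_op R M f) f))"
  have cont: "continuous_on A (\<lambda>f. f x)" for x :: 'a and A :: "('a \<Rightarrow> complex) set"
    by (rule continuous_on_product_coordinates[THEN continuous_on_subset]) auto
  have "closed {f. finner R f f = 1}"
    by (intro closed_Collect_eq continuous_intros cont)
  moreover have "closed (\<Inter>i\<in>{..<m}. {f. finner R f (u i) = 0})"
    by (intro closed_INT ballI closed_Collect_eq continuous_intros cont)
  ultimately have "closed W"
    by (auto simp: W_def)
  then have cpt: "compact (B \<inter> W)"
    using compact_supported_ball[OF R] by (auto simp: B_def intro: compact_Int_closed)
  have contQ: "continuous_on (B \<inter> W) Q"
    unfolding Q_def
  proof (intro continuous_intros cont)
    fix x assume "x \<in> R"
    then show "continuous_on (B \<inter> W) (\<lambda>f. mat_op R M f x)"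
      by (auto simp: mat_op_def intro!: continuous_intros cont)
  qed
  have normalise: "\<exists>g c. g \<in> B \<inter> W \<and> c > 0 \<and> (\<forall>x\<in>R. h x = of_real c * g x)"
    if h: "\<forall>i<m. finner R h (u i) = 0" "x0 \<in> R" "h x0 \<noteq> 0" for h x0
  proof -
    define N where "N = (\<Sum>x\<in>R. (cmod (h x))\<^sup>2)"
    have N: "N > 0"
      unfolding N_def by (rule sum_pos2[OF R h(2)]) (use h(3) in auto)
    define g where "g = (\<lambda>x. if x \<in> R then of_real (1 / sqrt N) * h x else 0)"
    have g: "finner R g f = of_real (1 / sqrt N) * finner R h f" for f
      unfolding finner_scale_left[symmetric] by (rule finner_cong) (auto simp: g_def)
    have "finner R g g = of_real (1 / sqrt N) * cnj (of_real (1 / sqrt N) * finner R h h)"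
      unfolding g by (subst cnj_finner[symmetric], subst g) simp
    also have "\<dots> = of_real (1 / sqrt N * (1 / sqrt N) * N)"
      unfolding finner_self N_def[symmetric]
      by (simp only: of_real_mult complex_cnj_mult complex_cnj_complex_of_real mult.assoc)
    also have "1 / sqrt N * (1 / sqrt N) * N = 1"
      using N by (simp add: field_simps)
    finally have gg: "finner R g g = 1" by simp
    have "cmod (g x) \<le> 1" if "x \<in> R" for x
    proof -
      have "(cmod (g x))\<^sup>2 \<le> (\<Sum>x\<in>R. (cmod (g x))\<^sup>2)"
        by (rule member_le_sum) (use R that in auto)
      also have "\<dots> = 1"
        using gg unfolding finner_self by (metis of_real_eq_1_iff)
      finally show ?thesis
        by (simp add: abs_square_le_1)
    qed
    moreover have "\<forall>x\<in>R. h x = of_real (sqrt N) * g x"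
      using N by (auto simp: g_def)
    moreover have "\<forall>x. x \<notin> R \<longrightarrow> g x = 0"
      by (simp add: g_def)
    moreover have "\<forall>i<m. finner R g (u i) = 0"
      using h(1) by (simp add: g)
    moreover have "sqrt N > 0"
      using N by simp
    ultimately show ?thesis
      using gg unfolding B_def W_def by blast
  qed
  \<comment> \<open>Fewer constraints than dimensions: some nonzero vector satisfies them all, so
    the set to minimise over is not empty.\<close>
  obtain c0 where c0: "\<exists>x\<in>R. c0 x \<noteq> 0" "\<forall>j\<in>{..<m}. (\<Sum>x\<in>R. cnj (u j x) * c0 x) = 0"
    using underdetermined_system_nontrivial[of "{..<m}" R "\<lambda>j x. cnj (u j x)"] R m by auto
  have "B \<inter> W \<noteq> {}"
    using normalise[of c0] c0 by (auto simp: finner_def mult.commute)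
  then obtain g where g: "g \<in> B \<inter> W" "\<And>f. f \<in> B \<inter> W \<Longrightarrow> Q g \<le> Q f"
    using continuous_attains_inf[OF cpt _ contQ] by blast
  define l where "l = Q g"
  have g1: "finner R g g = 1" and gu: "\<forall>i<m. finner R g (u i) = 0" and gR: "\<forall>x. x \<notin> R \<longrightarrow> g x = 0"
    using g(1) by (auto simp: W_def B_def)
  have low: "l * Re (finner R h h) \<le> Q h" if h: "\<forall>i<m. finner R h (u i) = 0" for h
  proof (cases "\<exists>x0\<in>R. h x0 \<noteq> 0")
    case True
    then obtain f c where f: "f \<in> B \<inter> W" "c > 0" "\<forall>x\<in>R. h x = of_real c * f x"
      using normalise[OF h] by blast
    have "finner R h h = finner R (\<lambda>x. of_real c * f x) (\<lambda>x. of_real c * f x)"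
      by (rule finner_cong) (use f in auto)
    also have "\<dots> = of_real (c * c)"
      using f(1) by (simp add: finner_scale_left finner_scale_right W_def)
    finally have hh: "finner R h h = of_real (c * c)" .
    have "finner R (mat_op R M h) h = finner R (\<lambda>x. of_real c * mat_op R M f x) (\<lambda>x. of_real c * f x)"
      by (rule finner_cong) (use f in \<open>auto simp: mat_op_def sum_distrib_left mult_ac intro!: sum.cong\<close>)
    also have "\<dots> = of_real (c * c) * finner R (mat_op R M f) f"
      by (simp add: finner_scale_left finner_scale_right)
    finally have "Q h = c * c * Q f"
      by (simp add: Q_def)
    then show ?thesis
      using g(2)[OF f(1)] hh f(2) by (simp add: l_def mult.commute mult_left_mono)
  next
    case False
    then have "finner R h h = 0" "finner R (mat_op R M h) h = 0"
      by (auto simp: finner_def)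
    then show ?thesis by (simp add: Q_def)
  qed
  define N where "N = (\<lambda>x. mat_op R M g x - of_real l * g x)"
  \<comment> \<open>\<open>M\<close> is Hermitian and \<open>u i\<close> is an eigenvector, so the
    image of \<open>g\<close> stays orthogonal to \<open>u i\<close>.\<close>
  have Nu: "finner R N (u i) = 0" if i: "i < m" for i
  proof -
    have "finner R (mat_op R M g) (u i) = finner R g (\<lambda>x. of_real (\<mu> i) * u i x)"
      unfolding mat_op_hermitian[OF M] by (rule finner_cong) (use u[OF i] in auto)
    then show ?thesis
      using gu i by (simp add: N_def finner_diff_left finner_scale_left finner_scale_right)
  qed
  \<comment> \<open>A Hermitian form is real on the diagonal, so taking the real part in
    \<open>Q\<close> loses nothing.\<close>
  have Qg: "finner R N g = 0"
  proof -
    have "cnj (finner R (mat_op R M g) g) = finner R (mat_op R M g) g"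
      unfolding cnj_finner mat_op_hermitian[OF M] ..
    then have "finner R (mat_op R M g) g = of_real l"
      unfolding l_def Q_def by (simp add: complex_eq_iff)
    then show ?thesis
      by (simp add: N_def finner_diff_left finner_scale_left g1)
  qed
  define n2 where "n2 = Re (finner R N N)"
  define s where "s = Q N - l * n2"
  \<comment> \<open>Perturbing the minimiser \<open>g\<close> along its residual \<open>N\<close>: the first-order term is the squared norm of \<open>N\<close>.\<close>
  have key: "2 * t * n2 \<le> t * t * s" for t :: real
  proof -
    define h where "h = (\<lambda>x. g x - of_real t * N x)"
    have "\<forall>i<m. finner R h (u i) = 0"
      using gu Nu by (simp add: h_def finner_diff_left finner_scale_left)
    then have "l * Re (finner R h h) \<le> Q h"
      by (rule low)
    then have *: "0 \<le> Re (finner R (mat_op R M h) h - of_real l * finner R h h)"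
      by (simp add: Q_def)
    have Mh: "mat_op R M h = (\<lambda>x. mat_op R M g x - of_real t * mat_op R M N x)"
      by (auto simp: mat_op_def h_def ring_distribs sum_subtractf sum_distrib_left mult_ac fun_eq_iff)
    have MN: "finner R (mat_op R M N) g = finner R N N + of_real l * finner R N g"
    proof -
      have "finner R (mat_op R M N) g = finner R N (\<lambda>x. N x + of_real l * g x)"
        unfolding mat_op_hermitian[OF M] by (rule finner_cong) (auto simp: N_def)
      then show ?thesis by (simp add: finner_add_right finner_scale_right)
    qed
    have gN: "finner R g N = 0"
      using Qg cnj_finner[of R N g] by simp
    have Mg: "finner R (mat_op R M g) h = finner R N h + of_real l * finner R g h" for h
      by (simp add: N_def finner_diff_left finner_scale_left)
    have "finner R (mat_op R M h) h - of_real l * finner R h h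
        = of_real t * of_real t * (finner R (mat_op R M N) N - of_real l * finner R N N)
          - 2 * of_real t * finner R N N"
      unfolding Mh unfolding h_def
      by (simp add: finner_diff_left finner_diff_right finner_scale_left finner_scale_right MN gN Qg g1 Mg)
        (simp add: algebra_simps)
    from arg_cong[OF this, of Re]
    have "Re (finner R (mat_op R M h) h - of_real l * finner R h h) = t * t * s - 2 * t * n2"
      by (simp add: s_def n2_def Q_def algebra_simps)
    with * show ?thesis by simp
  qed
  have n2_nonneg: "n2 \<ge> 0"
    unfolding n2_def finner_self by (simp add: sum_nonneg)
  have "n2 = 0"
    using key n2_nonneg by (rule first_order_term_zero)
  then have "finner R N N = 0"
    unfolding n2_def finner_self by simp
  then have "\<forall>x\<in>R. mat_op R M g x = of_real l * g x"
    using finner_self_eq_0[OF R, of N] by (auto simp: N_def)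
  then show ?thesis
    using g1 gu gR low by (intro exI[of _ g] exI[of _ l]) (auto simp: Q_def)
qed

text \<open>\<open>n\<close> counts the vectors found so far, which allows induction. The last
  clause records the minimum property of each stage; it yields the ordering of the eigenvalues and
  the lower estimate in Weyl's inequality.\<close>

definition eigensystem ::
  "'a set \<Rightarrow> ('a \<Rightarrow> 'a \<Rightarrow> complex) \<Rightarrow> nat \<Rightarrow> (nat \<Rightarrow> 'a \<Rightarrow> complex) \<Rightarrow> (nat \<Rightarrow> real) \<Rightarrow> bool" where
  "eigensystem R M n u \<mu> \<longleftrightarrow>
     (\<forall>i<n. \<forall>x. x \<notin> R \<longrightarrow> u i x = 0) \<and>
     (\<forall>i<n. \<forall>j<n. finner R (u i) (u j) = (if i = j then 1 else 0)) \<and>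
     (\<forall>i<n. \<forall>x\<in>R. mat_op R M (u i) x = of_real (\<mu> i) * u i x) \<and>
     (\<forall>j<n. \<forall>h. (\<forall>i<j. finner R h (u i) = 0) \<longrightarrow>
        \<mu> j * Re (finner R h h) \<le> Re (finner R (mat_op R M h) h))"

lemma eigensystem_exists_aux:
  assumes R: "finite R" and M: "hermitian_on R M" and "n \<le> card R"
  shows "\<exists>u \<mu>. eigensystem R M n u \<mu>"
  using \<open>n \<le> card R\<close>
proof (induction n)
  case 0
  show ?case by (auto simp: eigensystem_def)
next
  case (Suc n)
  then obtain u \<mu> where s: "eigensystem R M n u \<mu>" by auto
  have "n < card R" using Suc.prems by simp
  then obtain g l where g:
    "\<forall>x. x \<notin> R \<longrightarrow> g x = 0" "finner R g g = 1" "\<forall>i<n. finner R g (u i) = 0"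
    "\<forall>x\<in>R. mat_op R M g x = of_real l * g x"
    "\<forall>h. (\<forall>i<n. finner R h (u i) = 0) \<longrightarrow> l * Re (finner R h h) \<le> Re (finner R (mat_op R M h) h)"
    using hermitian_constrained_minimum[OF R M, of n u \<mu>] s unfolding eigensystem_def by metis
  have g': "finner R (u i) g = 0" if "i < n" for i
    using g(3) that cnj_finner[of R g "u i"] by simp
  have "eigensystem R M (Suc n) (u(n := g)) (\<mu>(n := l))"
    using s g g' unfolding eigensystem_def
    by (auto simp: less_Suc_eq)
  then show ?case by blast
qed

lemma eigensystem_exists:
  assumes "finite R" "hermitian_on R M"
  obtains u \<mu> where "eigensystem R M (card R) u \<mu>"
  using eigensystem_exists_aux[OF assms] by blast

text \<open>\<open>u j\<close> was a competitor in the minimisation that produced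
  \<open>\<mu> i\<close>, and its quotient is \<open>\<mu> j\<close>.\<close>

lemma eigensystem_mono:
  assumes s: "eigensystem R M n u \<mu>" and ij: "i \<le> j" "j < n"
  shows "\<mu> i \<le> \<mu> j"
proof -
  have "\<forall>l<i. finner R (u j) (u l) = 0"
    using s ij by (auto simp: eigensystem_def)
  moreover have "i < n" using ij by simp
  ultimately have "\<mu> i * Re (finner R (u j) (u j)) \<le> Re (finner R (mat_op R M (u j)) (u j))"
    using s unfolding eigensystem_def by blast
  moreover have "finner R (mat_op R M (u j)) (u j) = finner R (\<lambda>x. of_real (\<mu> j) * u j x) (u j)"
    by (rule finner_cong) (use s ij in \<open>auto simp: eigensystem_def\<close>)
  moreover have "finner R (u j) (u j) = 1"
    using s ij by (simp add: eigensystem_def)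
  ultimately show ?thesis
    by (simp add: finner_scale_left)
qed

lemma eigensystem_finner_lincomb:
  assumes s: "eigensystem R M n u \<mu>" and I: "I \<subseteq> {..<n}" "finite I" and j: "j < n"
  shows "finner R (\<lambda>x. \<Sum>i\<in>I. c i * u i x) (u j) = (if j \<in> I then c j else 0)"
proof -
  have "finner R (\<lambda>x. \<Sum>i\<in>I. c i * u i x) (u j) = (\<Sum>i\<in>I. c i * finner R (u i) (u j))"
    by (rule finner_sum_left)
  also have "\<dots> = (\<Sum>i\<in>I. if i = j then c i else 0)"
    by (rule sum.cong) (use s I j in \<open>auto simp: eigensystem_def\<close>)
  finally show ?thesis
    using I by simp
qed

text \<open>Completeness by counting: the remainder \<open>p\<close> is orthogonal to all
  \<open>u i\<close>, and together they are one vector more than the dimension. In a linear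
  dependence all coefficients of the \<open>u i\<close> vanish by orthogonality, so \<open>p\<close>
  itself is zero.\<close>

lemma eigensystem_expansion:
  assumes R: "finite R" and s: "eigensystem R M (card R) u \<mu>" and x: "x \<in> R"
  shows "g x = (\<Sum>i<card R. finner R g (u i) * u i x)"
proof -
  define n where "n = card R"
  define p where "p = (\<lambda>x. g x - (\<Sum>i<n. finner R g (u i) * u i x))"
  have pu: "finner R p (u j) = 0" if "j < n" for j
    unfolding p_def finner_diff_left
    using eigensystem_finner_lincomb[OF s, of "{..<n}" j] that by (simp add: n_def)
  define v where "v = u(n := p)"
  obtain c where c: "\<exists>i\<in>{..n}. c i \<noteq> 0" "\<forall>x\<in>R. (\<Sum>i\<in>{..n}. v i x * c i) = 0"
    using underdetermined_system_nontrivial[of R "{..n}" "\<lambda>x i. v i x"] R by (auto simp: n_def)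
  have z: "finner R (\<lambda>x. \<Sum>i\<in>{..n}. c i * v i x) h = 0" for h
    using c(2) by (simp add: finner_def mult.commute[of "c _"])
  have vc: "(\<lambda>x. \<Sum>i\<in>{..n}. c i * v i x) = (\<lambda>x. (\<Sum>i<n. c i * u i x) + c n * p x)"
    by (simp add: v_def lessThan_Suc_atMost[symmetric])
  have cj: "c j = 0" if "j < n" for j
    using z[of "u j"] that pu[OF that] eigensystem_finner_lincomb[OF s, of "{..<n}" j c]
    unfolding vc by (simp add: finner_add_left finner_scale_left n_def)
  then have cn: "c n \<noteq> 0"
    using c(1) by (metis atMost_iff le_neq_implies_less)
  have "c n * finner R p p = 0"
    using z[of p] cj unfolding vc by (simp add: finner_scale_left)
  then have "p x = 0"
    using cn finner_self_eq_0[OF R _ x] by simp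
  then show ?thesis
    by (simp add: p_def n_def)
qed

lemma eigensystem_norm_lincomb:
  assumes s: "eigensystem R M n u \<mu>"
  shows "(\<Sum>x\<in>R. (cmod (\<Sum>i<n. c i * u i x))\<^sup>2) = (\<Sum>i<n. (cmod (c i))\<^sup>2)"
proof -
  define f where "f = (\<lambda>x. \<Sum>i<n. c i * u i x)"
  have "finner R f f = (\<Sum>i<n. c i * finner R (u i) f)"
    unfolding f_def by (rule finner_sum_left)
  also have "\<dots> = (\<Sum>i<n. c i * cnj (finner R f (u i)))"
    by (simp add: cnj_finner)
  also have "\<dots> = (\<Sum>i<n. c i * cnj (c i))"
    by (rule sum.cong) (use eigensystem_finner_lincomb[OF s] in \<open>auto simp: f_def\<close>)
  also have "\<dots> = of_real (\<Sum>i<n. (cmod (c i))\<^sup>2)"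
    unfolding of_real_sum by (intro sum.cong) (auto simp: complex_norm_square[symmetric])
  finally show ?thesis
    unfolding finner_self f_def of_real_eq_iff .
qed

section \<open>Weyl's inequality for perturbed eigenvalues\<close>

lemma cmod_finner_mat_op_le:
  assumes R: "finite R"
  shows "cmod (finner R (mat_op R M h) h) \<le> (\<Sum>x\<in>R. \<Sum>y\<in>R. cmod (M x y)) * Re (finner R h h)"
proof -
  define n where "n = (\<Sum>x\<in>R. (cmod (h x))\<^sup>2)"
  have h: "cmod (h x) \<le> sqrt n" if "x \<in> R" for x
    by (rule real_le_rsqrt) (use R that in \<open>auto simp: n_def intro: member_le_sum\<close>)
  have n0: "n \<ge> 0" by (simp add: n_def sum_nonneg)
  have "finner R (mat_op R M h) h = (\<Sum>x\<in>R. \<Sum>y\<in>R. M x y * h y * cnj (h x))"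
    by (simp add: finner_def mat_op_def sum_distrib_right)
  also have "cmod \<dots> \<le> (\<Sum>x\<in>R. \<Sum>y\<in>R. cmod (M x y * h y * cnj (h x)))"
    by (intro order.trans[OF norm_sum] sum_mono order.refl)
  also have "\<dots> \<le> (\<Sum>x\<in>R. \<Sum>y\<in>R. cmod (M x y) * n)"
  proof (intro sum_mono)
    fix x y assume xy: "x \<in> R" "y \<in> R"
    have "cmod (h y) * cmod (h x) \<le> sqrt n * sqrt n"
      by (rule mult_mono) (use h xy n0 in auto)
    then show "cmod (M x y * h y * cnj (h x)) \<le> cmod (M x y) * n"
      using n0 by (simp add: norm_mult mult.assoc mult_left_mono)
  qed
  finally show ?thesis
    by (simp add: finner_self n_def sum_distrib_right)
qed

text \<open>Some combination of \<open>u 0, \<dots>, u j\<close> is orthogonal to \<open>v 0, \<dots>, v (j - 1)\<close>; compare the two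
  quadratic forms on it.\<close>

lemma weyl_inequality_one_sided:
  assumes R: "finite R" and s: "eigensystem R M n u \<mu>" and t: "eigensystem R M' n v \<kappa>" and j: "j < n"
  shows "\<kappa> j \<le> \<mu> j + (\<Sum>x\<in>R. \<Sum>y\<in>R. cmod (M' x y - M x y))"
proof -
  define C where "C = (\<Sum>x\<in>R. \<Sum>y\<in>R. cmod (M' x y - M x y))"
  obtain c where c: "\<exists>i\<in>{..j}. c i \<noteq> 0" "\<forall>l\<in>{..<j}. (\<Sum>i\<in>{..j}. finner R (u i) (v l) * c i) = 0"
    using underdetermined_system_nontrivial[of "{..<j}" "{..j}" "\<lambda>l i. finner R (u i) (v l)"] by auto
  \<comment> \<open>Padding by zeros up to \<open>n\<close>, so that the lemmas on combinations of
    the whole system apply to a combination of the first \<open>j + 1\<close> vectors.\<close>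
  define d where "d = (\<lambda>i. if i \<le> j then c i else 0)"
  have dsum: "(\<Sum>i<n. d i * f i) = (\<Sum>i\<in>{..j}. c i * f i)" for f :: "nat \<Rightarrow> complex"
    by (rule sum.mono_neutral_cong_right) (use j in \<open>auto simp: d_def\<close>)
  define h where "h = (\<lambda>x. \<Sum>i<n. d i * u i x)"
  have hv: "\<forall>l<j. finner R h (v l) = 0"
    unfolding h_def finner_sum_left dsum using c(2) by (simp add: mult.commute)
  have hu: "finner R h (u i) = d i" if "i < n" for i
    unfolding h_def using eigensystem_finner_lincomb[OF s, of "{..<n}" i d] that by simp
  have N: "Re (finner R h h) = (\<Sum>i<n. (cmod (d i))\<^sup>2)"
    unfolding finner_self h_def eigensystem_norm_lincomb[OF s] by simp
  obtain i where i: "i \<le> j" "c i \<noteq> 0" using c(1) by auto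
  have Npos: "Re (finner R h h) > 0"
    unfolding N by (rule sum_pos2[of _ i]) (use i j in \<open>auto simp: d_def\<close>)
  have "finner R (mat_op R M h) h = finner R (\<lambda>x. \<Sum>i<n. (d i * of_real (\<mu> i)) * u i x) h"
    by (rule finner_cong) (use s in \<open>auto simp: h_def mat_op_lincomb eigensystem_def mult_ac intro!: sum.cong\<close>)
  also have "\<dots> = (\<Sum>i<n. d i * of_real (\<mu> i) * finner R (u i) h)"
    by (rule finner_sum_left)
  also have "\<dots> = (\<Sum>i<n. of_real (\<mu> i * (cmod (d i))\<^sup>2))"
  proof (rule sum.cong[OF refl])
    fix i assume "i \<in> {..<n}"
    then have "finner R (u i) h = cnj (d i)"
      using hu[of i] by (metis cnj_finner lessThan_iff)
    then show "d i * of_real (\<mu> i) * finner R (u i) h = of_real (\<mu> i * (cmod (d i))\<^sup>2)"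
      by (simp add: complex_norm_square mult_ac del: of_real_power)
  qed
  finally have "Re (finner R (mat_op R M h) h) = (\<Sum>i<n. \<mu> i * (cmod (d i))\<^sup>2)"
    by simp
  \<comment> \<open>Indices above \<open>j\<close> carry weight zero; up to \<open>j\<close> the
    eigenvalues are at most \<open>\<mu> j\<close>.\<close>
  also have "\<dots> \<le> (\<Sum>i<n. \<mu> j * (cmod (d i))\<^sup>2)"
  proof (rule sum_mono)
    fix i assume "i \<in> {..<n}"
    show "\<mu> i * (cmod (d i))\<^sup>2 \<le> \<mu> j * (cmod (d i))\<^sup>2"
      using eigensystem_mono[OF s, of i j] j by (cases "i \<le> j") (auto simp: d_def mult_right_mono)
  qed
  finally have up: "Re (finner R (mat_op R M h) h) \<le> \<mu> j * Re (finner R h h)"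
    by (simp add: N sum_distrib_left)
  have low: "\<kappa> j * Re (finner R h h) \<le> Re (finner R (mat_op R M' h) h)"
    using t j hv unfolding eigensystem_def by blast
  have "finner R (mat_op R M' h) h - finner R (mat_op R M h) h = finner R (mat_op R (\<lambda>x y. M' x y - M x y) h) h"
    unfolding finner_diff_left[symmetric]
    by (rule finner_cong) (auto simp: mat_op_def ring_distribs sum_subtractf)
  then have "Re (finner R (mat_op R M' h) h) - Re (finner R (mat_op R M h) h)
      \<le> cmod (finner R (mat_op R (\<lambda>x y. M' x y - M x y) h) h)"
    by (metis complex_Re_le_cmod minus_complex.sel(1))
  also have "\<dots> \<le> C * Re (finner R h h)"
    unfolding C_def by (rule cmod_finner_mat_op_le[OF R])
  finally have "\<kappa> j * Re (finner R h h) \<le> (\<mu> j + C) * Re (finner R h h)"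
    using up low by (simp add: ring_distribs)
  then show ?thesis
    using Npos by (simp add: C_def)
qed

lemma weyl_inequality:
  assumes "finite R" "eigensystem R M n u \<mu>" "eigensystem R M' n v \<kappa>" "j < n"
  shows "\<bar>\<kappa> j - \<mu> j\<bar> \<le> (\<Sum>x\<in>R. \<Sum>y\<in>R. cmod (M' x y - M x y))"
  using weyl_inequality_one_sided[OF assms] weyl_inequality_one_sided[OF assms(1,3,2,4)]
  by (simp add: norm_minus_commute[of "M _ _"] abs_le_iff)

section \<open>Linear operators of finite range\<close>

abbreviation delta :: "'a \<Rightarrow> 'a \<Rightarrow> complex" where "delta y \<equiv> \<lambda>z. if z = y then 1 else 0"

definition lin_op :: "(('a \<Rightarrow> complex) \<Rightarrow> 'a \<Rightarrow> complex) \<Rightarrow> bool" where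
  "lin_op A \<longleftrightarrow> (\<forall>c f g. A (\<lambda>y. c * f y + g y) = (\<lambda>y. c * A f y + A g y))"

text \<open>Finite range without any norm: the operators are applied to arbitrary functions, among
  them Floquet functions, which need not be square-summable.\<close>

definition local_op :: "(('a \<Rightarrow> complex) \<Rightarrow> 'a \<Rightarrow> complex) \<Rightarrow> bool" where
  "local_op A \<longleftrightarrow> (\<forall>x. \<exists>F. finite F \<and> (\<forall>f g. (\<forall>y\<in>F. f y = g y) \<longrightarrow> A f x = A g x))"

lemma lin_op_zero: "lin_op A \<Longrightarrow> A (\<lambda>y. 0) = (\<lambda>y. 0)"
  unfolding lin_op_def
  by (drule spec[of _ "-1"], drule spec[of _ "\<lambda>y. 0"], drule spec[of _ "\<lambda>y. 0"]) (simp add: fun_eq_iff)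

lemma lin_op_scale: "lin_op A \<Longrightarrow> A (\<lambda>y. c * f y) = (\<lambda>y. c * A f y)"
  using lin_op_zero[of A] unfolding lin_op_def
  by (metis (no_types, lifting) add.right_neutral ext)

lemma lin_op_add: "lin_op A \<Longrightarrow> A (\<lambda>y. f y + g y) = (\<lambda>y. A f y + A g y)"
  unfolding lin_op_def by (drule spec[of _ 1]) simp

lemma lin_op_sum:
  assumes "lin_op A" "finite I"
  shows "A (\<lambda>y. \<Sum>i\<in>I. c i * f i y) = (\<lambda>y. \<Sum>i\<in>I. c i * A (f i) y)"
  using assms(2)
proof induction
  case empty
  show ?case using lin_op_zero[OF assms(1)] by simp
next
  case (insert i I)
  then show ?case
    using assms(1) unfolding lin_op_def by simp
qed

text \<open>On the finite set that determines the value at \<open>x\<close>, \<open>f\<close> agrees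
  with a finite combination of point masses, so linearity gives a matrix row with finitely many
  entries.\<close>

lemma local_op_kernel:
  fixes A :: "('a \<Rightarrow> complex) \<Rightarrow> 'a \<Rightarrow> complex" and x :: 'a
  assumes A: "lin_op A" "local_op A"
  defines "K \<equiv> \<lambda>y. A (delta y) x"
  shows "finite {y. K y \<noteq> 0}" "A f x = (\<Sum>y | K y \<noteq> 0. K y * f y)"
proof -
  from A(2) obtain F where F: "finite F" "\<And>f g. (\<forall>y\<in>F. f y = g y) \<Longrightarrow> A f x = A g x"
    unfolding local_op_def by blast
  have "K y = A (\<lambda>z. 0) x" if "y \<notin> F" for y
    unfolding K_def by (rule F(2)) (use that in auto)
  then have sub: "{y. K y \<noteq> 0} \<subseteq> F"
    using lin_op_zero[OF A(1)] by auto
  then show "finite {y. K y \<noteq> 0}" using F(1) finite_subset by blast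
  have "A f x = A (\<lambda>z. \<Sum>y\<in>F. f y * (if z = y then 1 else 0)) x"
    by (rule F(2)) (use F(1) in \<open>auto simp: if_distrib cong: if_cong\<close>)
  also have "\<dots> = (\<Sum>y\<in>F. K y * f y)"
    unfolding lin_op_sum[OF A(1) F(1)] by (simp add: K_def mult.commute)
  also have "\<dots> = (\<Sum>y | K y \<noteq> 0. K y * f y)"
    by (rule sum.mono_neutral_right) (use F(1) sub in auto)
  finally show "A f x = (\<Sum>y | K y \<noteq> 0. K y * f y)" .
qed

lemma lin_op_schroedinger: "lin_op (schroedinger G)"
  unfolding lin_op_def
proof (intro allI ext)
  fix c :: complex and f g :: "'a \<Rightarrow> complex" and y :: 'a
  have "(\<Sum>(e, u)\<in>N. of_real (weight G e) * (c * f y + g y - (c * f u + g u)))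
    = c * (\<Sum>(e, u)\<in>N. of_real (weight G e) * (f y - f u)) + (\<Sum>(e, u)\<in>N. of_real (weight G e) * (g y - g u))"
    for N
    unfolding sum_distrib_left sum.distrib[symmetric]
    by (intro sum.cong refl) (auto simp: algebra_simps)
  then show "schroedinger G (\<lambda>y. c * f y + g y) y = c * schroedinger G f y + schroedinger G g y"
    unfolding schroedinger_def by (simp add: algebra_simps)
qed

lemma local_op_schroedinger: "local_op (schroedinger G)"
  unfolding local_op_def
proof
  fix v
  define N where "N = {(e, u). e \<in> edges G \<and> ends G e = {v, u}}"
  \<comment> \<open>A sum over an infinite set is 0 by convention, so in that case only the value at
    \<open>v\<close> matters and locality holds for every graph.\<close>
  define F where "F = (if finite N then insert v (snd ` N) else {v})"
  have "schroedinger G f v = schroedinger G g v" if *: "\<forall>y\<in>F. f y = g y" for f g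
  proof -
    have "(\<Sum>(e, u)\<in>N. of_real (weight G e) * (f v - f u)) = (\<Sum>(e, u)\<in>N. of_real (weight G e) * (g v - g u))"
    proof (cases "finite N")
      case True
      then show ?thesis
        by (intro sum.cong refl) (use * in \<open>auto simp: F_def image_iff Bex_def\<close>)
    qed simp
    moreover have "f v = g v"
      using * by (auto simp: F_def split: if_splits)
    ultimately show ?thesis
      by (simp add: schroedinger_def N_def)
  qed
  then show "\<exists>F. finite F \<and> (\<forall>f g. (\<forall>y\<in>F. f y = g y) \<longrightarrow> schroedinger G f v = schroedinger G g v)"
    by (intro exI[of _ F]) (auto simp: F_def)
qed

section \<open>Floquet operators as Hermitian matrices\<close>

lemma ivec_add: "ivec (a + b) = ivec a + ivec b"
  and ivec_minus: "ivec (- a) = - ivec a"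
  and ivec_diff: "ivec (a - b) = ivec a - ivec b"
  and ivec_0 [simp]: "ivec 0 = 0"
  by (auto simp: ivec_def vec_eq_iff)

lemma ivec_inject [simp]: "ivec a = ivec b \<longleftrightarrow> a = b"
  by (auto simp: ivec_def vec_eq_iff)

definition chi :: "real ^ 'd \<Rightarrow> int ^ 'd \<Rightarrow> complex" where
  "chi k a = exp (\<i> * of_real (ivec a \<bullet> k))"

lemma chi_add: "chi k (a + b) = chi k a * chi k b"
  by (simp add: chi_def ivec_add inner_add_left ring_distribs exp_add)

lemma chi_0 [simp]: "chi k 0 = 1"
  by (simp add: chi_def)

lemma cmod_chi [simp]: "cmod (chi k a) = 1"
  by (simp add: chi_def)

lemma cnj_chi: "cnj (chi k a) = chi k (- a)"
  by (simp add: chi_def ivec_minus exp_cnj)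

definition lattice_subgroup :: "(int ^ 'd) set \<Rightarrow> bool" where
  "lattice_subgroup L \<longleftrightarrow> 0 \<in> L \<and> (\<forall>a\<in>L. \<forall>b\<in>L. a - b \<in> L)"

lemma subgroup_closed:
  assumes "lattice_subgroup L"
  shows "0 \<in> L" "a \<in> L \<Longrightarrow> b \<in> L \<Longrightarrow> a - b \<in> L" "a \<in> L \<Longrightarrow> - a \<in> L" "a \<in> L \<Longrightarrow> b \<in> L \<Longrightarrow> a + b \<in> L"
proof -
  show L: "0 \<in> L" "\<And>a b. a \<in> L \<Longrightarrow> b \<in> L \<Longrightarrow> a - b \<in> L"
    using assms by (auto simp: lattice_subgroup_def)
  show m: "\<And>a. a \<in> L \<Longrightarrow> - a \<in> L" using L(2)[of 0] L(1) by simp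
  show "a \<in> L \<Longrightarrow> b \<in> L \<Longrightarrow> a + b \<in> L" using L(2)[of a "- b"] m by simp
qed

lemma vorbit_eq_iff:
  assumes "lattice_subgroup L"
  shows "vorbit L u = vorbit L v \<longleftrightarrow> (\<exists>a\<in>L. u = v + ivec a)"
proof
  assume *: "vorbit L u = vorbit L v"
  have "u + ivec 0 \<in> vorbit L u"
    unfolding vorbit_def using subgroup_closed(1)[OF assms] by blast
  then show "\<exists>a\<in>L. u = v + ivec a"
    unfolding * by (auto simp: vorbit_def)
next
  assume "\<exists>a\<in>L. u = v + ivec a"
  then obtain a where a: "a \<in> L" "u = v + ivec a" by blast
  have "\<exists>c\<in>L. v + ivec a + ivec b = v + ivec c" if "b \<in> L" for b
    using subgroup_closed(4)[OF assms a(1) that] by (intro bexI[of _ "a + b"]) (auto simp: ivec_add)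
  moreover have "\<exists>c\<in>L. v + ivec b = v + ivec a + ivec c" if "b \<in> L" for b
    using subgroup_closed(2)[OF assms that a(1)] by (intro bexI[of _ "b - a"]) (auto simp: ivec_diff)
  ultimately show "vorbit L u = vorbit L v"
    unfolding a(2) vorbit_def by blast
qed

lemma vorbit_UNIV_shift: "vorbit UNIV (v + ivec a) = vorbit UNIV v"
  by (subst vorbit_eq_iff) (auto simp: lattice_subgroup_def)

text \<open>The choice is made for every point of space and depends on the orbit alone, so
  \<open>rep\<close> is invariant under lattice translations and \<open>off\<close> is
  equivariant.\<close>

definition rep :: "real ^ 'd \<Rightarrow> real ^ 'd" where
  "rep v = (SOME w. w \<in> vorbit UNIV v)"

definition off :: "real ^ 'd \<Rightarrow> int ^ 'd" where
  "off v = (SOME a. v = rep v + ivec a)"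

lemma rep_off: "v = rep v + ivec (off v)"
proof -
  have "v \<in> vorbit UNIV v" unfolding vorbit_def by (auto intro!: exI[of _ 0])
  then have "rep v \<in> vorbit UNIV v"
    unfolding rep_def by (rule someI)
  then obtain a where "rep v = v + ivec a" by (auto simp: vorbit_def)
  then have "v = rep v + ivec (- a)" by (simp add: ivec_minus)
  then show ?thesis unfolding off_def by (rule someI)
qed

lemma rep_shift [simp]: "rep (v + ivec a) = rep v"
  by (simp add: rep_def vorbit_UNIV_shift)

lemma off_shift [simp]: "off (v + ivec a) = off v + a"
proof -
  have "rep v + ivec (off (v + ivec a)) = v + ivec a"
    using rep_off[of "v + ivec a"] by simp
  also have "\<dots> = rep v + ivec (off v + a)"
    using rep_off[of v] by (simp add: ivec_add)
  finally show ?thesis by simp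
qed

lemma rep_rep [simp]: "rep (rep v) = rep v"
  using rep_shift[of "rep v" "off v"] rep_off[of v] by simp

lemma off_rep [simp]: "off (rep v) = 0"
  using rep_off[of "rep v"] ivec_inject[of "off (rep v)" 0] by simp

definition reps :: "(real ^ 'd, 'e) wgraph \<Rightarrow> (real ^ 'd) set" where
  "reps G = rep ` verts G"

text \<open>Inverse of restricting a Floquet function to the representatives; this identifies the
  Floquet space with functions on the fundamental graph.\<close>

definition floquet_ext :: "(real ^ 'd, 'e) wgraph \<Rightarrow> real ^ 'd \<Rightarrow> (real ^ 'd \<Rightarrow> complex) \<Rightarrow> real ^ 'd \<Rightarrow> complex" where
  "floquet_ext G k g v = (if v \<in> verts G then chi k (off v) * g (rep v) else 0)"

definition floquet_matrix :: "(real ^ 'd, 'e) wgraph \<Rightarrow> real ^ 'd \<Rightarrow> real ^ 'd \<Rightarrow> real ^ 'd \<Rightarrow> complex" where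
  "floquet_matrix G k r s = schroedinger G (floquet_ext G k (delta s)) r"

context periodic_schroedinger
begin

lemma verts_shift_iff: "v + ivec a \<in> verts G \<longleftrightarrow> v \<in> verts G"
  using verts_shift[of v a] verts_shift[of "v + ivec a" "- a"] by (auto simp: ivec_minus)

lemma rep_in_verts [simp]: "rep v \<in> verts G \<longleftrightarrow> v \<in> verts G"
  using verts_shift_iff[of "rep v" "off v"] rep_off[of v] by simp

lemma reps_subset: "reps G \<subseteq> verts G"
  by (auto simp: reps_def)

lemma rep_of_reps: "r \<in> reps G \<Longrightarrow> rep r = r"
  by (auto simp: reps_def)

lemma off_of_reps: "r \<in> reps G \<Longrightarrow> off r = 0"
  by (auto simp: reps_def)

lemma rep_in_reps [simp]: "rep v \<in> reps G \<longleftrightarrow> v \<in> verts G"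
  by (metis reps_def reps_subset rep_in_verts imageE imageI subsetD)

lemma bij_betw_reps: "bij_betw (vorbit UNIV) (reps G) (verts (fundamental_graph G shift))"
  unfolding bij_betw_def
proof
  show "inj_on (vorbit UNIV) (reps G)"
  proof (rule inj_onI)
    fix r s assume "r \<in> reps G" "s \<in> reps G" "vorbit UNIV r = vorbit UNIV s"
    then have "rep r = rep s" by (simp add: rep_def)
    with \<open>r \<in> reps G\<close> \<open>s \<in> reps G\<close> show "r = s" by (simp add: rep_of_reps)
  qed
  have "vorbit UNIV v = vorbit UNIV (rep v)" for v :: "real ^ 'd"
    using vorbit_UNIV_shift[of "rep v" "off v"] rep_off[of v] by simp
  then show "vorbit UNIV ` reps G = verts (fundamental_graph G shift)"
    by (auto simp: quotient_graph_def reps_def image_image)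
qed

declare rep_of_reps [simp] off_of_reps [simp]

lemma finite_reps [simp]: "finite (reps G)"
  using bij_betw_finite[OF bij_betw_reps] finite_verts_fundamental by simp

lemma card_reps: "card (reps G) = card (verts (fundamental_graph G shift))"
  by (rule bij_betw_same_card[OF bij_betw_reps])

text \<open>There are finitely many edge orbits, and within one orbit at most two translations move
  an endpoint onto \<open>v\<close>, because the lattice acts freely. This makes the sums defining
  the operator genuine finite sums.\<close>

lemma finite_edges_at: "finite {e \<in> edges G. v \<in> ends G e}"
proof -
  have "finite {e \<in> eorbit shift UNIV e0. v \<in> ends G e}" if e0: "e0 \<in> edges G" for e0
  proof -
    obtain u w where uw: "ends G e0 = {u, w}" using ends[OF e0] by auto
    have sub: "{e \<in> eorbit shift UNIV e0. v \<in> ends G e} \<subseteq> (\<lambda>a. shift a e0) ` {a. u + ivec a = v \<or> w + ivec a = v}"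
    proof
      fix e assume "e \<in> {e \<in> eorbit shift UNIV e0. v \<in> ends G e}"
      then obtain a where a: "e = shift a e0" "v \<in> ends G (shift a e0)" by (auto simp: eorbit_def)
      then have "v \<in> {u + ivec a, w + ivec a}"
        unfolding ends_shift[OF e0] uw by simp
      then show "e \<in> (\<lambda>a. shift a e0) ` {a. u + ivec a = v \<or> w + ivec a = v}"
        unfolding a(1) by (intro imageI) auto
    qed
    have "finite {a. x + ivec a = v}" for x
      using finite_vimageI[of "{v}" "\<lambda>a. x + ivec a"] by (simp add: vimage_def inj_def)
    then have "finite {a. u + ivec a = v \<or> w + ivec a = v}"
      by (simp add: Collect_disj_eq)
    then show ?thesis
      using sub by (meson finite_imageI finite_subset)
  qed
  then have "finite (\<Union>X\<in>edges (fundamental_graph G shift). {e \<in> X. v \<in> ends G e})"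
    using finite_edges_fundamental by (intro finite_UN_I) (auto simp: quotient_graph_def)
  moreover have "{e \<in> edges G. v \<in> ends G e} \<subseteq> (\<Union>X\<in>edges (fundamental_graph G shift). {e \<in> X. v \<in> ends G e})"
  proof
    fix e assume e: "e \<in> {e \<in> edges G. v \<in> ends G e}"
    then have "e \<in> eorbit shift UNIV e"
      using shift_zero[of e] unfolding eorbit_def by (auto intro!: exI[of _ 0])
    then show "e \<in> (\<Union>X\<in>edges (fundamental_graph G shift). {e \<in> X. v \<in> ends G e})"
      using e by (auto simp: quotient_graph_def)
  qed
  ultimately show ?thesis
    by (rule rev_finite_subset)
qed

definition nbrs :: "real ^ 'd \<Rightarrow> ('e \<times> (real ^ 'd)) set" where
  "nbrs v = {(e, u). e \<in> edges G \<and> ends G e = {v, u}}"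

lemma schroedinger_nbrs:
  "schroedinger G f v = (\<Sum>(e, u)\<in>nbrs v. of_real (weight G e) * (f v - f u)) + of_real (pot G v) * f v"
  by (simp add: schroedinger_def nbrs_def)

lemma finite_nbrs [simp]: "finite (nbrs v)"
proof (rule finite_imageD)
  show "finite (fst ` nbrs v)"
    by (rule finite_subset[OF _ finite_edges_at[of v]]) (auto simp: nbrs_def)
  show "inj_on fst (nbrs v)"
    by (auto simp: inj_on_def nbrs_def doubleton_eq_iff)
qed

lemma nbrs_verts: "(e, u) \<in> nbrs v \<Longrightarrow> u \<in> verts G \<and> v \<in> verts G"
proof -
  assume "(e, u) \<in> nbrs v"
  then have "e \<in> edges G" "ends G e = {v, u}" by (auto simp: nbrs_def)
  then show ?thesis using ends[of e] by (auto simp: doubleton_eq_iff)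
qed

lemma nbrs_shiftI: "(e, u) \<in> nbrs v \<Longrightarrow> (shift a e, u + ivec a) \<in> nbrs (v + ivec a)"
  using edges_shift ends_shift by (auto simp: nbrs_def)

lemma schroedinger_shift:
  assumes "v \<in> verts G"
  shows "schroedinger G f (v + ivec a) = schroedinger G (\<lambda>u. f (u + ivec a)) v"
proof -
  have shift_inv: "shift (- a) (shift a e) = e" "shift a (shift (- a) e) = e" if "e \<in> edges G" for e
    using shift_add[OF that, of "- a" a] shift_add[OF that, of a "- a"] shift_zero[OF that] by simp_all
  have "(\<Sum>(e, u)\<in>nbrs (v + ivec a). of_real (weight G e) * (f (v + ivec a) - f u))
      = (\<Sum>(e, u)\<in>nbrs v. of_real (weight G e) * (f (v + ivec a) - f (u + ivec a)))"
  proof (rule sum.reindex_bij_witness[where i = "\<lambda>(e, u). (shift a e, u + ivec a)"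
        and j = "\<lambda>(e, u). (shift (- a) e, u + ivec (- a))"]; clarsimp)
    fix e u
    show "(e, u) \<in> nbrs v \<Longrightarrow> (shift a e, u + ivec a) \<in> nbrs (v + ivec a)" by (rule nbrs_shiftI)
    assume eu: "(e, u) \<in> nbrs (v + ivec a)"
    show "(shift (- a) e, u + ivec (- a)) \<in> nbrs v"
      using nbrs_shiftI[OF eu, of "- a"] by (simp add: ivec_minus)
  qed (use shift_inv weight_shift in \<open>auto simp: nbrs_def ivec_minus\<close>)
  then show ?thesis
    unfolding schroedinger_nbrs using pot_shift[OF assms] by simp
qed

lemma schroedinger_outside: "v \<notin> verts G \<Longrightarrow> f v = 0 \<Longrightarrow> schroedinger G f v = 0"
proof -
  assume "v \<notin> verts G" "f v = 0"
  then have "nbrs v = {}" using nbrs_verts by auto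
  with \<open>f v = 0\<close> show ?thesis unfolding schroedinger_nbrs by simp
qed

definition ker :: "real ^ 'd \<Rightarrow> real ^ 'd \<Rightarrow> complex" where
  "ker v u = schroedinger G (delta u) v"

lemmas finite_ker = local_op_kernel(1)[OF lin_op_schroedinger local_op_schroedinger, of G, folded ker_def]

lemmas schroedinger_eq_sum_ker =
  local_op_kernel(2)[OF lin_op_schroedinger local_op_schroedinger, of G, folded ker_def]

lemma ker_shift: "v \<in> verts G \<Longrightarrow> ker (v + ivec a) (u + ivec a) = ker v u"
  by (simp add: ker_def schroedinger_shift)

lemma cnj_ker: "cnj (ker v u) = ker v u"
  unfolding ker_def schroedinger_nbrs cnj_sum by (auto simp: case_prod_unfold intro!: sum.cong)

text \<open>Off the diagonal an entry is minus the total weight of the edges joining the two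
  vertices, and edges are unoriented.\<close>

lemma ker_sym: "ker v u = ker u v"
proof (cases "u = v")
  case False
  have *: "ker v u = - (\<Sum>e\<in>{e \<in> edges G. ends G e = {v, u}}. of_real (weight G e))" if "u \<noteq> v" for u v
  proof -
    have "ker v u = (\<Sum>x\<in>nbrs v. if snd x = u then - of_real (weight G (fst x)) else 0)"
      using that unfolding ker_def schroedinger_nbrs by (auto simp: case_prod_unfold intro!: sum.cong)
    also have "\<dots> = (\<Sum>x\<in>{x \<in> nbrs v. snd x = u}. - of_real (weight G (fst x)))"
      by (rule sum.inter_filter[symmetric]) simp
    also have "\<dots> = (\<Sum>e\<in>{e \<in> edges G. ends G e = {v, u}}. - of_real (weight G e))"
      by (rule sum.reindex_bij_witness[where i = "\<lambda>e. (e, u)" and j = fst]) (auto simp: nbrs_def)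
    finally show ?thesis by (simp add: sum_negf)
  qed
  show ?thesis
    using *[of u v] *[of v u] False by (simp add: insert_commute)
qed simp

section \<open>Floquet spaces and Floquet matrices\<close>

lemma floquet_ext_in_floquet_space: "floquet_ext G k g \<in> floquet_space G k"
  by (auto simp: floquet_space_def floquet_ext_def verts_shift_iff chi_add chi_def[symmetric])

lemma floquet_spaceD:
  assumes "f \<in> floquet_space G k"
  shows "f v = chi k (off v) * f (rep v)"
proof (cases "v \<in> verts G")
  case True
  then have "f (rep v + ivec (off v)) = chi k (off v) * f (rep v)"
    using assms unfolding floquet_space_def chi_def by simp
  then show ?thesis using rep_off[of v] by simp
next
  case False
  then have "rep v \<notin> verts G" by simp
  with False show ?thesis using assms by (auto simp: floquet_space_def)
qed

lemma floquet_ext_restrict: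
  assumes "f \<in> floquet_space G k"
  shows "floquet_ext G k f = f"
proof
  fix v
  show "floquet_ext G k f v = f v"
    using floquet_spaceD[OF assms, of v] assms by (cases "v \<in> verts G") (auto simp: floquet_ext_def floquet_space_def)
qed

lemma floquet_ext_reps: "r \<in> reps G \<Longrightarrow> floquet_ext G k g r = g r"
  using reps_subset by (auto simp: floquet_ext_def)

lemma floquet_ext_cong: "(\<And>r. r \<in> reps G \<Longrightarrow> f r = g r) \<Longrightarrow> floquet_ext G k f = floquet_ext G k g"
  by (auto simp: floquet_ext_def fun_eq_iff)

lemma schroedinger_floquet_space:
  assumes f: "f \<in> floquet_space G k"
  shows "schroedinger G f \<in> floquet_space G k"
proof -
  have "schroedinger G f (v + ivec a) = exp (\<i> * of_real (ivec a \<bullet> k)) * schroedinger G f v"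
    if v: "v \<in> verts G" for v a
  proof -
    have "f (u + ivec a) = exp (\<i> * of_real (ivec a \<bullet> k)) * f u" for u
      using f verts_shift_iff[of u a] by (cases "u \<in> verts G") (auto simp: floquet_space_def)
    then have "schroedinger G f (v + ivec a) = schroedinger G (\<lambda>u. exp (\<i> * of_real (ivec a \<bullet> k)) * f u) v"
      unfolding schroedinger_shift[OF v] by simp
    then show ?thesis
      by (simp add: lin_op_scale[OF lin_op_schroedinger])
  qed
  then show ?thesis
    using f schroedinger_outside unfolding floquet_space_def by auto
qed

lemma floquet_space_lincomb:
  assumes "\<And>i. i \<in> I \<Longrightarrow> f i \<in> floquet_space G k"
  shows "(\<lambda>v. \<Sum>i\<in>I. c i * f i v) \<in> floquet_space G k"
  using assms by (auto simp: floquet_space_def sum_distrib_left mult.left_commute intro!: sum.neutral sum.cong)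

lemma schroedinger_floquet_ext:
  assumes r: "r \<in> reps G"
  shows "schroedinger G (floquet_ext G k g) r = mat_op (reps G) (floquet_matrix G k) g r"
proof -
  have "floquet_ext G k g v = (\<Sum>s\<in>reps G. g s * floquet_ext G k (delta s) v)" for v
  proof (cases "v \<in> verts G")
    case True
    have "(\<Sum>s\<in>reps G. g s * floquet_ext G k (delta s) v)
      = (\<Sum>s\<in>reps G. if rep v = s then chi k (off v) * g s else 0)"
      using True by (intro sum.cong) (auto simp: floquet_ext_def)
    also have "\<dots> = chi k (off v) * g (rep v)"
      using True by simp
    finally show ?thesis using True by (simp add: floquet_ext_def)
  qed (simp add: floquet_ext_def)
  then have "schroedinger G (floquet_ext G k g) r
      = schroedinger G (\<lambda>v. \<Sum>s\<in>reps G. g s * floquet_ext G k (delta s) v) r"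
    by presburger
  then show ?thesis
    using r by (simp add: lin_op_sum[OF lin_op_schroedinger] mat_op_def floquet_matrix_def mult.commute)
qed

text \<open>Exhibits the entries as trigonometric polynomials in \<open>k\<close>; continuity in
  \<open>k\<close> and Hermitian symmetry are both read off from this form.\<close>

lemma floquet_matrix_sum:
  assumes r: "r \<in> reps G"
  shows "floquet_matrix G k r s =
    (\<Sum>u\<in>{u \<in> verts G. rep u = s \<and> ker r u \<noteq> 0}. ker r u * chi k (off u))"
proof -
  have "floquet_matrix G k r s = (\<Sum>u | ker r u \<noteq> 0. ker r u * floquet_ext G k (delta s) u)"
    unfolding floquet_matrix_def schroedinger_eq_sum_ker ..
  also have "\<dots> = (\<Sum>u\<in>{u \<in> verts G. rep u = s \<and> ker r u \<noteq> 0}. ker r u * floquet_ext G k (delta s) u)"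
    by (rule sum.mono_neutral_right[OF finite_ker]) (auto simp: floquet_ext_def)
  also have "\<dots> = (\<Sum>u\<in>{u \<in> verts G. rep u = s \<and> ker r u \<noteq> 0}. ker r u * chi k (off u))"
    by (rule sum.cong) (auto simp: floquet_ext_def)
  finally show ?thesis .
qed

text \<open>Reversing an edge from \<open>r\<close> to \<open>s + a\<close> and translating it back gives an edge from \<open>s\<close> to \<open>r - a\<close>.\<close>

lemma hermitian_floquet_matrix: "hermitian_on (reps G) (floquet_matrix G k)"
  unfolding hermitian_on_def
proof (intro ballI)
  fix r s assume rs: "r \<in> reps G" "s \<in> reps G"
  have key: "ker r' u = ker s' (r' + ivec (- off u))"
    if "s' \<in> reps G" "r' \<in> reps G" "u \<in> verts G" "rep u = s'" for s' r' u
  proof -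
    have "ker r' u = ker u r'" by (rule ker_sym)
    also have "\<dots> = ker (s' + ivec (off u)) (r' + ivec (- off u) + ivec (off u))"
      using that(4) rep_off[of u] by (simp add: ivec_minus)
    also have "\<dots> = ker s' (r' + ivec (- off u))"
      by (rule ker_shift) (use that reps_subset in auto)
    finally show ?thesis .
  qed
  have "cnj (floquet_matrix G k s r)
      = (\<Sum>u\<in>{u \<in> verts G. rep u = r \<and> ker s u \<noteq> 0}. ker s u * chi k (- off u))"
    unfolding floquet_matrix_sum[OF rs(2)] cnj_sum
    by (intro sum.cong) (auto simp: cnj_ker cnj_chi)
  also have "\<dots> = (\<Sum>u\<in>{u \<in> verts G. rep u = s \<and> ker r u \<noteq> 0}. ker r u * chi k (off u))"
  proof (rule sum.reindex_bij_witness[where i = "\<lambda>u. r + ivec (- off u)" and j = "\<lambda>u. s + ivec (- off u)"])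
    fix u
    show "u \<in> {u \<in> verts G. rep u = r \<and> ker s u \<noteq> 0} \<Longrightarrow> s + ivec (- off u) \<in> {u \<in> verts G. rep u = s \<and> ker r u \<noteq> 0}"
      using rs reps_subset verts_shift key[of r s u] by auto
    show "u \<in> {u \<in> verts G. rep u = s \<and> ker r u \<noteq> 0} \<Longrightarrow> r + ivec (- off u) \<in> {u \<in> verts G. rep u = r \<and> ker s u \<noteq> 0}"
      using rs reps_subset verts_shift key[of s r u] by auto
  qed (use rs rep_off[symmetric] key[of r s] in auto)
  also have "\<dots> = floquet_matrix G k r s"
    using floquet_matrix_sum[OF rs(1)] by simp
  finally show "floquet_matrix G k r s = cnj (floquet_matrix G k s r)" ..
qed

lemma continuous_floquet_matrix: "r \<in> reps G \<Longrightarrow> continuous_on S (\<lambda>k. floquet_matrix G k r s)"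
  unfolding floquet_matrix_sum chi_def by (intro continuous_intros)

section \<open>Band functions\<close>

abbreviation nbands :: nat where "nbands \<equiv> card (reps G)"

abbreviation ip :: "(real ^ 'd \<Rightarrow> complex) \<Rightarrow> (real ^ 'd \<Rightarrow> complex) \<Rightarrow> complex" where "ip \<equiv> finner (reps G)"

text \<open>An eigensystem of \<open>floquet_matrix\<close> transported to functions on all
  vertices. The eigenfunctions are not chosen continuously in \<open>k\<close>; only eigenvalues are
  compared between different quasimomenta.\<close>

definition bloch_system :: "real ^ 'd \<Rightarrow> (nat \<Rightarrow> real ^ 'd \<Rightarrow> complex) \<Rightarrow> (nat \<Rightarrow> real) \<Rightarrow> bool" where
  "bloch_system k U \<mu> \<longleftrightarrow>
     (\<forall>i<nbands. U i \<in> floquet_space G k \<and> schroedinger G (U i) = (\<lambda>v. of_real (\<mu> i) * U i v)) \<and>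
     (\<forall>i<nbands. \<forall>j<nbands. ip (U i) (U j) = (if i = j then 1 else 0)) \<and>
     (\<forall>f\<in>floquet_space G k. f = (\<lambda>v. \<Sum>i<nbands. ip f (U i) * U i v)) \<and>
     (\<forall>c. (\<Sum>r\<in>reps G. (cmod (\<Sum>i<nbands. c i * U i r))\<^sup>2) = (\<Sum>i<nbands. (cmod (c i))\<^sup>2)) \<and>
     (\<forall>i j. i \<le> j \<longrightarrow> j < nbands \<longrightarrow> \<mu> i \<le> \<mu> j)"

lemma floquet_space_eqI:
  assumes "f \<in> floquet_space G k" "g \<in> floquet_space G k" "\<And>r. r \<in> reps G \<Longrightarrow> f r = g r"
  shows "f = g"
proof -
  have "f = floquet_ext G k f" using floquet_ext_restrict[OF assms(1)] by simp
  also have "\<dots> = floquet_ext G k g" by (rule floquet_ext_cong[OF assms(3)])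
  finally show ?thesis using floquet_ext_restrict[OF assms(2)] by simp
qed

lemma floquet_space_scale:
  "f \<in> floquet_space G k \<Longrightarrow> (\<lambda>v. c * f v) \<in> floquet_space G k"
  by (auto simp: floquet_space_def)

lemma bloch_system_of_eigensystem:
  assumes s: "eigensystem (reps G) (floquet_matrix G k) (nbands) u \<mu>"
  shows "bloch_system k (\<lambda>i. floquet_ext G k (u i)) \<mu>"
proof -
  define U where "U = (\<lambda>i. floquet_ext G k (u i))"
  have U: "U i \<in> floquet_space G k" for i
    by (simp add: U_def floquet_ext_in_floquet_space)
  have Ur: "U i r = u i r" if "r \<in> reps G" for i r
    using that by (simp add: U_def floquet_ext_reps)
  have fin: "ip f (U i) = ip f (u i)" for f i
    by (rule finner_cong) (auto simp: Ur)
  have fin': "ip (U i) f = ip (u i) f" for f i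
    by (rule finner_cong) (auto simp: Ur)
  have "schroedinger G (U i) = (\<lambda>v. of_real (\<mu> i) * U i v)" if i: "i < nbands" for i
  proof (rule floquet_space_eqI)
    show "schroedinger G (U i) \<in> floquet_space G k" by (rule schroedinger_floquet_space[OF U])
    show "(\<lambda>v. of_real (\<mu> i) * U i v) \<in> floquet_space G k" by (rule floquet_space_scale[OF U])
    fix r assume r: "r \<in> reps G"
    show "schroedinger G (U i) r = of_real (\<mu> i) * U i r"
      using s i r Ur[OF r, of i] schroedinger_floquet_ext[OF r, of k "u i"] by (simp add: eigensystem_def U_def)
  qed
  moreover have "f = (\<lambda>v. \<Sum>i<nbands. ip f (U i) * U i v)" if f: "f \<in> floquet_space G k" for f
  proof (rule floquet_space_eqI[OF f])
    show "(\<lambda>v. \<Sum>i<nbands. ip f (U i) * U i v) \<in> floquet_space G k"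
      by (rule floquet_space_lincomb[OF U])
    fix r assume r: "r \<in> reps G"
    show "f r = (\<Sum>i<nbands. ip f (U i) * U i r)"
      using eigensystem_expansion[OF finite_reps s r, of f] r by (simp add: fin Ur)
  qed
  moreover have "(\<Sum>r\<in>reps G. (cmod (\<Sum>i<nbands. c i * U i r))\<^sup>2) = (\<Sum>i<nbands. (cmod (c i))\<^sup>2)" for c
    using eigensystem_norm_lincomb[OF s, of c] by (simp add: Ur)
  ultimately show ?thesis
    using s U eigensystem_mono[OF s] unfolding bloch_system_def U_def[symmetric]
    by (simp add: fin fin' eigensystem_def)
qed

lemma bloch_system_exists: obtains U \<mu> where "bloch_system k U \<mu>"
proof -
  obtain u \<mu> where u: "eigensystem (reps G) (floquet_matrix G k) (nbands) u \<mu>"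
    using eigensystem_exists[OF finite_reps hermitian_floquet_matrix] .
  show ?thesis
    by (rule that[OF bloch_system_of_eigensystem[OF u]])
qed

section \<open>Bands as sorted eigenvalues with multiplicity\<close>

lemma sum_fun_eval: "(\<Sum>i\<in>I. f i) x = (\<Sum>i\<in>I. f i x :: complex)"
  by (induction I rule: infinite_finite_induct) auto

text \<open>Comparing coefficients in the eigenvalue equation of an expanded function kills every
  component with a different eigenvalue; orthonormality makes the remaining \<open>U i\<close> a
  basis of the eigenspace.\<close>

lemma floquet_mult_bloch:
  assumes b: "bloch_system k U \<mu>"
  shows "floquet_mult G k x = card {i. i < nbands \<and> \<mu> i = x}"
proof -
  interpret vs: vector_space "\<lambda>(c :: complex) f (v :: real ^ 'd). c * f v"
    by unfold_locales (auto simp: algebra_simps)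
  define I where "I = {i. i < nbands \<and> \<mu> i = x}"
  have I: "finite I" "\<And>i. i \<in> I \<Longrightarrow> i < nbands" by (auto simp: I_def)
  have ortho: "ip (U i) (U j) = (if i = j then 1 else 0)" if "i < nbands" "j < nbands" for i j
    using b that by (simp add: bloch_system_def)
  have inj: "inj_on U I"
  proof (rule inj_onI)
    fix i j assume "i \<in> I" "j \<in> I" "U i = U j"
    then show "i = j" using ortho[of i j] ortho[of j j] I(2) by (auto split: if_splits)
  qed
  define V where "V = {f \<in> floquet_space G k. schroedinger G f = (\<lambda>v. of_real x * f v)}"
  have "vs.dim V = card I"
  proof (rule vs.dim_unique[of "U ` I"])
    show "U ` I \<subseteq> V"
      using b by (auto simp: V_def I_def bloch_system_def)
    show "card (U ` I) = card I"
      by (rule card_image[OF inj])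
    show "V \<subseteq> vs.span (U ` I)"
    proof
      fix f assume f: "f \<in> V"
      have fe: "f = (\<lambda>v. \<Sum>i<nbands. ip f (U i) * U i v)"
        using b f by (auto simp: bloch_system_def V_def)
      have z: "ip f (U i) = 0" if i: "i < nbands" "i \<notin> I" for i
      proof -
        have lin: "ip (\<lambda>v. \<Sum>j<nbands. c j * U j v) (U i) = c i" for c
        proof -
          have "(\<Sum>j<nbands. c j * ip (U j) (U i)) = (\<Sum>j<nbands. if j = i then c j else 0)"
            using ortho i by (intro sum.cong) auto
          then show ?thesis unfolding finner_sum_left using i by simp
        qed
        have "(\<lambda>v. of_real x * f v) = schroedinger G (\<lambda>v. \<Sum>i<nbands. ip f (U i) * U i v)"
          using f fe by (auto simp: V_def)
        also have "\<dots> = (\<lambda>v. \<Sum>i<nbands. ip f (U i) * schroedinger G (U i) v)"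
          by (rule lin_op_sum[OF lin_op_schroedinger]) simp
        also have "\<dots> = (\<lambda>v. \<Sum>i<nbands. (ip f (U i) * of_real (\<mu> i)) * U i v)"
          using b by (auto simp: bloch_system_def mult.assoc)
        finally have "ip (\<lambda>v. of_real x * f v) (U i) = ip f (U i) * of_real (\<mu> i)"
          using lin by simp
        then have "of_real x * ip f (U i) = ip f (U i) * of_real (\<mu> i)"
          by (simp add: finner_scale_left)
        then show ?thesis
          using i by (auto simp: I_def)
      qed
      have "f v = (\<Sum>i\<in>I. (\<lambda>v. ip f (U i) * U i v)) v" for v
      proof -
        have "f v = (\<Sum>i<nbands. ip f (U i) * U i v)"
          using fe by metis
        also have "\<dots> = (\<Sum>i\<in>I. ip f (U i) * U i v)"
          by (rule sum.mono_neutral_right) (use I z in auto)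
        finally show ?thesis by (simp add: sum_fun_eval)
      qed
      then have "f = (\<Sum>i\<in>I. (\<lambda>v. ip f (U i) * U i v))" by blast
      also have "\<dots> \<in> vs.span (U ` I)"
        by (intro vs.span_sum vs.span_scale vs.span_base) auto
      finally show "f \<in> vs.span (U ` I)" .
    qed
    show "vs.independent (U ` I)"
    proof
      assume "vs.dependent (U ` I)"
      then obtain c where c: "\<exists>f\<in>U ` I. c f \<noteq> 0" "(\<Sum>f\<in>U ` I. (\<lambda>v. c f * f v)) = 0"
        using vs.dependent_finite[of "U ` I"] I by auto
      then obtain j where j: "j \<in> I" "c (U j) \<noteq> 0" by auto
      have "(\<lambda>v. \<Sum>i\<in>I. c (U i) * U i v) = (\<lambda>v. 0)"
        using c(2) by (auto simp: sum.reindex[OF inj] sum_fun_eval fun_eq_iff)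
      then have "ip (\<lambda>v. \<Sum>i\<in>I. c (U i) * U i v) (U j) = 0"
        by (simp add: finner_def)
      then have "(\<Sum>i\<in>I. c (U i) * ip (U i) (U j)) = 0"
        unfolding finner_sum_left .
      also have "(\<Sum>i\<in>I. c (U i) * ip (U i) (U j)) = (\<Sum>i\<in>I. if i = j then c (U i) else 0)"
        using ortho I j by (intro sum.cong) auto
      finally show False using j I by simp
    qed
  qed
  then show ?thesis
    unfolding floquet_mult_def V_def I_def .
qed

text \<open>A sorted list is determined by its multiplicities, so the eigenvalues found by
  minimisation are the ones that the definite description picks out. Bands are numbered from 1,
  eigensystems from 0.\<close>

lemma band_bloch:
  assumes b: "bloch_system k U \<mu>" and i: "i < nbands"
  shows "band G (Suc i) k = \<mu> i"
proof -
  define xs where "xs = map \<mu> [0..<nbands]"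
  have xs: "sorted xs" "\<forall>x. count_list xs x = floquet_mult G k x"
  proof -
    show "sorted xs"
      using b unfolding xs_def bloch_system_def by (auto simp: sorted_iff_nth_mono)
    have "count_list xs x = card {i. i < nbands \<and> \<mu> i = x}" for x
    proof -
      have "count_list xs x = length (filter (\<lambda>y. y = x) xs)"
        by (induction xs) auto
      also have "\<dots> = card {i. i < nbands \<and> \<mu> i = x}"
        unfolding length_filter_conv_card by (rule arg_cong[where f = card]) (auto simp: xs_def)
      finally show ?thesis .
    qed
    then show "\<forall>x. count_list xs x = floquet_mult G k x"
      unfolding floquet_mult_bloch[OF b] by simp
  qed
  have "floquet_eigenvalues G k = xs"
    unfolding floquet_eigenvalues_def
  proof (rule the_equality)
    show "sorted xs \<and> (\<forall>x. count_list xs x = floquet_mult G k x)"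
      using xs by simp
    fix ys assume ys: "sorted ys \<and> (\<forall>x. count_list ys x = floquet_mult G k x)"
    then have "mset ys = mset xs"
      using xs by (intro multiset_eqI) (simp add: count_mset)
    then show "ys = xs"
      using xs ys by (metis properties_for_sort)
  qed
  then show ?thesis
    using i by (simp add: band_def xs_def)
qed

section \<open>Continuity and periodicity of the bands\<close>

lemma continuous_on_band:
  assumes j: "j \<in> {1..nbands}"
  shows "continuous_on S (band G j)"
proof -
  obtain i where i: "j = Suc i" "i < nbands"
    using j by (cases j) auto
  have bound: "\<bar>band G j k - band G j k0\<bar>
      \<le> (\<Sum>x\<in>reps G. \<Sum>y\<in>reps G. cmod (floquet_matrix G k x y - floquet_matrix G k0 x y))" for k k0
  proof -
    obtain u \<mu> where u: "eigensystem (reps G) (floquet_matrix G k) (nbands) u \<mu>"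
      using eigensystem_exists[OF finite_reps hermitian_floquet_matrix] .
    obtain v \<kappa> where v: "eigensystem (reps G) (floquet_matrix G k0) (nbands) v \<kappa>"
      using eigensystem_exists[OF finite_reps hermitian_floquet_matrix] .
    show ?thesis
      using weyl_inequality[OF finite_reps v u i(2)] i
        band_bloch[OF bloch_system_of_eigensystem[OF u]] band_bloch[OF bloch_system_of_eigensystem[OF v]]
      by simp
  qed
  have "isCont (band G j) k0" for k0
  proof -
    have "isCont (\<lambda>k. \<Sum>x\<in>reps G. \<Sum>y\<in>reps G. cmod (floquet_matrix G k x y - floquet_matrix G k0 x y)) k0"
      by (intro continuous_intros continuous_on_interior[OF continuous_floquet_matrix[where S = UNIV]]) auto
    then have "((\<lambda>k. \<Sum>x\<in>reps G. \<Sum>y\<in>reps G. cmod (floquet_matrix G k x y - floquet_matrix G k0 x y)) \<longlongrightarrow> 0) (at k0)"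
      by (simp add: isCont_def)
    then have "((\<lambda>k. band G j k - band G j k0) \<longlongrightarrow> 0) (at k0)"
      by (rule Lim_null_comparison[rotated]) (simp add: bound)
    then show ?thesis
      by (simp add: isCont_def LIM_zero_iff)
  qed
  then show ?thesis
    by (simp add: continuous_at_imp_continuous_on)
qed

text \<open>The characters of the two quasimomenta agree on the lattice, so the Floquet spaces are
  literally the same set, and with them all multiplicities.\<close>

lemma band_periodic: "band G j (k + (2 * pi) *\<^sub>R ivec n) = band G j k"
proof -
  have "exp (\<i> * of_real (ivec a \<bullet> (k + (2 * pi) *\<^sub>R ivec n))) = exp (\<i> * of_real (ivec a \<bullet> k))" for a
  proof -
    have "ivec a \<bullet> ivec n = of_int (\<Sum>i\<in>UNIV. a $ i * n $ i)"
      by (simp add: ivec_def inner_vec_def)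
    then have "\<i> * of_real (ivec a \<bullet> (k + (2 * pi) *\<^sub>R ivec n))
        = \<i> * of_real (ivec a \<bullet> k) + \<i> * (of_int (\<Sum>i\<in>UNIV. a $ i * n $ i) * (of_real pi * 2))"
      by (simp only: inner_add_right inner_scaleR_right) (simp add: algebra_simps)
    then show ?thesis
      by (metis exp_plus_2pin)
  qed
  then have "floquet_space G (k + (2 * pi) *\<^sub>R ivec n) = floquet_space G k"
    by (simp add: floquet_space_def)
  then show ?thesis
    by (simp add: band_def floquet_eigenvalues_def floquet_mult_def)
qed

end

section \<open>Lattice bases and their duals\<close>

lemma inner_ivec: "ivec a \<bullet> ivec n = of_int (\<Sum>i\<in>UNIV. a $ i * n $ i)"
  by (simp add: ivec_def inner_vec_def)

definition coord :: "(int ^ 'd) set \<Rightarrow> int ^ 'd \<Rightarrow> int ^ 'd \<Rightarrow> int" where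
  "coord S a = (THE c. (\<forall>s. s \<notin> S \<longrightarrow> c s = 0) \<and> a = (\<Sum>s\<in>S. c s *s s))"

text \<open>The dual basis vector: pairing with it reads off the coordinate at \<open>s\<close>. It
  is integral because the standard basis vectors have integral coordinates, so \<open>2 * pi\<close>
  times it is a period of the bands.\<close>

definition dual :: "(int ^ 'd) set \<Rightarrow> int ^ 'd \<Rightarrow> int ^ 'd" where
  "dual S s = (\<chi> i. coord S (axis i 1) s)"

context
  fixes S :: "(int ^ 'd) set"
  assumes S: "lattice_basis S"
begin

lemma lattice_basis_finite: "finite S"
  using S by (simp add: lattice_basis_def)

lemma coord_props: "(\<forall>s. s \<notin> S \<longrightarrow> coord S a s = 0) \<and> a = (\<Sum>s\<in>S. coord S a s *s s)"
proof -
  have "\<exists>!c. (\<forall>s. s \<notin> S \<longrightarrow> c s = 0) \<and> a = (\<Sum>s\<in>S. c s *s s)"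
    using S by (simp add: lattice_basis_def)
  from theI'[OF this] show ?thesis unfolding coord_def[abs_def] .
qed

lemma coord_eqI: "(\<And>s. s \<notin> S \<Longrightarrow> c s = 0) \<Longrightarrow> a = (\<Sum>s\<in>S. c s *s s) \<Longrightarrow> coord S a = c"
  using S coord_props[of a] unfolding lattice_basis_def by blast

lemma coord_outside: "s \<notin> S \<Longrightarrow> coord S a s = 0"
  using coord_props by blast

lemma coord_expansion: "(\<Sum>s\<in>S. coord S a s *s s) = a"
  using coord_props[of a] by simp

lemma coord_inject: "coord S a = coord S b \<Longrightarrow> a = b"
  by (metis coord_expansion)

lemma coord_lincomb: "s \<in> S \<Longrightarrow> coord S (\<Sum>s\<in>S. m s *s s) s = m s"
  using coord_eqI[of "\<lambda>s. if s \<in> S then m s else 0" "\<Sum>s\<in>S. m s *s s"] by simp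

lemma coord_add: "coord S (a + b) s = coord S a s + coord S b s"
proof -
  have "coord S (a + b) = (\<lambda>s. coord S a s + coord S b s)"
    by (rule coord_eqI) (simp_all add: coord_outside coord_expansion vector_sadd_rdistrib sum.distrib)
  then show ?thesis by simp
qed

lemma coord_scale: "coord S (m *s a) s = m * coord S a s"
proof -
  have "m *s a = (\<Sum>s\<in>S. (m * coord S a s) *s s)"
    by (subst coord_expansion[symmetric])
      (simp add: vec_eq_iff sum_distrib_left mult.assoc)
  then have "coord S (m *s a) = (\<lambda>s. m * coord S a s)"
    by (intro coord_eqI) (simp_all add: coord_outside)
  then show ?thesis by simp
qed

lemma coord_minus: "coord S (- a) s = - coord S a s"
  using coord_scale[of "- 1" a s] by (simp add: vector_sneg_minus1[symmetric])

lemma coord_diff: "coord S (a - b) s = coord S a s - coord S b s"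
  using coord_add[of a "- b" s] coord_minus[of b s] by simp

lemma coord_0: "coord S 0 s = 0"
  using coord_diff[of 0 0 s] by simp

lemma coord_sum: "finite I \<Longrightarrow> coord S (\<Sum>i\<in>I. f i) s = (\<Sum>i\<in>I. coord S (f i) s)"
  by (induction I rule: finite_induct) (auto simp: coord_add coord_0)

lemma coord_basis: "s \<in> S \<Longrightarrow> coord S s t = (if s = t then 1 else 0)"
proof -
  assume s: "s \<in> S"
  have "s = (\<Sum>x\<in>S. if s = x then x else 0)"
    using s lattice_basis_finite by simp
  also have "\<dots> = (\<Sum>x\<in>S. (if s = x then 1 else 0) *s x)"
    by (rule sum.cong) (auto simp: vec_eq_iff)
  finally have "coord S s = (\<lambda>t. if s = t then 1 else 0)"
    by (intro coord_eqI) (use s in auto)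
  then show ?thesis by simp
qed

lemma inner_ivec_dual: "ivec a \<bullet> ivec (dual S s) = of_int (coord S a s)"
proof -
  have "coord S a s = coord S (\<Sum>i\<in>UNIV. (a $ i) *s axis i 1) s"
    by (simp add: basis_expansion)
  also have "\<dots> = (\<Sum>i\<in>UNIV. a $ i * dual S s $ i)"
    by (simp add: coord_sum coord_scale dual_def)
  finally show ?thesis by (simp add: inner_ivec)
qed

end

section \<open>Quasimomenta of a subcovering\<close>

lemma real_matrix_nth: "(real_matrix T *v k) $ i = ivec (row i T) \<bullet> k"
  by (simp add: real_matrix_def matrix_vector_mult_def ivec_def row_def inner_vec_def)

lemma in_two_pi_lattice_iff: "x \<in> two_pi_lattice \<longleftrightarrow> (\<forall>i. x $ i / (2 * pi) \<in> \<int>)"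
proof
  assume "x \<in> two_pi_lattice"
  then show "\<forall>i. x $ i / (2 * pi) \<in> \<int>"
    by (auto simp: two_pi_lattice_def ivec_def)
next
  assume "\<forall>i. x $ i / (2 * pi) \<in> \<int>"
  then have "\<forall>i. \<exists>n. x $ i / (2 * pi) = of_int n"
    by (auto elim!: Ints_cases)
  then obtain n where n: "\<And>i. x $ i / (2 * pi) = of_int (n i)" by metis
  then have "x = (2 * pi) *\<^sub>R ivec (\<chi> i. n i)"
    by (simp add: vec_eq_iff ivec_def field_simps)
  then show "x \<in> two_pi_lattice"
    unfolding two_pi_lattice_def by blast
qed

text \<open>The quasimomenta of the subcovering before the cut to the half-open cell
  \<open>brillouin\<close>: a closed set, invariant under the periods. By
  \<open>band_image_brillouin\<close> the cut does not change the images of the bands.\<close>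

definition admissible :: "int ^ 'd ^ 'o \<Rightarrow> (real ^ 'd) set" where
  "admissible T = {k. real_matrix T *v k \<in> two_pi_lattice}"

lemma brillouin_sub_eq: "brillouin_sub T = admissible T \<inter> brillouin"
  by (auto simp: brillouin_sub_def admissible_def)

lemma zero_in_brillouin: "0 \<in> brillouin"
  by (simp add: brillouin_def)

lemma zero_in_admissible: "0 \<in> admissible T"
  by (simp add: admissible_def in_two_pi_lattice_iff)

lemma closed_admissible: "closed (admissible T)"
proof -
  have "admissible T = (\<Inter>i. (\<lambda>k. (ivec (row i T) \<bullet> k) / (2 * pi)) -` \<int>)"
    by (auto simp: admissible_def in_two_pi_lattice_iff real_matrix_nth)
  then show ?thesis
    by (simp add: closed_INT continuous_closed_vimage closed_Ints)
qed

definition periodic_set :: "(real ^ 'd) set \<Rightarrow> bool" where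
  "periodic_set X \<longleftrightarrow> (\<forall>k\<in>X. \<forall>n. k + (2 * pi) *\<^sub>R ivec n \<in> X)"

lemma periodic_set_admissible: "periodic_set (admissible T)"
  unfolding periodic_set_def admissible_def in_two_pi_lattice_iff real_matrix_nth
  by (auto simp: inner_add_right inner_ivec add_divide_distrib)

lemma shift_into_brillouin:
  fixes k :: "real ^ 'd"
  obtains n where "k + (2 * pi) *\<^sub>R ivec n \<in> brillouin"
proof
  \<comment> \<open>The ceiling rather than the floor, since the cell contains \<open>pi\<close> but
    not \<open>- pi\<close>.\<close>
  define n where "n = (\<chi> i. - \<lceil>(k $ i - pi) / (2 * pi)\<rceil>)"
  show "k + (2 * pi) *\<^sub>R ivec n \<in> brillouin"
    unfolding brillouin_def
  proof (intro CollectI allI)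
    fix i
    define c where "c = (k $ i - pi) / (2 * pi)"
    have "k $ i = 2 * pi * c + pi" by (simp add: c_def field_simps)
    moreover have "2 * pi * (of_int \<lceil>c\<rceil> - 1) < 2 * pi * c" "2 * pi * c \<le> 2 * pi * of_int \<lceil>c\<rceil>"
      using ceiling_correct[of c] by (auto intro!: mult_strict_left_mono mult_left_mono)
    ultimately show "- pi < (k + (2 * pi) *\<^sub>R ivec n) $ i \<and> (k + (2 * pi) *\<^sub>R ivec n) $ i \<le> pi"
      by (simp add: n_def ivec_def c_def[symmetric] algebra_simps)
  qed
qed

section \<open>Images of the bands: compactness and connectedness\<close>

context periodic_schroedinger
begin

lemma band_image_brillouin:
  assumes "periodic_set X"
  shows "band G j ` (X \<inter> brillouin) = band G j ` X"
proof
  show "band G j ` X \<subseteq> band G j ` (X \<inter> brillouin)"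
  proof
    fix y assume "y \<in> band G j ` X"
    then obtain k where k: "k \<in> X" "y = band G j k" by auto
    obtain n where n: "k + (2 * pi) *\<^sub>R ivec n \<in> brillouin" using shift_into_brillouin .
    have "k + (2 * pi) *\<^sub>R ivec n \<in> X \<inter> brillouin"
      using assms k n by (auto simp: periodic_set_def)
    then show "y \<in> band G j ` (X \<inter> brillouin)"
      using k(2) band_periodic[of j k n] by (metis imageI)
  qed
qed auto

text \<open>The half-open cell is not closed, but by periodicity it has the same band image as all
  of \<open>X\<close>, and therefore the same as the closed cube lying in between.\<close>

lemma compact_band_image:
  assumes j: "j \<in> {1..nbands}" and X: "periodic_set X" "closed X"
  shows "compact (band G j ` (X \<inter> brillouin))"
proof -
  define C where "C = X \<inter> cbox (\<chi> i. - pi) (\<chi> i. pi)"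
  have "X \<inter> brillouin \<subseteq> C" "C \<subseteq> X"
    by (auto simp: C_def brillouin_def mem_box_cart less_imp_le)
  then have "band G j ` (X \<inter> brillouin) = band G j ` C"
    using band_image_brillouin[OF X(1), of j] by (metis image_mono subset_antisym)
  moreover have "compact (band G j ` C)"
    unfolding C_def
    by (intro compact_continuous_image continuous_on_band[OF j] closed_Int_compact X compact_cbox)
  ultimately show ?thesis by simp
qed

text \<open>Integral multiples of the dual vectors of the rows remove \<open>T k\<close> without changing \<open>k\<close> modulo
  \<open>2 * pi\<close>.\<close>

lemma band_image_admissible:
  fixes T :: "int ^ 'd ^ 'o"
  assumes "primitive T"
  shows "band G j ` admissible T = band G j ` {k. \<forall>i. ivec (row i T) \<bullet> k = 0}"
proof
  obtain S where S: "rows T \<subseteq> S" "lattice_basis S"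
    using assms by (auto simp: primitive_def)
  have rowS: "row i T \<in> S" for i using S(1) by (auto simp: rows_def)
  have inj: "row i T = row l T \<longleftrightarrow> i = l" for i l
    using assms by (auto simp: primitive_def inj_def)
  show "band G j ` admissible T \<subseteq> band G j ` {k. \<forall>i. ivec (row i T) \<bullet> k = 0}"
  proof
    fix y assume "y \<in> band G j ` admissible T"
    then obtain k where k: "k \<in> admissible T" "y = band G j k" by auto
    then obtain n where n: "real_matrix T *v k = (2 * pi) *\<^sub>R ivec n"
      by (auto simp: admissible_def two_pi_lattice_def)
    define b where "b = (\<Sum>i\<in>UNIV. n $ i *s dual S (row i T))"
    have ib: "ivec b = (\<Sum>i\<in>UNIV. of_int (n $ i) *\<^sub>R ivec (dual S (row i T)))"
      by (simp add: b_def ivec_def vec_eq_iff)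
    have "ivec (row l T) \<bullet> ivec b = of_int (n $ l)" for l
    proof -
      have "ivec (row l T) \<bullet> ivec b = (\<Sum>i\<in>UNIV. of_int (n $ i) * of_int (coord S (row l T) (row i T)))"
        by (simp add: ib inner_sum_right inner_ivec_dual[OF S(2)])
      also have "\<dots> = (\<Sum>i\<in>UNIV. if l = i then of_int (n $ i) else 0)"
        by (rule sum.cong) (auto simp: coord_basis[OF S(2) rowS] inj)
      finally show ?thesis by simp
    qed
    moreover have "ivec (row l T) \<bullet> k = 2 * pi * of_int (n $ l)" for l
      using arg_cong[OF n, of "\<lambda>x. x $ l"] by (simp add: real_matrix_nth ivec_def)
    ultimately have "k + (2 * pi) *\<^sub>R ivec (- b) \<in> {k. \<forall>i. ivec (row i T) \<bullet> k = 0}"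
      by (simp add: ivec_minus inner_diff_right)
    then show "y \<in> band G j ` {k. \<forall>i. ivec (row i T) \<bullet> k = 0}"
      using k(2) band_periodic[of j k "- b"] by (metis imageI)
  qed
  show "band G j ` {k. \<forall>i. ivec (row i T) \<bullet> k = 0} \<subseteq> band G j ` admissible T"
    by (intro image_mono) (auto simp: admissible_def in_two_pi_lattice_iff real_matrix_nth)
qed

text \<open>\<open>admissible T\<close> is a union of parallel affine subspaces and not connected;
  periodicity reduces its image to that of the subspace through 0, which is convex.\<close>

lemma connected_band_image_sub:
  assumes j: "j \<in> {1..nbands}" and T: "primitive T"
  shows "connected (band G j ` brillouin_sub T)"
proof -
  have "band G j ` brillouin_sub T = band G j ` {k. \<forall>i. ivec (row i T) \<bullet> k = 0}"
    unfolding brillouin_sub_eq band_image_brillouin[OF periodic_set_admissible]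
    by (rule band_image_admissible[OF T])
  moreover have "convex {k. \<forall>i. ivec (row i T) \<bullet> k = 0}"
    by (auto simp: convex_def inner_add_right)
  ultimately show ?thesis
    using connected_continuous_image[OF continuous_on_band[OF j] convex_connected] by simp
qed

lemma compact_band_image_sub:
  assumes j: "j \<in> {1..nbands}"
  shows "compact (band G j ` brillouin_sub T)"
  unfolding brillouin_sub_eq by (rule compact_band_image[OF j periodic_set_admissible closed_admissible])

lemma compact_band_image_full:
  assumes j: "j \<in> {1..nbands}"
  shows "compact (band G j ` brillouin)"
  using compact_band_image[OF j, of UNIV] by (simp add: periodic_set_def)

end

lemma LEAST_compact:
  fixes A :: "real set"
  assumes "compact A" "A \<noteq> {}"
  shows "(LEAST x. x \<in> A) \<in> A" "x \<in> A \<Longrightarrow> (LEAST x. x \<in> A) \<le> x"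
  using compact_attains_inf[OF assms] by (metis Least_equality)+

lemma GREATEST_compact:
  fixes A :: "real set"
  assumes "compact A" "A \<noteq> {}"
  shows "(GREATEST x. x \<in> A) \<in> A" "x \<in> A \<Longrightarrow> x \<le> (GREATEST x. x \<in> A)"
  using compact_attains_sup[OF assms] by (metis Greatest_equality)+

lemma compact_connected_eq_interval:
  fixes A :: "real set"
  assumes "compact A" "connected A" "A \<noteq> {}"
  shows "A = {(LEAST x. x \<in> A)..(GREATEST x. x \<in> A)}"
proof
  show "A \<subseteq> {(LEAST x. x \<in> A)..(GREATEST x. x \<in> A)}"
    using LEAST_compact(2)[OF assms(1,3)] GREATEST_compact(2)[OF assms(1,3)] by auto
  show "{(LEAST x. x \<in> A)..(GREATEST x. x \<in> A)} \<subseteq> A"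
    by (rule connected_contains_Icc[OF assms(2) LEAST_compact(1)[OF assms(1,3)] GREATEST_compact(1)[OF assms(1,3)]])
qed

section \<open>Density of the admissible quasimomenta\<close>

lemma inner_gram_matrix:
  fixes A :: "real ^ 'n ^ 'm"
  shows "((A ** transpose A) *v v) \<bullet> w = (transpose A *v v) \<bullet> (transpose A *v w)"
proof -
  have "((A ** transpose A) *v v) \<bullet> w = w \<bullet> (A *v (transpose A *v v))"
    by (simp only: matrix_vector_mul_assoc inner_commute)
  also have "\<dots> = (w v* A) \<bullet> (transpose A *v v)"
    by (rule dot_lmul_matrix[symmetric])
  finally show ?thesis
    by (simp add: inner_commute)
qed

text \<open>The quadratic form of the Gram matrix attains its minimum \<open>m\<close> on the unit
  sphere, and the minimiser is an eigenvector by the first-variation argument. Hence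
  \<open>m\<close> is the least eigenvalue, the \<open>LEAST\<close> in the definition is attained,
  and minimality is the asserted bound.\<close>

lemma smallest_singular_value_bound:
  fixes T :: "int ^ 'd ^ 'o"
  shows "smallest_singular_value T * norm u \<le> norm (transpose (real_matrix T) *v u)"
    and "0 \<le> smallest_singular_value T"
proof -
  define A where "A = real_matrix T"
  define B where "B = transpose A"
  define q where "q = (\<lambda>v. (B *v v) \<bullet> (B *v v))"
  have adj: "((A ** B) *v v) \<bullet> w = (B *v v) \<bullet> (B *v w)" for v w
    unfolding B_def by (rule inner_gram_matrix)
  obtain e :: "real ^ 'o" where "norm e = 1" using vector_choose_size[of 1] by auto
  then have "sphere (0 :: real ^ 'o) 1 \<noteq> {}" by auto
  moreover have "continuous_on (sphere 0 1) q"
    unfolding q_def by (intro continuous_intros matrix_vector_mult_linear_continuous_on)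
  ultimately obtain v where v: "norm v = 1" "\<And>u. norm u = 1 \<Longrightarrow> q v \<le> q u"
    using continuous_attains_inf[OF compact_sphere, of 0 1 q] by auto
  define m where "m = q v"
  have m: "m * (u \<bullet> u) \<le> q u" for u
  proof (cases "u = 0")
    case False
    have "q v \<le> q (u /\<^sub>R norm u)" by (rule v(2)) (use False in simp)
    also have "\<dots> = q u / (u \<bullet> u)"
      by (simp add: q_def matrix_vector_mult_scaleR power2_norm_eq_inner[symmetric] power2_eq_square divide_simps)
    finally show ?thesis using False by (simp add: m_def field_simps)
  qed (simp add: q_def)
  define N where "N = (A ** B) *v v - m *\<^sub>R v"
  have vv: "v \<bullet> v = 1" using v(1) by (simp add: power2_norm_eq_inner[symmetric])
  have ABv: "(B *v v) \<bullet> (B *v w) = N \<bullet> w + m * (v \<bullet> w)" for w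
    using adj[of v w] by (simp add: N_def inner_diff_left)
  have "N \<bullet> N = 0"
  proof (rule first_order_term_zero)
    fix t
    have Nv: "N \<bullet> v = 0"
      using ABv[of v] vv by (simp add: m_def q_def)
    have "m * ((v - t *\<^sub>R N) \<bullet> (v - t *\<^sub>R N)) \<le> q (v - t *\<^sub>R N)" by (rule m)
    also have "q (v - t *\<^sub>R N) = m - 2 * t * (N \<bullet> N) + t * t * q N"
      using ABv[of N] Nv unfolding q_def
      by (simp add: matrix_vector_mult_diff_distrib matrix_vector_mult_scaleR inner_diff_left inner_diff_right
          m_def q_def inner_commute algebra_simps)
    also have "(v - t *\<^sub>R N) \<bullet> (v - t *\<^sub>R N) = 1 + t * t * (N \<bullet> N)"
      using Nv vv by (simp add: inner_diff_left inner_diff_right inner_commute)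
    finally show "2 * t * (N \<bullet> N) \<le> t * t * (q N - m * (N \<bullet> N))"
      by (simp add: algebra_simps)
  qed simp
  then have ev: "(A ** B) *v v = m *\<^sub>R v" by (simp add: N_def)
  have "(LEAST x. \<exists>v. v \<noteq> 0 \<and> (A ** B) *v v = x *\<^sub>R v) = m"
  proof (rule Least_equality)
    show "\<exists>v. v \<noteq> 0 \<and> (A ** B) *v v = m *\<^sub>R v"
      using ev v(1) by (intro exI[of _ v]) auto
    fix x assume "\<exists>v. v \<noteq> 0 \<and> (A ** B) *v v = x *\<^sub>R v"
    then obtain w where w: "w \<noteq> 0" "(A ** B) *v w = x *\<^sub>R w" by blast
    have "m * (w \<bullet> w) \<le> q w" by (rule m)
    also have "q w = x * (w \<bullet> w)" using adj[of w w] w(2) by (simp add: q_def)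
    finally show "m \<le> x" using w(1) by simp
  qed
  then have \<tau>: "smallest_singular_value T = sqrt m"
    by (simp add: smallest_singular_value_def A_def B_def)
  have m0: "m \<ge> 0" by (simp add: m_def q_def)
  show "0 \<le> smallest_singular_value T" using m0 by (simp add: \<tau>)
  have "(sqrt m * norm u)\<^sup>2 \<le> (norm (B *v u))\<^sup>2"
    using m[of u] m0 by (simp add: power_mult_distrib power2_norm_eq_inner q_def)
  then show "smallest_singular_value T * norm u \<le> norm (transpose (real_matrix T) *v u)"
    unfolding \<tau> A_def[symmetric] B_def[symmetric] by (rule power2_le_imp_le) simp
qed

text \<open>Rounding \<open>T k / (2 * pi)\<close> to integers leaves a defect \<open>r\<close> with
  entries at most \<open>pi\<close>, whose norm is bounded by the sum of the entries; this gives
  \<open>pi * CARD('o)\<close>. The correction \<open>x = B w\<close> lies in the range of the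
  transpose, so \<open>norm x ^ 2 = r \<bullet> w\<close> and
  \<open>\<tau> * norm w \<le> norm x\<close> combine to
  \<open>\<tau> * norm x \<le> norm r\<close>.\<close>

lemma admissible_dense:
  fixes T :: "int ^ 'd ^ 'o"
  assumes \<tau>: "0 < smallest_singular_value T"
  shows "\<exists>k'\<in>admissible T. norm (k' - k) \<le> pi * CARD('o) / smallest_singular_value T"
proof -
  define A where "A = real_matrix T"
  define B where "B = transpose A"
  define \<tau> where "\<tau> = smallest_singular_value T"
  have bd: "\<tau> * norm u \<le> norm (B *v u)" for u
    using smallest_singular_value_bound(1)[of T u] by (simp add: \<tau>_def A_def B_def)
  have adj: "((A ** B) *v v) \<bullet> w = (B *v v) \<bullet> (B *v w)" for v w
    unfolding B_def by (rule inner_gram_matrix)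
  have "inj ((*v) (A ** B))"
    unfolding linear_injective_0[OF matrix_vector_mul_linear]
  proof (intro allI impI)
    fix w assume "(A ** B) *v w = 0"
    then have "B *v w = 0" using adj[of w w] by simp
    then show "w = 0" using bd[of w] assms by (simp add: \<tau>_def mult_le_0_iff)
  qed
  then have surj: "surj ((*v) (A ** B))"
    by (rule linear_inj_imp_surj[OF matrix_vector_mul_linear])
  define n where "n = (\<chi> i. round ((A *v k) $ i / (2 * pi)))"
  define r where "r = (2 * pi) *\<^sub>R ivec n - A *v k"
  obtain w where w: "(A ** B) *v w = r" using surj by (metis surjD)
  define x where "x = B *v w"
  have Ax: "A *v x = r" using w by (simp add: x_def matrix_vector_mul_assoc)
  have "\<bar>r $ i\<bar> \<le> pi" for i
  proof -
    define y where "y = (A *v k) $ i / (2 * pi)"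
    have "r $ i = 2 * pi * (of_int (round y) - y)"
      by (simp add: r_def n_def ivec_def y_def field_simps)
    then have "\<bar>r $ i\<bar> = 2 * pi * \<bar>of_int (round y) - y\<bar>"
      by (simp add: abs_mult)
    also have "\<dots> \<le> 2 * pi * (1 / 2)"
      by (intro mult_left_mono of_int_round_abs_le) simp
    finally show ?thesis by simp
  qed
  then have "(\<Sum>i\<in>UNIV. \<bar>r $ i\<bar>) \<le> (\<Sum>i\<in>(UNIV :: 'o set). pi)"
    by (intro sum_mono)
  then have r: "norm r \<le> pi * CARD('o)"
    using norm_le_l1_cart[of r] by (simp add: mult.commute)
  have "x \<bullet> x = r \<bullet> w" using adj[of w w] w by (simp add: x_def)
  also have "\<dots> \<le> norm r * norm w" by (rule norm_cauchy_schwarz)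
  finally have "norm x * norm x \<le> norm r * norm w" by (simp add: power2_norm_eq_inner[symmetric] power2_eq_square)
  then have "\<tau> * (norm x * norm x) \<le> \<tau> * (norm r * norm w)"
    using assms by (simp add: \<tau>_def)
  also have "\<dots> = norm r * (\<tau> * norm w)" by simp
  also have "\<dots> \<le> norm r * norm x"
    by (intro mult_left_mono) (use bd[of w] in \<open>auto simp: x_def\<close>)
  finally have "(\<tau> * norm x) * norm x \<le> norm r * norm x" by simp
  then have "\<tau> * norm x \<le> norm r"
    by (cases "norm x = 0") (auto simp: mult_le_cancel_right)
  then have "norm x \<le> norm r / \<tau>"
    using assms by (simp add: \<tau>_def field_simps)
  also have "\<dots> \<le> pi * CARD('o) / \<tau>"
    using r assms by (simp add: \<tau>_def divide_right_mono)
  finally have "norm (k + x - k) \<le> pi * CARD('o) / \<tau>" by simp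
  moreover have "A *v (k + x) = (2 * pi) *\<^sub>R ivec n"
    using Ax by (simp add: matrix_vector_right_distrib r_def)
  then have "k + x \<in> admissible T"
    unfolding admissible_def two_pi_lattice_def A_def by blast
  ultimately show ?thesis
    unfolding \<tau>_def by blast
qed

lemma admissible_approximation:
  fixes S :: "nat \<Rightarrow> int ^ 'd ^ 'o"
  assumes "filterlim (\<lambda>n. smallest_singular_value (S n)) at_top sequentially"
  obtains x where "\<And>n. x n \<in> admissible (S n)" "x \<longlonglongrightarrow> k"
proof -
  define C where "C = pi * CARD('o)"
  \<comment> \<open>The point 0 serves for the indices at which the singular value is not positive;
    only finitely many of them occur.\<close>
  have "\<exists>x\<in>admissible (S n). 0 < smallest_singular_value (S n) \<longrightarrow> norm (x - k) \<le> C / smallest_singular_value (S n)" for n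
    using admissible_dense[of "S n" k] zero_in_admissible[of "S n"] by (auto simp: C_def)
  then obtain x where x: "\<And>n. x n \<in> admissible (S n)"
    "\<And>n. 0 < smallest_singular_value (S n) \<Longrightarrow> norm (x n - k) \<le> C / smallest_singular_value (S n)" by metis
  have "((\<lambda>n. C / smallest_singular_value (S n)) \<longlongrightarrow> 0) sequentially"
    by (rule real_tendsto_divide_at_top[OF tendsto_const assms])
  moreover have "\<forall>\<^sub>F n in sequentially. norm (x n - k) \<le> C / smallest_singular_value (S n)"
    using assms[unfolded filterlim_at_top_dense, rule_format, of 0] by eventually_elim (rule x(2))
  ultimately have "(\<lambda>n. x n - k) \<longlonglongrightarrow> 0"
    by (rule Lim_null_comparison[rotated])
  then have "x \<longlonglongrightarrow> k" by (simp add: LIM_zero_iff)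
  with x(1) show ?thesis by (rule that)
qed

section \<open>Band edges of subcoverings\<close>

context periodic_schroedinger
begin

lemma band_min_max_props:
  assumes j: "j \<in> {1..nbands}" and K: "compact (band G j ` K)" "0 \<in> K"
  shows "band_min G K j \<in> band G j ` K" "band_max G K j \<in> band G j ` K"
    "k \<in> K \<Longrightarrow> band_min G K j \<le> band G j k" "k \<in> K \<Longrightarrow> band G j k \<le> band_max G K j"
proof -
  have ne: "band G j ` K \<noteq> {}" using K(2) by auto
  show "band_min G K j \<in> band G j ` K" "band_max G K j \<in> band G j ` K"
    using LEAST_compact(1)[OF K(1) ne] GREATEST_compact(1)[OF K(1) ne]
    by (simp_all add: band_min_def band_max_def)
  show "k \<in> K \<Longrightarrow> band_min G K j \<le> band G j k" "k \<in> K \<Longrightarrow> band G j k \<le> band_max G K j"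
    using LEAST_compact(2)[OF K(1) ne, of "band G j k"] GREATEST_compact(2)[OF K(1) ne, of "band G j k"]
    by (simp_all add: band_min_def band_max_def)
qed

lemma zero_in_brillouin_sub: "0 \<in> brillouin_sub T"
  by (simp add: brillouin_sub_eq zero_in_admissible zero_in_brillouin)

lemma band_sub_interval:
  assumes j: "j \<in> {1..nbands}" and T: "primitive T"
  shows "band G j ` brillouin_sub T = {band_min G (brillouin_sub T) j .. band_max G (brillouin_sub T) j}"
  unfolding band_min_def band_max_def
  by (rule compact_connected_eq_interval[OF compact_band_image_sub[OF j] connected_band_image_sub[OF j T]])
    (use zero_in_brillouin_sub in auto)

lemmas band_edge_props =
  band_min_max_props[OF _ compact_band_image_full zero_in_brillouin]

lemmas band_edge_sub_props =
  band_min_max_props[OF _ compact_band_image_sub zero_in_brillouin_sub]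

lemma brillouin_sub_subset: "brillouin_sub T \<subseteq> brillouin"
  by (auto simp: brillouin_sub_def)

lemma band_edges_sub_bounds:
  assumes j: "j \<in> {1..nbands}"
  shows "band_min G brillouin j \<le> band_min G (brillouin_sub T) j"
    and "band_max G (brillouin_sub T) j \<le> band_max G brillouin j"
  using band_edge_sub_props(1,2)[OF j j, of T] band_edge_props(3,4)[OF j j] brillouin_sub_subset[of T]
  by auto

text \<open>Both extrema are attained, so equal edges mean that an extremal point of the full zone
  can be taken in the smaller set; conversely such a point closes the gap left by
  \<open>band_edges_sub_bounds\<close>.\<close>

lemma band_edges_sub_eq_iff:
  assumes j: "j \<in> {1..nbands}"
  shows "band_min G (brillouin_sub T) j = band_min G brillouin j
      \<longleftrightarrow> (\<exists>k\<in>min_points G j. real_matrix T *v k \<in> two_pi_lattice)" (is "?min \<longleftrightarrow> ?Kmin")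
    and "band_max G (brillouin_sub T) j = band_max G brillouin j
      \<longleftrightarrow> (\<exists>k\<in>max_points G j. real_matrix T *v k \<in> two_pi_lattice)" (is "?max \<longleftrightarrow> ?Kmax")
proof -
  note pts = min_points_def max_points_def brillouin_sub_def
  have "?min \<Longrightarrow> ?Kmin" "?max \<Longrightarrow> ?Kmax"
    using band_edge_sub_props(1,2)[OF j j, of T] by (auto simp: pts)
  moreover have ?min if K: ?Kmin
  proof -
    obtain k where "k \<in> brillouin_sub T" "band G j k = band_min G brillouin j" using K by (auto simp: pts)
    then show ?thesis
      using band_edge_sub_props(3)[OF j j, of k T] band_edges_sub_bounds(1)[OF j, of T] by simp
  qed
  moreover have ?max if K: ?Kmax
  proof -
    obtain k where "k \<in> brillouin_sub T" "band G j k = band_max G brillouin j" using K by (auto simp: pts)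
    then show ?thesis
      using band_edge_sub_props(4)[OF j j, of k T] band_edges_sub_bounds(2)[OF j, of T] by simp
  qed
  ultimately show "?min \<longleftrightarrow> ?Kmin" "?max \<longleftrightarrow> ?Kmax" by blast+
qed

text \<open>Admissible points converge to an extremal point of the full zone. Their band values
  squeeze each edge of the subcovering between the corresponding full edge and a sequence converging
  to it.\<close>

lemma band_edges_sub_tendsto:
  fixes S :: "nat \<Rightarrow> int ^ 'd ^ 'o"
  assumes j: "j \<in> {1..nbands}"
    and S: "filterlim (\<lambda>n. smallest_singular_value (S n)) at_top sequentially"
  shows "(\<lambda>n. band_min G (brillouin_sub (S n)) j) \<longlonglongrightarrow> band_min G brillouin j"
    and "(\<lambda>n. band_max G (brillouin_sub (S n)) j) \<longlonglongrightarrow> band_max G brillouin j"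
proof -
  have lim: "\<exists>x. (\<forall>n. band_min G (brillouin_sub (S n)) j \<le> x n \<and> x n \<le> band_max G (brillouin_sub (S n)) j) \<and>
      x \<longlonglongrightarrow> band G j k" for k
  proof -
    obtain x where x: "\<And>n. x n \<in> admissible (S n)" "x \<longlonglongrightarrow> k"
      by (rule admissible_approximation[OF S, of k]) blast
    have "isCont (band G j) k"
      using continuous_on_band[OF j, of UNIV] by (simp add: continuous_on_eq_continuous_at)
    then have "(\<lambda>n. band G j (x n)) \<longlonglongrightarrow> band G j k"
      using x(2) by (rule isCont_tendsto_compose)
    moreover have "band_min G (brillouin_sub (S n)) j \<le> band G j (x n) \<and> band G j (x n) \<le> band_max G (brillouin_sub (S n)) j" for n
    proof -
      \<comment> \<open>The approximants may leave the cell; by periodicity their band values still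
        belong to the subcovering.\<close>
      have "band G j (x n) \<in> band G j ` brillouin_sub (S n)"
        unfolding brillouin_sub_eq band_image_brillouin[OF periodic_set_admissible] using x(1) by simp
      then show ?thesis using band_edge_sub_props(3,4)[OF j j] by auto
    qed
    ultimately show ?thesis by (intro exI[of _ "\<lambda>n. band G j (x n)"]) auto
  qed
  obtain k where "band_min G brillouin j = band G j k"
    using band_edge_props(1)[OF j j] by auto
  then obtain x where x: "\<And>n. band_min G (brillouin_sub (S n)) j \<le> x n" "x \<longlonglongrightarrow> band_min G brillouin j"
    using lim[of k] by auto
  show "(\<lambda>n. band_min G (brillouin_sub (S n)) j) \<longlonglongrightarrow> band_min G brillouin j"
    by (rule tendsto_sandwich[OF _ _ tendsto_const x(2)]) (simp_all add: x(1) band_edges_sub_bounds[OF j])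
  obtain k where "band_max G brillouin j = band G j k"
    using band_edge_props(2)[OF j j] by auto
  then obtain x where x: "\<And>n. x n \<le> band_max G (brillouin_sub (S n)) j" "x \<longlonglongrightarrow> band_max G brillouin j"
    using lim[of k] by auto
  show "(\<lambda>n. band_max G (brillouin_sub (S n)) j) \<longlonglongrightarrow> band_max G brillouin j"
    by (rule tendsto_sandwich[OF _ _ x(2) tendsto_const]) (simp_all add: x(1) band_edges_sub_bounds[OF j])
qed

lemma pi_in_admissible:
  assumes "\<And>i. even (\<Sum>l\<in>UNIV. T $ i $ l)"
  shows "real_matrix T *v (\<chi> i. pi) \<in> two_pi_lattice"
  unfolding in_two_pi_lattice_iff
proof
  fix i
  obtain m where m: "(\<Sum>l\<in>UNIV. T $ i $ l) = 2 * m" using assms[of i] by (auto elim: evenE)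
  have "(real_matrix T *v (\<chi> i. pi)) $ i = of_int (\<Sum>l\<in>UNIV. T $ i $ l) * pi"
    by (simp add: real_matrix_def matrix_vector_mult_def sum_distrib_right)
  then have "(real_matrix T *v (\<chi> i. pi)) $ i / (2 * pi) = of_int m"
    unfolding m by simp
  then show "(real_matrix T *v (\<chi> i. pi)) $ i / (2 * pi) \<in> \<int>" by simp
qed

end

section \<open>Invertibility of local operators on square-summable functions\<close>

abbreviation l2 :: "('a \<Rightarrow> complex) \<Rightarrow> 'a set \<Rightarrow> real" where
  "l2 f \<equiv> L2_set (\<lambda>x. cmod (f x))"

lemma ell2_L2_set_le:
  assumes "f \<in> ell2 X" "finite F" "F \<subseteq> X"
  shows "l2 f F \<le> ell2_norm X f"
  unfolding L2_set_def ell2_norm_def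
  by (intro real_sqrt_le_mono finite_sum_le_infsum) (use assms in \<open>auto simp: ell2_def\<close>)

text \<open>Reduces membership and norm bounds to finite sets, where the triangle inequality of
  \<open>L2_set\<close> is available.\<close>

lemma ell2_boundI:
  assumes "\<And>x. x \<notin> X \<Longrightarrow> f x = 0" "\<And>F. finite F \<Longrightarrow> F \<subseteq> X \<Longrightarrow> l2 f F \<le> C"
  shows "f \<in> ell2 X" "ell2_norm X f \<le> C"
proof -
  have C: "0 \<le> C" using assms(2)[of "{}"] by simp
  have le: "(\<Sum>x\<in>F. (cmod (f x))\<^sup>2) \<le> C\<^sup>2" if "finite F" "F \<subseteq> X" for F
    using assms(2)[OF that] C unfolding L2_set_def by (simp add: real_sqrt_le_iff sqrt_le_D)
  have s: "(\<lambda>x. (cmod (f x))\<^sup>2) summable_on X"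
    by (rule nonneg_bounded_partial_sums_imp_summable_on[where C = "C\<^sup>2"])
      (auto intro!: eventually_finite_subsets_at_top_weakI le)
  then show "f \<in> ell2 X" using assms(1) by (simp add: ell2_def)
  have "(\<Sum>\<^sub>\<infinity>x\<in>X. (cmod (f x))\<^sup>2) \<le> C\<^sup>2"
    by (rule infsum_le_finite_sums[OF s le])
  then show "ell2_norm X f \<le> C"
    unfolding ell2_norm_def using C by (simp add: real_le_lsqrt)
qed

lemma ell2_norm_nonneg: "0 \<le> ell2_norm X f"
  by (simp add: ell2_norm_def infsum_nonneg)

lemma ell2_outside: "f \<in> ell2 X \<Longrightarrow> x \<notin> X \<Longrightarrow> f x = 0"
  by (simp add: ell2_def)

lemma ell2_cmod_le: "f \<in> ell2 X \<Longrightarrow> cmod (f x) \<le> ell2_norm X f"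
  using ell2_L2_set_le[of f X "{x}"] ell2_norm_nonneg[of X f]
  by (cases "x \<in> X") (auto simp: ell2_def L2_set_def)

lemma L2_set_cmod_add:
  "L2_set (\<lambda>x. cmod (f x + g x)) F \<le> l2 f F + l2 g F"
  by (rule order.trans[OF L2_set_mono L2_set_triangle_ineq]) (auto intro: norm_triangle_ineq)

lemma ell2_add:
  assumes "f \<in> ell2 X" "g \<in> ell2 X"
  shows "(\<lambda>x. f x + g x) \<in> ell2 X" "ell2_norm X (\<lambda>x. f x + g x) \<le> ell2_norm X f + ell2_norm X g"
proof -
  have *: "L2_set (\<lambda>x. cmod (f x + g x)) F \<le> ell2_norm X f + ell2_norm X g" if "finite F" "F \<subseteq> X" for F
    using L2_set_cmod_add[of f g F] ell2_L2_set_le[OF assms(1) that] ell2_L2_set_le[OF assms(2) that] by linarith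
  have 0: "\<And>x. x \<notin> X \<Longrightarrow> f x + g x = 0" using assms by (simp add: ell2_outside)
  show "(\<lambda>x. f x + g x) \<in> ell2 X" "ell2_norm X (\<lambda>x. f x + g x) \<le> ell2_norm X f + ell2_norm X g"
    using ell2_boundI[OF 0 *] by auto
qed

lemma ell2_scale:
  assumes "f \<in> ell2 X"
  shows "(\<lambda>x. c * f x) \<in> ell2 X" "ell2_norm X (\<lambda>x. c * f x) \<le> cmod c * ell2_norm X f"
proof -
  have *: "L2_set (\<lambda>x. cmod (c * f x)) F \<le> cmod c * ell2_norm X f" if "finite F" "F \<subseteq> X" for F
    using mult_left_mono[OF ell2_L2_set_le[OF assms that], of "cmod c"]
    by (simp add: norm_mult L2_set_right_distrib)
  have 0: "\<And>x. x \<notin> X \<Longrightarrow> c * f x = 0" using assms by (simp add: ell2_outside)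
  show "(\<lambda>x. c * f x) \<in> ell2 X" "ell2_norm X (\<lambda>x. c * f x) \<le> cmod c * ell2_norm X f"
    using ell2_boundI[OF 0 *] by auto
qed

text \<open>Only finitely supported inputs and finite pieces of the output are tested, because this
  is what Parseval on a finite grid delivers; \<open>op_bound_ell2\<close> removes both restrictions
  for local operators.\<close>

definition op_bound :: "'a set \<Rightarrow> (('a \<Rightarrow> complex) \<Rightarrow> 'a \<Rightarrow> complex) \<Rightarrow> real \<Rightarrow> bool" where
  "op_bound X D q \<longleftrightarrow> 0 \<le> q \<and>
     (\<forall>f F H. finite F \<longrightarrow> F \<subseteq> X \<longrightarrow> (\<forall>x. x \<notin> F \<longrightarrow> f x = 0) \<longrightarrow> finite H \<longrightarrow> H \<subseteq> X \<longrightarrow>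
        l2 (D f) H \<le> q * l2 f F)"

definition preserves_support :: "'a set \<Rightarrow> (('a \<Rightarrow> complex) \<Rightarrow> 'a \<Rightarrow> complex) \<Rightarrow> bool" where
  "preserves_support X A \<longleftrightarrow> (\<forall>f. (\<forall>x. x \<notin> X \<longrightarrow> f x = 0) \<longrightarrow> (\<forall>x. x \<notin> X \<longrightarrow> A f x = 0))"

text \<open>By locality the values of \<open>D f\<close> on a finite set only involve a finite piece of \<open>f\<close>, so no
  limit is needed to pass from finitely supported functions to all of \<open>ell2 X\<close>.\<close>

lemma op_bound_ell2:
  assumes D: "local_op D" "preserves_support X D" "op_bound X D q" and f: "f \<in> ell2 X"
  shows "D f \<in> ell2 X" "ell2_norm X (D f) \<le> q * ell2_norm X f"
proof -
  have 0: "\<And>x. x \<notin> X \<Longrightarrow> D f x = 0"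
    using D(2) f by (auto simp: preserves_support_def ell2_def)
  have q: "0 \<le> q" using D(3) by (simp add: op_bound_def)
  have *: "l2 (D f) H \<le> q * ell2_norm X f" if H: "finite H" "H \<subseteq> X" for H
  proof -
    obtain N where N: "\<And>x. finite (N x)" "\<And>x f g. (\<forall>y\<in>N x. f y = g y) \<Longrightarrow> D f x = D g x"
      using D(1) unfolding local_op_def by metis
    define F where "F = (\<Union>x\<in>H. N x) \<inter> X"
    have F: "finite F" "F \<subseteq> X" using H N(1) by (auto simp: F_def)
    define g where "g = (\<lambda>x. if x \<in> F then f x else 0)"
    have "D f x = D g x" if "x \<in> H" for x
      by (rule N(2)) (use that f in \<open>auto simp: g_def F_def ell2_def\<close>)
    then have "l2 (D f) H = l2 (D g) H"
      by (intro L2_set_cong) auto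
    also have "\<dots> \<le> q * l2 g F"
      using D(3) F H unfolding op_bound_def by (simp add: g_def)
    also have "l2 g F = l2 f F"
      by (intro L2_set_cong) (auto simp: g_def)
    also have "q * \<dots> \<le> q * ell2_norm X f"
      by (intro mult_left_mono ell2_L2_set_le f F q)
    finally show ?thesis .
  qed
  show "D f \<in> ell2 X" "ell2_norm X (D f) \<le> q * ell2_norm X f"
    using ell2_boundI[OF 0 *] by auto
qed

text \<open>A value of \<open>A f\<close> is a fixed finite sum, so pointwise convergence passes
  through without any norm.\<close>

lemma local_op_tendsto:
  assumes "lin_op A" "local_op A" "\<And>x. (\<lambda>n. f n x) \<longlonglongrightarrow> g x"
  shows "(\<lambda>n. A (f n) x) \<longlonglongrightarrow> A g x"
proof -
  note * = local_op_kernel(2)[OF assms(1,2), of _ x]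
  show ?thesis
    unfolding *[of g] *[of "f _"] by (intro tendsto_intros assms(3))
qed

section \<open>Shifted operators and the inverse by a Neumann series\<close>

definition shift_op :: "(('a \<Rightarrow> complex) \<Rightarrow> 'a \<Rightarrow> complex) \<Rightarrow> complex \<Rightarrow> ('a \<Rightarrow> complex) \<Rightarrow> 'a \<Rightarrow> complex" where
  "shift_op A z f = (\<lambda>x. A f x - z * f x)"

lemma lin_op_shift_op: "lin_op A \<Longrightarrow> lin_op (shift_op A z)"
  by (simp add: lin_op_def shift_op_def fun_eq_iff algebra_simps)

lemma local_op_affine:
  assumes "local_op A"
  shows "local_op (\<lambda>f x. c * f x - d * A f x)"
  unfolding local_op_def
proof
  fix x
  obtain F where F: "finite F" "\<And>f g. (\<forall>y\<in>F. f y = g y) \<Longrightarrow> A f x = A g x"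
    using assms unfolding local_op_def by blast
  show "\<exists>F. finite F \<and> (\<forall>f g. (\<forall>y\<in>F. f y = g y) \<longrightarrow> c * f x - d * A f x = c * g x - d * A g x)"
    by (rule exI[of _ "insert x F"]) (use F in \<open>auto intro!: arg_cong2[where f = "(-)"] arg_cong[where f = "(*) d"]\<close>)
qed

lemma local_op_shift_op: "local_op A \<Longrightarrow> local_op (shift_op A z)"
  using local_op_affine[of A "- z" "- 1"] by (simp add: shift_op_def[abs_def])

lemma local_op_comp:
  assumes "local_op A" "local_op B"
  shows "local_op (\<lambda>f. A (B f))"
  unfolding local_op_def
proof
  fix x
  obtain F where F: "finite F" "\<And>f g. (\<forall>y\<in>F. f y = g y) \<Longrightarrow> A f x = A g x"
    using assms(1) unfolding local_op_def by blast
  obtain N where N: "\<And>x. finite (N x)" "\<And>x f g. (\<forall>y\<in>N x. f y = g y) \<Longrightarrow> B f x = B g x"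
    using assms(2) unfolding local_op_def by metis
  have "A (B f) x = A (B g) x" if "\<forall>y\<in>\<Union>(N ` F). f y = g y" for f g
    by (intro F(2) ballI N(2)) (use that in auto)
  then show "\<exists>F. finite F \<and> (\<forall>f g. (\<forall>y\<in>F. f y = g y) \<longrightarrow> A (B f) x = A (B g) x)"
    using F(1) N(1) by (intro exI[of _ "\<Union>(N ` F)"]) auto
qed

lemma lin_op_comp: "lin_op A \<Longrightarrow> lin_op B \<Longrightarrow> lin_op (\<lambda>f. A (B f))"
  by (simp add: lin_op_def)

text \<open>The right-hand side is symmetric in \<open>z\<close> and \<open>w\<close>, so shifts by
  different numbers commute.\<close>

lemma shift_op_commute:
  assumes "lin_op A"
  shows "shift_op A z (shift_op A w f) x = A (A f) x + (- z - w) * A f x + z * w * f x"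
proof -
  have "A (\<lambda>y. A f y - w * f y) = A (\<lambda>y. (- w) * f y + A f y)" by (simp add: add.commute)
  also have "\<dots> = (\<lambda>y. (- w) * A f y + A (A f) y)"
    using assms unfolding lin_op_def by blast
  finally show ?thesis by (simp add: shift_op_def algebra_simps)
qed

text \<open>The product \<open>B\<close> of the two shifts is used in both orders:
  \<open>B = P' P\<close> gives the lower bound and hence injectivity of \<open>P\<close>, while
  \<open>B = P P'\<close> turns a solution of \<open>s * B g = h\<close> into a preimage of
  \<open>h\<close> under \<open>P\<close>.\<close>

lemma bounded_inverse_ell2:
  fixes A :: "('a \<Rightarrow> complex) \<Rightarrow> 'a \<Rightarrow> complex" and s :: real
  assumes A: "lin_op A" "local_op A" "preserves_support X A"
    and M: "op_bound X (shift_op A z) M" "op_bound X (shift_op A (cnj z)) M"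
    and D: "op_bound X (\<lambda>f x. f x - of_real s * shift_op A z (shift_op A (cnj z) f) x) q" "q < 1" and s: "s \<ge> 0"
  shows "bij_betw (\<lambda>f x. A f x - z * f x) (ell2 X) (ell2 X) \<and>
     (\<exists>C. \<forall>f\<in>ell2 X. ell2_norm X f \<le> C * ell2_norm X (\<lambda>x. A f x - z * f x))"
proof -
  define P where "P = shift_op A z"
  define P' where "P' = shift_op A (cnj z)"
  define B where "B = (\<lambda>f. P (P' f))"
  define E where "E = (\<lambda>f x. f x - of_real s * B f x)"
  have linP: "lin_op P" "lin_op P'" and locP: "local_op P" "local_op P'"
    using A by (simp_all add: P_def P'_def lin_op_shift_op local_op_shift_op)
  have supP: "preserves_support X P" "preserves_support X P'"
    using A(3) by (auto simp: P_def P'_def preserves_support_def shift_op_def)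
  have linB: "lin_op B" and locB: "local_op B"
    unfolding B_def using linP locP by (simp_all add: lin_op_comp local_op_comp)
  have B': "B f = P' (P f)" for f
    unfolding B_def P_def P'_def by (rule ext) (simp add: shift_op_commute[OF A(1)] algebra_simps)
  have locE: "local_op E"
    using local_op_affine[OF locB, of 1 "of_real s"] by (simp add: E_def[abs_def])
  have supE: "preserves_support X E"
    using supP by (auto simp: E_def B_def preserves_support_def)
  have bE: "op_bound X E q" using D(1) by (simp add: E_def B_def P_def P'_def)
  have q: "0 \<le> q" and M0: "0 \<le> M" using D(1) M(1) by (simp_all add: op_bound_def)
  have E: "E f \<in> ell2 X" "ell2_norm X (E f) \<le> q * ell2_norm X f" if "f \<in> ell2 X" for f
    using op_bound_ell2[OF locE supE bE that] .
  have P: "P f \<in> ell2 X" if "f \<in> ell2 X" for f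
    using op_bound_ell2(1)[OF locP(1) supP(1) _ that] M(1) by (simp add: P_def)
  have P': "P' f \<in> ell2 X" "ell2_norm X (P' f) \<le> M * ell2_norm X f" if "f \<in> ell2 X" for f
    using op_bound_ell2[OF locP(2) supP(2) _ that] M(2) by (simp_all add: P'_def)
  have lower: "ell2_norm X f \<le> s * M / (1 - q) * ell2_norm X (P f)" if f: "f \<in> ell2 X" for f
  proof -
    have "f = (\<lambda>x. E f x + of_real s * P' (P f) x)"
      by (simp add: E_def B'[symmetric])
    then have "ell2_norm X f = ell2_norm X (\<lambda>x. E f x + of_real s * P' (P f) x)" by metis
    also have "\<dots> \<le> ell2_norm X (E f) + ell2_norm X (\<lambda>x. of_real s * P' (P f) x)"
      by (intro ell2_add ell2_scale E P' P f)
    also have "\<dots> \<le> q * ell2_norm X f + s * ell2_norm X (P' (P f))"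
      using E(2)[OF f] ell2_scale(2)[OF P'(1)[OF P[OF f]], of "of_real s"] s by simp
    also have "\<dots> \<le> q * ell2_norm X f + s * (M * ell2_norm X (P f))"
      using P'(2)[OF P[OF f]] s by (simp add: mult_left_mono)
    finally have "(1 - q) * ell2_norm X f \<le> s * M * ell2_norm X (P f)"
      by (simp add: algebra_simps)
    then show ?thesis
      using D(2) by (simp add: field_simps)
  qed
  have "inj_on P (ell2 X)"
  proof (rule inj_onI)
    fix f g assume fg: "f \<in> ell2 X" "g \<in> ell2 X" "P f = P g"
    define h where "h = (\<lambda>x. f x + (- 1) * g x)"
    have h: "h \<in> ell2 X" unfolding h_def by (intro ell2_add ell2_scale fg)
    have "P h = (\<lambda>x. P f x + (- 1) * P g x)"
      unfolding h_def using linP(1) by (subst lin_op_add[OF linP(1)], subst lin_op_scale[OF linP(1)]) rule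
    then have "P h = (\<lambda>x. 0)" using fg(3) by simp
    then have "ell2_norm X h \<le> 0" using lower[OF h] by (simp add: ell2_norm_def)
    then have "cmod (h x) \<le> 0" for x using ell2_cmod_le[OF h, of x] by linarith
    then show "f = g" by (auto simp: h_def)
  qed
  moreover have "h \<in> P ` ell2 X" if h: "h \<in> ell2 X" for h
  proof -
    \<comment> \<open>Neumann series for the inverse of \<open>B = P P'\<close>, summed pointwise.\<close>
    define d where "d = (\<lambda>n. (E ^^ n) h)"
    define N where "N = ell2_norm X h"
    have N0: "N \<ge> 0" by (simp add: N_def ell2_norm_nonneg)
    have d: "d n \<in> ell2 X \<and> ell2_norm X (d n) \<le> q ^ n * N" for n
    proof (induction n)
      case 0
      then show ?case using h by (simp add: d_def N_def)
    next
      case (Suc n)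
      have "ell2_norm X (E (d n)) \<le> q * ell2_norm X (d n)" using Suc E by blast
      also have "\<dots> \<le> q * (q ^ n * N)" using Suc q by (intro mult_left_mono) auto
      finally show ?case using Suc E by (simp add: d_def mult.assoc)
    qed
    have sq: "summable (\<lambda>n. q ^ n * N)"
      using q D(2) by (intro summable_mult2 summable_geometric) auto
    have dx: "cmod (d n x) \<le> q ^ n * N" for n x
      using ell2_cmod_le[of "d n" X x] d[of n] by linarith
    have sd: "summable (\<lambda>n. d n x)" for x
      by (rule summable_comparison_test'[OF sq, of 0]) (rule dx)
    define S where "S = (\<lambda>m x. \<Sum>n<m. d n x)"
    define g where "g = (\<lambda>x. \<Sum>n. d n x)"
    have Sg: "(\<lambda>m. S m x) \<longlonglongrightarrow> g x" for x
      unfolding S_def g_def by (rule summable_LIMSEQ[OF sd])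
    have S: "S m \<in> ell2 X \<and> ell2_norm X (S m) \<le> (\<Sum>n<m. q ^ n * N)" for m
    proof (induction m)
      case 0
      show ?case by (auto simp: S_def ell2_def ell2_norm_def)
    next
      case (Suc m)
      have "S (Suc m) = (\<lambda>x. S m x + d m x)" by (simp add: S_def)
      then show ?case
        using ell2_add[of "S m" X "d m"] Suc d[of m] by simp
    qed
    \<comment> \<open>The partial sums are bounded in norm by the geometric series, and on each
      finite set this bound survives the pointwise limit.\<close>
    have g: "g \<in> ell2 X"
    proof (rule ell2_boundI(1))
      fix x assume "x \<notin> X"
      then have "S m x = 0" for m by (rule ell2_outside[OF conjunct1[OF S]])
      then show "g x = 0" using Sg[of x] by (simp add: LIMSEQ_const_iff)
    next
      fix F assume F: "finite F" "F \<subseteq> X"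
      have "(\<lambda>m. l2 (S m) F) \<longlonglongrightarrow> l2 g F"
        unfolding L2_set_def by (intro tendsto_intros Sg)
      moreover have "l2 (S m) F \<le> (\<Sum>n. q ^ n * N)" for m
      proof -
        have "l2 (S m) F \<le> ell2_norm X (S m)"
          using S[of m] F by (intro ell2_L2_set_le) auto
        also have "\<dots> \<le> (\<Sum>n<m. q ^ n * N)" using S[of m] by simp
        also have "\<dots> \<le> (\<Sum>n. q ^ n * N)"
          by (rule sum_le_suminf[OF sq]) (use q N0 in auto)
        finally show ?thesis .
      qed
      ultimately show "l2 g F \<le> (\<Sum>n. q ^ n * N)"
        by (intro LIMSEQ_le_const2[of _ _ "\<Sum>n. q ^ n * N"]) auto
    qed
    \<comment> \<open>The sum telescopes, since \<open>s * B (d n) = d n - d (Suc n)\<close> by the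
      definition of \<open>E\<close>.\<close>
    have BS: "of_real s * B (S m) x = h x - d m x" for m x
    proof (induction m)
      case 0
      show ?case by (simp add: S_def d_def lin_op_zero[OF linB])
    next
      case (Suc m)
      have "S (Suc m) = (\<lambda>x. S m x + d m x)" by (simp add: S_def)
      then have "B (S (Suc m)) x = B (S m) x + B (d m) x"
        using lin_op_add[OF linB] by simp
      moreover have "d (Suc m) x = d m x - of_real s * B (d m) x"
        by (simp add: d_def E_def)
      ultimately have "of_real s * B (S (Suc m)) x = of_real s * B (S m) x + (d m x - d (Suc m) x)"
        by (simp add: ring_distribs)
      then show ?case unfolding Suc.IH by simp
    qed
    have Bg: "of_real s * B g x = h x" for x
    proof -
      have "(\<lambda>m. of_real s * B (S m) x) \<longlonglongrightarrow> of_real s * B g x"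
        by (intro tendsto_intros local_op_tendsto[OF linB locB Sg])
      moreover have "(\<lambda>m. h x - d m x) \<longlonglongrightarrow> h x - 0"
        by (intro tendsto_intros summable_LIMSEQ_zero sd)
      ultimately show ?thesis
        unfolding BS using LIMSEQ_unique by fastforce
    qed
    have "h = (\<lambda>x. of_real s * P (P' g) x)" using Bg by (auto simp: B_def)
    also have "\<dots> = P (\<lambda>x. of_real s * P' g x)" by (rule lin_op_scale[OF linP(1), symmetric])
    finally show ?thesis
      using ell2_scale(1)[OF P'(1)[OF g]] by blast
  qed
  ultimately have "bij_betw P (ell2 X) (ell2 X)"
    using P unfolding bij_betw_def by blast
  moreover have "P = (\<lambda>f x. A f x - z * f x)"
    by (auto simp: P_def shift_op_def)
  ultimately show ?thesis
    using lower by (intro conjI exI[of _ "s * M / (1 - q)"] ballI) metis+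
qed

section \<open>Quotient graphs\<close>

definition lift_fun :: "(int ^ 'd) set \<Rightarrow> ((real ^ 'd) set \<Rightarrow> complex) \<Rightarrow> real ^ 'd \<Rightarrow> complex" where
  "lift_fun L f v = f (vorbit L v)"

context periodic_schroedinger
begin

lemma eorbit_eq_iff:
  assumes L: "lattice_subgroup L" and e: "e \<in> edges G" "e' \<in> edges G"
  shows "eorbit shift L e = eorbit shift L e' \<longleftrightarrow> (\<exists>a\<in>L. e = shift a e')"
proof
  assume *: "eorbit shift L e = eorbit shift L e'"
  have "shift 0 e \<in> eorbit shift L e"
    unfolding eorbit_def using subgroup_closed(1)[OF L] by blast
  then show "\<exists>a\<in>L. e = shift a e'"
    unfolding * using shift_zero[OF e(1)] by (auto simp: eorbit_def)
next
  assume "\<exists>a\<in>L. e = shift a e'"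
  then obtain a where a: "a \<in> L" "e = shift a e'" by blast
  have "\<exists>c\<in>L. shift b (shift a e') = shift c e'" if "b \<in> L" for b
    using subgroup_closed(4)[OF L that a(1)] shift_add[OF e(2), of b a] by (intro bexI[of _ "b + a"]) auto
  moreover have "\<exists>c\<in>L. shift b e' = shift c (shift a e')" if "b \<in> L" for b
    using subgroup_closed(2)[OF L that a(1)] shift_add[OF e(2), of "b - a" a] by (intro bexI[of _ "b - a"]) auto
  ultimately show "eorbit shift L e = eorbit shift L e'"
    unfolding a(2) eorbit_def by blast
qed

lemma quotient_ends:
  assumes L: "lattice_subgroup L" and e: "e \<in> edges G"
  shows "ends (quotient_graph G shift L) (eorbit shift L e) = vorbit L ` ends G e"
proof -
  have "vorbit L ` ends G (shift a e) = vorbit L ` ends G e" if "a \<in> L" for a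
  proof -
    have "vorbit L (v + ivec a) = vorbit L v" for v
      using that by (auto simp: vorbit_eq_iff[OF L])
    then show ?thesis
      by (simp add: ends_shift[OF e] image_image)
  qed
  moreover have "0 \<in> L" by (rule subgroup_closed(1)[OF L])
  ultimately show ?thesis
    by (auto simp: quotient_graph_def eorbit_def image_Union image_UN)
qed

lemma quotient_weight:
  assumes L: "lattice_subgroup L" and e: "e \<in> edges G"
  shows "weight (quotient_graph G shift L) (eorbit shift L e) = weight G e"
proof -
  have "shift 0 e \<in> eorbit shift L e"
    unfolding eorbit_def using subgroup_closed(1)[OF L] by blast
  then have "(SOME x. x \<in> eorbit shift L e) \<in> eorbit shift L e" by (rule someI)
  then show ?thesis
    using weight_shift[OF e] by (auto simp: quotient_graph_def eorbit_def)
qed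

lemma quotient_pot:
  assumes L: "lattice_subgroup L" and v: "v \<in> verts G"
  shows "pot (quotient_graph G shift L) (vorbit L v) = pot G v"
proof -
  have "v + ivec 0 \<in> vorbit L v"
    unfolding vorbit_def using subgroup_closed(1)[OF L] by blast
  then have "(SOME x. x \<in> vorbit L v) \<in> vorbit L v" by (rule someI)
  then show ?thesis
    using pot_shift[OF v] by (auto simp: quotient_graph_def vorbit_def)
qed

text \<open>Distinct edges at \<open>v\<close> are identified in the quotient only if they become loops, which do
  not contribute.\<close>

lemma schroedinger_quotient:
  assumes L: "lattice_subgroup L" and v: "v \<in> verts G"
  shows "schroedinger (quotient_graph G shift L) f (vorbit L v) = schroedinger G (lift_fun L f) v"
proof -
  let ?Q = "quotient_graph G shift L"
  define N where "N = {(E, U). E \<in> edges ?Q \<and> ends ?Q E = {vorbit L v, U}}"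
  define \<phi> where "\<phi> = (\<lambda>(e, u). (eorbit shift L e, vorbit L u))"
  have edges: "edges ?Q = eorbit shift L ` edges G" by (simp add: quotient_graph_def)
  have N: "N = \<phi> ` nbrs v"
  proof (intro subset_antisym subsetI)
    fix x assume "x \<in> N"
    then obtain E U where x: "x = (E, U)" "E \<in> edges ?Q" "ends ?Q E = {vorbit L v, U}" by (auto simp: N_def)
    then obtain e0 where e0: "e0 \<in> edges G" "E = eorbit shift L e0" unfolding edges by auto
    have "vorbit L v \<in> vorbit L ` ends G e0" using x(3) quotient_ends[OF L e0(1)] e0(2) by simp
    then obtain u0 where u0: "u0 \<in> ends G e0" "vorbit L v = vorbit L u0" by auto
    then obtain w0 where w0: "ends G e0 = {u0, w0}" using ends[OF e0(1)] by (metis insertE insert_commute singletonD)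
    \<comment> \<open>The representative \<open>e0\<close> is translated by the element of
      \<open>L\<close> that moves its endpoint \<open>u0\<close> onto \<open>v\<close>.\<close>
    obtain a where a: "a \<in> L" "v = u0 + ivec a" using u0(2) by (auto simp: vorbit_eq_iff[OF L])
    have "{vorbit L v, U} = {vorbit L v, vorbit L w0}"
      using x(3) quotient_ends[OF L e0(1)] e0(2) w0 u0(2) by simp
    then have "U = vorbit L w0" by (auto simp: doubleton_eq_iff)
    also have "\<dots> = vorbit L (w0 + ivec a)"
      using a(1) by (subst eq_commute) (auto simp: vorbit_eq_iff[OF L])
    finally have U: "U = vorbit L (w0 + ivec a)" .
    have "E = eorbit shift L (shift a e0)"
      unfolding e0(2) using a(1) by (subst eq_commute) (auto simp: eorbit_eq_iff[OF L edges_shift[OF e0(1)] e0(1)])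
    moreover have "(shift a e0, w0 + ivec a) \<in> nbrs v"
      using ends_shift[OF e0(1)] edges_shift[OF e0(1)] w0 a(2) by (auto simp: nbrs_def)
    ultimately show "x \<in> \<phi> ` nbrs v" unfolding x(1) \<phi>_def using U by force
  next
    fix x assume "x \<in> \<phi> ` nbrs v"
    then obtain e u where "x = (eorbit shift L e, vorbit L u)" "e \<in> edges G" "ends G e = {v, u}"
      by (auto simp: \<phi>_def nbrs_def)
    then show "x \<in> N"
      unfolding N_def edges using quotient_ends[OF L] by auto
  qed
  have "(\<Sum>(E, U)\<in>N. of_real (weight ?Q E) * (f (vorbit L v) - f U))
      = (\<Sum>x\<in>nbrs v. (\<lambda>(E, U). of_real (weight ?Q E) * (f (vorbit L v) - f U)) (\<phi> x))"
    unfolding N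
  proof (subst sum.reindex_nontrivial)
    fix x y assume xy: "x \<in> nbrs v" "y \<in> nbrs v" "x \<noteq> y" "\<phi> x = \<phi> y"
    obtain e u where x: "x = (e, u)" by (cases x)
    obtain e' u' where y: "y = (e', u')" by (cases y)
    have e: "e \<in> edges G" "ends G e = {v, u}" and e': "e' \<in> edges G" "ends G e' = {v, u'}"
      using xy x y by (auto simp: nbrs_def)
    have "eorbit shift L e' = eorbit shift L e" using xy x y by (simp add: \<phi>_def)
    then obtain a where a: "a \<in> L" "e' = shift a e" using eorbit_eq_iff[OF L e'(1) e(1)] by blast
    have ee: "{v, u'} = {v + ivec a, u + ivec a}" using e' e a ends_shift[OF e(1), of a] by simp
    have "a \<noteq> 0"
    proof
      assume "a = 0"
      then have "e' = e" using a shift_zero[OF e(1)] by simp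
      moreover have "u' = u" using ee \<open>a = 0\<close> by (auto simp: doubleton_eq_iff)
      ultimately show False using xy x y by simp
    qed
    then have "ivec a \<noteq> ivec 0" by (simp only: ivec_inject not_False_eq_True)
    then have "v \<noteq> v + ivec a" by simp
    \<comment> \<open>A nonzero translation can match the two endpoint sets only crosswise, which
      puts \<open>v\<close> and \<open>u\<close> into one orbit.\<close>
    then have "v = u + ivec a" using ee by (auto simp: doubleton_eq_iff)
    then have "vorbit L v = vorbit L u" using a(1) by (auto simp: vorbit_eq_iff[OF L])
    then show "(case \<phi> x of (E, U) \<Rightarrow> of_real (weight ?Q E) * (f (vorbit L v) - f U)) = 0"
      by (simp add: \<phi>_def x)
  qed simp_all
  also have "\<dots> = (\<Sum>(e, u)\<in>nbrs v. of_real (weight G e) * (lift_fun L f v - lift_fun L f u))"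
    by (intro sum.cong) (auto simp: \<phi>_def nbrs_def lift_fun_def quotient_weight[OF L])
  finally show ?thesis
    unfolding schroedinger_nbrs by (simp add: schroedinger_def N_def quotient_pot[OF L v] lift_fun_def)
qed

lemma quotient_verts: "verts (quotient_graph G shift L) = vorbit L ` verts G"
  by (simp add: quotient_graph_def)

lemma vorbit_in_quotient_verts:
  assumes "lattice_subgroup L"
  shows "vorbit L v \<in> verts (quotient_graph G shift L) \<longleftrightarrow> v \<in> verts G"
proof
  assume "vorbit L v \<in> verts (quotient_graph G shift L)"
  then obtain w where "w \<in> verts G" "vorbit L v = vorbit L w" unfolding quotient_verts by auto
  then show "v \<in> verts G" using verts_shift_iff by (auto simp: vorbit_eq_iff[OF assms])
qed (simp add: quotient_verts)

lemma preserves_support_quotient: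
  assumes L: "lattice_subgroup L"
  shows "preserves_support (verts (quotient_graph G shift L)) (schroedinger (quotient_graph G shift L))"
  unfolding preserves_support_def
proof (intro allI impI)
  let ?Q = "quotient_graph G shift L"
  fix f :: "(real ^ 'd) set \<Rightarrow> complex" and V assume f: "\<forall>x. x \<notin> verts ?Q \<longrightarrow> f x = 0" and V: "V \<notin> verts ?Q"
  have "{(E, U). E \<in> edges ?Q \<and> ends ?Q E = {V, U}} = {}"
  proof (rule ccontr)
    assume "{(E, U). E \<in> edges ?Q \<and> ends ?Q E = {V, U}} \<noteq> {}"
    then obtain E U where E: "E \<in> edges ?Q" "ends ?Q E = {V, U}" by auto
    then obtain e where e: "e \<in> edges G" "E = eorbit shift L e" by (auto simp: quotient_graph_def)
    have "V \<in> vorbit L ` ends G e" using E quotient_ends[OF L e(1)] e(2) by auto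
    moreover have "ends G e \<subseteq> verts G" using ends[OF e(1)] by auto
    ultimately show False using V unfolding quotient_verts by auto
  qed
  then show "schroedinger ?Q f V = 0" using f V unfolding schroedinger_def by (simp only:) simp
qed

end

section \<open>Fourier analysis on a subcovering\<close>

text \<open>Degree two covers both uses: the shifts \<open>A - z\<close>, whose boundedness is
  required, and the contraction built from a product of two shifts.\<close>

definition quad_op ::
  "(('a \<Rightarrow> complex) \<Rightarrow> 'a \<Rightarrow> complex) \<Rightarrow> complex \<Rightarrow> complex \<Rightarrow> complex \<Rightarrow> ('a \<Rightarrow> complex) \<Rightarrow> 'a \<Rightarrow> complex" where
  "quad_op A \<alpha> \<beta> \<delta> f x = \<alpha> * f x + \<beta> * A f x + \<delta> * A (A f) x"

text \<open>A geometric sum; the bound on \<open>d\<close> leaves 0 as the only multiple of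
  \<open>N\<close> in range.\<close>

lemma sum_roots_of_unity:
  fixes d :: int
  assumes "\<bar>d\<bar> < int N"
  shows "(\<Sum>m<N. exp (\<i> * of_real (2 * pi * real m * real_of_int d / real N))) = (if d = 0 then of_nat N else 0)"
proof (cases "d = 0")
  case False
  define w where "w = exp (\<i> * of_real (2 * pi * real_of_int d / real N))"
  have N: "N > 0" using assms by (cases N) auto
  have "w ^ N = exp (of_nat N * (\<i> * of_real (2 * pi * real_of_int d / real N)))"
    unfolding w_def by (rule exp_of_nat_mult[symmetric])
  also have "of_nat N * (\<i> * complex_of_real (2 * pi * real_of_int d / real N)) = \<i> * (of_int d * (of_real pi * 2))"
    using N by (simp add: field_simps)
  also have "exp \<dots> = 1"
    using exp_plus_2pin[of 0 d] by simp
  finally have wN: "w ^ N = 1" .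
  have "w \<noteq> 1"
  proof
    assume "w = 1"
    then obtain n :: int where n: "2 * pi * real_of_int d / real N = of_int (2 * n) * pi"
      unfolding w_def exp_eq_1 by auto
    then have "real_of_int d = of_int n * real N"
      using N by (simp add: field_simps)
    then have "d = n * int N"
      by (metis of_int_eq_iff of_int_mult of_int_of_nat_eq)
    then have "int N dvd d" by simp
    then show False using dvd_imp_le_int[OF False, of "int N"] assms by simp
  qed
  have "(\<Sum>m<N. exp (\<i> * of_real (2 * pi * real m * real_of_int d / real N))) = (\<Sum>m<N. w ^ m)"
    unfolding w_def by (intro sum.cong refl) (simp add: exp_of_nat_mult[symmetric] field_simps)
  also have "\<dots> = 0"
    using \<open>w \<noteq> 1\<close> wN by (simp add: geometric_sum)
  finally show ?thesis using False by simp
qed simp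

text \<open>One completion \<open>S\<close> of the rows to a lattice basis is fixed, so that
  coordinates with respect to \<open>S\<close> split the period lattice.\<close>

locale periodic_subcovering = periodic_schroedinger G shift
  for G :: "(real ^ 'd, 'e) wgraph" and shift :: "int ^ 'd \<Rightarrow> 'e \<Rightarrow> 'e" +
  fixes T :: "int ^ 'd ^ 'o" and S :: "(int ^ 'd) set"
  assumes T: "primitive T" and rows_S: "rows T \<subseteq> S" and S: "lattice_basis S"
begin

definition cobasis :: "(int ^ 'd) set" where "cobasis = S - rows T"

text \<open>The span of the basis vectors that are not rows: a complement of
  \<open>row_lattice T\<close>, which acts freely on the vertices of the subcovering and serves as
  its period lattice.\<close>

definition colattice :: "(int ^ 'd) set" where
  "colattice = {a. \<forall>s\<in>rows T. coord S a s = 0}"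

lemma finite_cobasis [simp]: "finite cobasis"
  using lattice_basis_finite[OF S] by (simp add: cobasis_def)

lemma row_in_S: "row i T \<in> S"
  using rows_S by (auto simp: rows_def)

lemma row_lattice_eq: "row_lattice T = {a. \<forall>s\<in>cobasis. coord S a s = 0}"
proof (intro subset_antisym subsetI)
  fix a assume "a \<in> row_lattice T"
  then obtain m where a: "a = (\<Sum>i\<in>UNIV. m i *s row i T)" by (auto simp: row_lattice_def)
  have "coord S a s = 0" if "s \<in> cobasis" for s
  proof -
    have "row i T \<noteq> s" for i using that by (auto simp: cobasis_def rows_def)
    then show ?thesis
      by (simp add: a coord_sum[OF S] coord_scale[OF S] coord_basis[OF S row_in_S])
  qed
  then show "a \<in> {a. \<forall>s\<in>cobasis. coord S a s = 0}" by simp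
next
  fix a assume a: "a \<in> {a. \<forall>s\<in>cobasis. coord S a s = 0}"
  have "a = (\<Sum>s\<in>S. coord S a s *s s)" by (simp add: coord_expansion[OF S])
  also have "\<dots> = (\<Sum>s\<in>rows T. coord S a s *s s)"
    by (rule sum.mono_neutral_right) (use a rows_S lattice_basis_finite[OF S] in \<open>auto simp: cobasis_def\<close>)
  also have "rows T = (\<lambda>i. row i T) ` UNIV" by (auto simp: rows_def)
  also have "(\<Sum>s\<in>(\<lambda>i. row i T) ` UNIV. coord S a s *s s) = (\<Sum>i\<in>UNIV. coord S a (row i T) *s row i T)"
    using T by (subst sum.reindex) (simp_all add: primitive_def)
  finally have "a = (\<Sum>i\<in>UNIV. coord S a (row i T) *s row i T)" .
  then show "a \<in> row_lattice T"
    unfolding row_lattice_def by (intro CollectI exI[of _ "\<lambda>i. coord S a (row i T)"] conjI TrueI)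
qed

lemma lattice_subgroups: "lattice_subgroup (row_lattice T)" "lattice_subgroup colattice"
  unfolding row_lattice_eq lattice_subgroup_def colattice_def
  by (simp_all add: coord_0[OF S] coord_diff[OF S])

lemma lattices_disjoint: "a \<in> row_lattice T \<Longrightarrow> a \<in> colattice \<Longrightarrow> a = 0"
proof -
  assume "a \<in> row_lattice T" "a \<in> colattice"
  then have "coord S a s = coord S 0 s" for s
    unfolding row_lattice_eq colattice_def
    by (cases "s \<in> S"; cases "s \<in> rows T") (auto simp: cobasis_def coord_0[OF S] coord_outside[OF S])
  then show "a = 0" using coord_inject[OF S] by blast
qed

lemma coord_lincomb_cobasis:
  "coord S (\<Sum>s\<in>S. (if s \<in> cobasis then m s else 0) *s s) t = (if t \<in> cobasis then m t else 0)"
  by (cases "t \<in> S") (auto simp: coord_lincomb[OF S] coord_outside[OF S] cobasis_def)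

lemma lattice_split: obtains l where "l \<in> colattice" "a - l \<in> row_lattice T" "\<And>s. s \<in> cobasis \<Longrightarrow> coord S l s = coord S a s"
proof
  define l where "l = (\<Sum>s\<in>S. (if s \<in> cobasis then coord S a s else 0) *s s)"
  have l: "coord S l t = (if t \<in> cobasis then coord S a t else 0)" for t
    unfolding l_def by (rule coord_lincomb_cobasis)
  show "l \<in> colattice" by (auto simp: colattice_def l cobasis_def)
  show "a - l \<in> row_lattice T" by (simp add: row_lattice_eq coord_diff[OF S] l)
  show "\<And>s. s \<in> cobasis \<Longrightarrow> coord S l s = coord S a s" by (simp add: l)
qed

abbreviation orb :: "real ^ 'd \<Rightarrow> (real ^ 'd) set" where "orb \<equiv> vorbit (row_lattice T)"
abbreviation subverts :: "(real ^ 'd) set set" where "subverts \<equiv> verts (subcovering G shift T)"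
abbreviation subop :: "((real ^ 'd) set \<Rightarrow> complex) \<Rightarrow> (real ^ 'd) set \<Rightarrow> complex" where
  "subop \<equiv> schroedinger (subcovering G shift T)"

lemmas orb_eq_iff = vorbit_eq_iff[OF lattice_subgroups(1)]
lemmas orb_in_subverts = vorbit_in_quotient_verts[OF lattice_subgroups(1)]
lemmas preserves_support_subop = preserves_support_quotient[OF lattice_subgroups(1)]

lemma orb_shift: "a \<in> row_lattice T \<Longrightarrow> orb (v + ivec a) = orb v"
  by (auto simp: orb_eq_iff)

text \<open>Product coordinates on the subcovering, finitely many representatives times the
  complementary lattice; the Fourier analysis acts on the second factor only.\<close>

definition pt :: "(real ^ 'd) \<times> (int ^ 'd) \<Rightarrow> (real ^ 'd) set" where
  "pt = (\<lambda>(r, a). orb (r + ivec a))"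

lemma inj_on_orb_compl: "inj_on (\<lambda>a. orb (v + ivec a)) colattice"
proof (rule inj_onI)
  fix a b assume ab: "a \<in> colattice" "b \<in> colattice" "orb (v + ivec a) = orb (v + ivec b)"
  then obtain c where c: "c \<in> row_lattice T" "v + ivec a = v + ivec b + ivec c"
    by (auto simp: orb_eq_iff)
  then have "ivec a = ivec (b + c)" by (simp add: ivec_add)
  then have "a - b = c" by simp
  moreover have "a - b \<in> colattice" using subgroup_closed(2)[OF lattice_subgroups(2)] ab by blast
  ultimately have "c = 0" using lattices_disjoint c(1) by blast
  then show "a = b" using \<open>a - b = c\<close> by simp
qed

lemma bij_betw_pt: "bij_betw pt (reps G \<times> colattice) subverts"
  unfolding bij_betw_def
proof
  show "inj_on pt (reps G \<times> colattice)"
  proof (rule inj_onI)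
    fix x y assume xy: "x \<in> reps G \<times> colattice" "y \<in> reps G \<times> colattice" "pt x = pt y"
    obtain r a s b where x: "x = (r, a)" and y: "y = (s, b)" by (cases x, cases y)
    obtain c where "r + ivec a = s + ivec b + ivec c"
      using xy(3) by (auto simp: pt_def x y orb_eq_iff)
    then have "rep (r + ivec a) = rep (s + ivec b + ivec c)" by simp
    then have rs: "r = s" using xy x y by simp
    have "orb (r + ivec a) = orb (r + ivec b)" using xy(3) by (simp add: pt_def x y rs)
    then have "a = b" using inj_onD[OF inj_on_orb_compl, of r a b] xy x y by simp
    with rs show "x = y" by (simp add: x y)
  qed
  show "pt ` (reps G \<times> colattice) = subverts"
  proof (intro subset_antisym subsetI)
    fix x assume "x \<in> pt ` (reps G \<times> colattice)"
    then show "x \<in> subverts"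
      using reps_subset verts_shift by (auto simp: pt_def quotient_verts)
  next
    fix x assume "x \<in> subverts"
    then obtain v where v: "v \<in> verts G" "x = orb v" by (auto simp: quotient_verts)
    obtain l where l: "l \<in> colattice" "off v - l \<in> row_lattice T" using lattice_split .
    have "v = rep v + ivec l + ivec (off v - l)"
      using rep_off[of v] by (simp add: ivec_diff)
    then have "x = orb (rep v + ivec l)" using orb_shift[OF l(2)] v(2) by metis
    then have "x = pt (rep v, l)" by (simp add: pt_def)
    then show "x \<in> pt ` (reps G \<times> colattice)"
      using v(1) l(1) by (intro image_eqI[of _ _ "(rep v, l)"]) auto
  qed
qed

lemmas inj_pt = bij_betw_imp_inj_on[OF bij_betw_pt]
lemmas surj_pt = bij_betw_imp_surj_on[OF bij_betw_pt]

section \<open>Finitely supported functions on the subcovering\<close>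

definition fin_supp :: "((real ^ 'd) set \<Rightarrow> complex) \<Rightarrow> bool" where
  "fin_supp f \<longleftrightarrow> finite {x. f x \<noteq> 0} \<and> (\<forall>x. x \<notin> subverts \<longrightarrow> f x = 0)"

abbreviation lft :: "((real ^ 'd) set \<Rightarrow> complex) \<Rightarrow> real ^ 'd \<Rightarrow> complex" where
  "lft \<equiv> lift_fun (row_lattice T)"

lemma lft_shift: "a \<in> row_lattice T \<Longrightarrow> lft f (v + ivec a) = lft f v"
  by (simp add: lift_fun_def orb_shift)

lemma lft_outside: "fin_supp f \<Longrightarrow> v \<notin> verts G \<Longrightarrow> lft f v = 0"
  by (simp add: lift_fun_def fin_supp_def orb_in_subverts)

lemma lft_subop: "v \<in> verts G \<Longrightarrow> lft (subop f) v = schroedinger G (lft f) v"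
  by (simp add: lift_fun_def[of _ "subop f"] schroedinger_quotient[OF lattice_subgroups(1)])

lemma fin_supp_lincomb: "fin_supp f \<Longrightarrow> fin_supp g \<Longrightarrow> fin_supp (\<lambda>x. c * f x + g x)"
  unfolding fin_supp_def by (auto intro: finite_subset[of _ "{x. f x \<noteq> 0} \<union> {x. g x \<noteq> 0}"])

lemma fin_supp_scale: "fin_supp f \<Longrightarrow> fin_supp (\<lambda>x. c * f x)"
  unfolding fin_supp_def by (auto intro: finite_subset[of _ "{x. f x \<noteq> 0}"])

text \<open>The image can be nonzero only at orbits coupled to the support by \<open>ker\<close>.
  The orbit over a support point is infinite, so \<open>ker\<close> is read at one chosen vertex
  \<open>\<rho> y\<close> over it; \<open>ker_sym\<close> and translation by the row lattice bring
  every coupling to this form.\<close>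

lemma fin_supp_subop:
  assumes f: "fin_supp f"
  shows "fin_supp (subop f)"
proof -
  have off: "\<forall>x. x \<notin> subverts \<longrightarrow> subop f x = 0"
    using preserves_support_subop f
    unfolding preserves_support_def fin_supp_def by blast
  define \<rho> where "\<rho> = (\<lambda>y. SOME v. v \<in> verts G \<and> y = orb v)"
  have \<rho>: "\<rho> y \<in> verts G \<and> y = orb (\<rho> y)" if "y \<in> subverts" for y
    unfolding \<rho>_def by (rule someI_ex) (use that in \<open>auto simp: quotient_verts\<close>)
  have "{x. subop f x \<noteq> 0} \<subseteq> (\<Union>y\<in>{y. f y \<noteq> 0}. orb ` {w. ker (\<rho> y) w \<noteq> 0})"
  proof
    fix x assume x: "x \<in> {x. subop f x \<noteq> 0}"
    then have "x \<in> subverts" using off by auto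
    then obtain v where v: "v \<in> verts G" "x = orb v" by (auto simp: quotient_verts)
    have "schroedinger G (lft f) v \<noteq> 0"
      using x v schroedinger_quotient[OF lattice_subgroups(1) v(1), of f] by simp
    then obtain u where u: "ker v u \<noteq> 0" "lft f u \<noteq> 0"
      unfolding schroedinger_eq_sum_ker by (metis (mono_tags, lifting) mem_Collect_eq mult_eq_0_iff sum.neutral)
    have y: "f (orb u) \<noteq> 0" using u by (simp add: lift_fun_def)
    then have "orb u \<in> subverts" using f by (auto simp: fin_supp_def)
    then have \<rho>u: "\<rho> (orb u) \<in> verts G" "orb u = orb (\<rho> (orb u))" using \<rho> by auto
    then obtain c where c: "c \<in> row_lattice T" "u = \<rho> (orb u) + ivec c"
      using orb_eq_iff by blast
    have "ker v u = ker u v" by (rule ker_sym)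
    also have "\<dots> = ker (\<rho> (orb u) + ivec c) (v + ivec (- c) + ivec c)"
      using c(2) by (simp add: ivec_minus)
    also have "\<dots> = ker (\<rho> (orb u)) (v + ivec (- c))" by (rule ker_shift[OF \<rho>u(1)])
    finally have "ker (\<rho> (orb u)) (v + ivec (- c)) \<noteq> 0" using u by simp
    moreover have "x = orb (v + ivec (- c))"
      using v(2) orb_shift[OF subgroup_closed(3)[OF lattice_subgroups(1) c(1)]] by simp
    ultimately show "x \<in> (\<Union>y\<in>{y. f y \<noteq> 0}. orb ` {w. ker (\<rho> y) w \<noteq> 0})"
      using y by blast
  qed
  moreover have "finite (\<Union>y\<in>{y. f y \<noteq> 0}. orb ` {w. ker (\<rho> y) w \<noteq> 0})"
    using f finite_ker by (auto simp: fin_supp_def)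
  ultimately show ?thesis
    using off finite_subset unfolding fin_supp_def by blast
qed

lemma fin_supp_quad: "fin_supp f \<Longrightarrow> fin_supp (quad_op subop \<alpha> \<beta> \<delta> f)"
  unfolding quad_op_def[abs_def] add.assoc
  by (intro fin_supp_lincomb fin_supp_scale fin_supp_subop)

section \<open>Bloch transform along the complementary lattice\<close>

lemma finite_lft_compl:
  assumes "fin_supp f"
  shows "finite {a \<in> colattice. lft f (v + ivec a) \<noteq> 0}"
proof -
  have "finite ((\<lambda>a. orb (v + ivec a)) -` {x. f x \<noteq> 0} \<inter> colattice)"
    by (rule finite_vimage_IntI[OF _ inj_on_orb_compl]) (use assms in \<open>simp add: fin_supp_def\<close>)
  then show ?thesis
    by (rule rev_finite_subset) (auto simp: lift_fun_def)
qed

text \<open>The sum runs over the complement only, because the lift is constant along the row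
  lattice. For finitely supported \<open>f\<close> it has finitely many nonzero terms.\<close>

definition bloch :: "real ^ 'd \<Rightarrow> ((real ^ 'd) set \<Rightarrow> complex) \<Rightarrow> real ^ 'd \<Rightarrow> complex" where
  "bloch k f v = (\<Sum>\<^sub>\<infinity>a\<in>colattice. chi k (- a) * lft f (v + ivec a))"

lemma bloch_eq_sum:
  assumes "finite A" "A \<subseteq> colattice" "\<And>a. a \<in> colattice - A \<Longrightarrow> lft f (v + ivec a) = 0"
  shows "bloch k f v = (\<Sum>a\<in>A. chi k (- a) * lft f (v + ivec a))"
proof -
  have "bloch k f v = (\<Sum>\<^sub>\<infinity>a\<in>A. chi k (- a) * lft f (v + ivec a))"
    unfolding bloch_def by (rule infsum_cong_neutral) (use assms in auto)
  then show ?thesis using assms(1) by simp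
qed

lemma bloch_lincomb:
  assumes "fin_supp f" "fin_supp g"
  shows "bloch k (\<lambda>x. c * f x + g x) v = c * bloch k f v + bloch k g v"
proof -
  define A where "A = {a \<in> colattice. lft f (v + ivec a) \<noteq> 0} \<union> {a \<in> colattice. lft g (v + ivec a) \<noteq> 0}"
  have A: "finite A" "A \<subseteq> colattice"
    using finite_lft_compl assms by (auto simp: A_def)
  have l: "lft (\<lambda>x. c * f x + g x) w = c * lft f w + lft g w" for w
    by (simp add: lift_fun_def)
  have "bloch k (\<lambda>x. c * f x + g x) v = (\<Sum>a\<in>A. chi k (- a) * (c * lft f (v + ivec a) + lft g (v + ivec a)))"
    by (subst bloch_eq_sum[OF A]) (auto simp: l A_def)
  also have "\<dots> = c * (\<Sum>a\<in>A. chi k (- a) * lft f (v + ivec a)) + (\<Sum>a\<in>A. chi k (- a) * lft g (v + ivec a))"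
    by (simp add: ring_distribs sum.distrib sum_distrib_left mult.left_commute)
  also have "(\<Sum>a\<in>A. chi k (- a) * lft f (v + ivec a)) = bloch k f v"
    by (rule bloch_eq_sum[OF A, symmetric]) (auto simp: A_def)
  also have "(\<Sum>a\<in>A. chi k (- a) * lft g (v + ivec a)) = bloch k g v"
    by (rule bloch_eq_sum[OF A, symmetric]) (auto simp: A_def)
  finally show ?thesis .
qed

text \<open>This is the meaning of admissibility: the character is trivial on the rows, hence
  compatible with functions that live on the quotient.\<close>

lemma chi_row_lattice:
  assumes k: "k \<in> admissible T" and a: "a \<in> row_lattice T"
  shows "chi k a = 1"
proof -
  obtain m where a: "a = (\<Sum>i\<in>UNIV. m i *s row i T)" using a by (auto simp: row_lattice_def)
  obtain n where n: "real_matrix T *v k = (2 * pi) *\<^sub>R ivec n"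
    using k by (auto simp: admissible_def two_pi_lattice_def)
  have "ivec (row i T) \<bullet> k = 2 * pi * of_int (n $ i)" for i
    using arg_cong[OF n, of "\<lambda>x. x $ i"] by (simp add: real_matrix_nth ivec_def)
  moreover have "ivec a = (\<Sum>i\<in>UNIV. of_int (m i) *\<^sub>R ivec (row i T))"
    by (simp add: a ivec_def vec_eq_iff)
  ultimately have "ivec a \<bullet> k = of_int (\<Sum>i\<in>UNIV. m i * n $ i) * (pi * 2)"
    by (simp add: inner_sum_left sum_distrib_left sum_distrib_right mult_ac)
  then have "chi k a = exp (0 + \<i> * (of_int (\<Sum>i\<in>UNIV. m i * n $ i) * (of_real pi * 2)))"
    by (simp only: chi_def) simp
  then show ?thesis unfolding exp_plus_2pin by simp
qed

lemma bloch_floquet_space: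
  assumes f: "fin_supp f" and k: "k \<in> admissible T"
  shows "bloch k f \<in> floquet_space G k"
proof -
  have "bloch k f v = 0" if "v \<notin> verts G" for v
    unfolding bloch_def using that lft_outside[OF f] verts_shift_iff by (simp add: infsum_0)
  moreover have "bloch k f (v + ivec b) = exp (\<i> * of_real (ivec b \<bullet> k)) * bloch k f v" for v b
  proof -
    \<comment> \<open>The translation is split: its complementary part \<open>l\<close> reindexes
      the sum and produces the factor, its row part is absorbed by the lift and by the
      character.\<close>
    obtain l where l: "l \<in> colattice" "b - l \<in> row_lattice T" using lattice_split .
    have bij: "bij_betw (\<lambda>a. a + l) colattice colattice"
      by (rule bij_betw_byWitness[where f' = "\<lambda>a. a - l"])
        (use l subgroup_closed[OF lattice_subgroups(2)] in auto)
    have "lft f (v + ivec b + ivec a) = lft f (v + ivec (a + l))" for a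
    proof -
      have *: "v + ivec b + ivec a = v + ivec (a + l) + ivec (b - l)"
        by (simp add: ivec_add ivec_diff)
      show ?thesis unfolding * by (rule lft_shift[OF l(2)])
    qed
    moreover have "chi k (- a) = chi k l * chi k (- (a + l))" for a
      by (simp add: chi_add[symmetric])
    ultimately have "bloch k f (v + ivec b)
        = (\<Sum>\<^sub>\<infinity>a\<in>colattice. chi k l * (chi k (- (a + l)) * lft f (v + ivec (a + l))))"
      unfolding bloch_def by (simp add: mult.assoc)
    also have "\<dots> = chi k l * (\<Sum>\<^sub>\<infinity>a\<in>colattice. chi k (- (a + l)) * lft f (v + ivec (a + l)))"
      by (rule infsum_cmult_right')
    also have "(\<Sum>\<^sub>\<infinity>a\<in>colattice. chi k (- (a + l)) * lft f (v + ivec (a + l))) = bloch k f v"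
      unfolding bloch_def
      by (rule infsum_reindex_bij_betw[OF bij, where f = "\<lambda>a. chi k (- a) * lft f (v + ivec a)"])
    also have "chi k l = chi k b"
      using chi_add[of k "b - l" l] chi_row_lattice[OF k l(2)] by simp
    finally show ?thesis by (simp add: chi_def)
  qed
  ultimately show ?thesis by (simp add: floquet_space_def)
qed

lemma bloch_subop:
  assumes f: "fin_supp f" and k: "k \<in> admissible T"
  shows "bloch k (subop f) = schroedinger G (bloch k f)"
proof (rule floquet_space_eqI)
  show "bloch k (subop f) \<in> floquet_space G k"
    by (intro bloch_floquet_space fin_supp_subop f k)
  show "schroedinger G (bloch k f) \<in> floquet_space G k"
    by (intro bloch_floquet_space schroedinger_floquet_space f k)
  fix v assume "v \<in> reps G"
  then have v: "v \<in> verts G" using reps_subset by auto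
  \<comment> \<open>One finite set of translations carries the Bloch sums at all \<open>u\<close>
    coupled to \<open>v\<close>, so the two finite sums can be exchanged.\<close>
  define A where "A = (\<Union>u\<in>{u. ker v u \<noteq> 0}. {a \<in> colattice. lft f (u + ivec a) \<noteq> 0})"
  have A: "finite A" "A \<subseteq> colattice"
    using finite_lft_compl[OF f] finite_ker by (auto simp: A_def)
  have l: "lft (subop f) (v + ivec a) = (\<Sum>u | ker v u \<noteq> 0. ker v u * lft f (u + ivec a))" for a
    unfolding lft_subop[OF verts_shift[OF v]] schroedinger_shift[OF v] by (rule schroedinger_eq_sum_ker)
  have "bloch k (subop f) v = (\<Sum>a\<in>A. chi k (- a) * (\<Sum>u | ker v u \<noteq> 0. ker v u * lft f (u + ivec a)))"
    unfolding l[symmetric] by (rule bloch_eq_sum[OF A]) (auto simp: l A_def intro!: sum.neutral)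
  also have "\<dots> = (\<Sum>u | ker v u \<noteq> 0. ker v u * (\<Sum>a\<in>A. chi k (- a) * lft f (u + ivec a)))"
    unfolding sum_distrib_left by (subst sum.swap) (simp add: mult.left_commute)
  also have "\<dots> = (\<Sum>u | ker v u \<noteq> 0. ker v u * bloch k f u)"
  proof (intro sum.cong refl)
    fix u assume "u \<in> {u. ker v u \<noteq> 0}"
    then have "bloch k f u = (\<Sum>a\<in>A. chi k (- a) * lft f (u + ivec a))"
      by (intro bloch_eq_sum[OF A]) (auto simp: A_def)
    then show "ker v u * (\<Sum>a\<in>A. chi k (- a) * lft f (u + ivec a)) = ker v u * bloch k f u" by simp
  qed
  finally show "bloch k (subop f) v = schroedinger G (bloch k f) v"
    by (simp add: schroedinger_eq_sum_ker)
qed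

lemma bloch_quad:
  assumes f: "fin_supp f" and k: "k \<in> admissible T"
  shows "bloch k (quad_op subop \<alpha> \<beta> \<delta> f) v = quad_op (schroedinger G) \<alpha> \<beta> \<delta> (bloch k f) v"
proof -
  have f2: "fin_supp (subop f)" "fin_supp (subop (subop f))"
    by (intro fin_supp_subop f)+
  have sc: "bloch k (\<lambda>x. c * g x) v = c * bloch k g v" if "fin_supp g" for c g
    using bloch_lincomb[OF that that, of k "c - 1" v] by (simp add: algebra_simps)
  have "bloch k (quad_op subop \<alpha> \<beta> \<delta> f) v = \<alpha> * bloch k f v + (\<beta> * bloch k (subop f) v
     + \<delta> * bloch k (subop (subop f)) v)"
    unfolding quad_op_def[abs_def] add.assoc
    by (simp add: bloch_lincomb fin_supp_lincomb fin_supp_scale f f2 sc)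
  then show ?thesis
    by (simp add: quad_op_def bloch_subop f f2 k)
qed

text \<open>In an orthonormal eigenbasis of the fibre the polynomial acts by multiplication with its
  values at the band energies.\<close>

lemma quad_op_floquet_bound:
  assumes \<phi>: "\<phi> \<in> floquet_space G k"
    and q: "\<And>i. i < nbands \<Longrightarrow> cmod (\<alpha> + \<beta> * of_real (band G (Suc i) k) + \<delta> * (of_real (band G (Suc i) k))\<^sup>2) \<le> q"
  shows "(\<Sum>r\<in>reps G. (cmod (quad_op (schroedinger G) \<alpha> \<beta> \<delta> \<phi> r))\<^sup>2) \<le> q\<^sup>2 * (\<Sum>r\<in>reps G. (cmod (\<phi> r))\<^sup>2)"
proof -
  obtain U \<mu> where b: "bloch_system k U \<mu>" using bloch_system_exists .
  define n where "n = nbands"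
  define c where "c = (\<lambda>i. ip \<phi> (U i))"
  have \<phi>e: "\<phi> = (\<lambda>v. \<Sum>i<n. c i * U i v)"
    using b \<phi> by (simp add: bloch_system_def n_def c_def)
  have H: "schroedinger G (\<lambda>v. \<Sum>i<n. d i * U i v) = (\<lambda>v. \<Sum>i<n. (d i * of_real (\<mu> i)) * U i v)" for d
    unfolding lin_op_sum[OF lin_op_schroedinger finite_lessThan]
    by (rule ext, rule sum.cong) (use b in \<open>auto simp: bloch_system_def n_def mult.assoc\<close>)
  define p where "p = (\<lambda>i. \<alpha> + \<beta> * of_real (\<mu> i) + \<delta> * (of_real (\<mu> i))\<^sup>2)"
  have quad: "quad_op (schroedinger G) \<alpha> \<beta> \<delta> \<phi> v = (\<Sum>i<n. (p i * c i) * U i v)" for v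
    unfolding \<phi>e quad_op_def H
    by (simp add: p_def sum_distrib_left sum.distrib[symmetric] algebra_simps power2_eq_square)
  have norm: "(\<Sum>r\<in>reps G. (cmod (\<Sum>i<n. d i * U i r))\<^sup>2) = (\<Sum>i<n. (cmod (d i))\<^sup>2)" for d
    using b unfolding bloch_system_def n_def by blast
  have p: "cmod (p i) \<le> q" if "i < n" for i
    using q[of i] that band_bloch[OF b, of i] by (simp add: p_def n_def)
  have "(\<Sum>r\<in>reps G. (cmod (quad_op (schroedinger G) \<alpha> \<beta> \<delta> \<phi> r))\<^sup>2) = (\<Sum>i<n. (cmod (p i * c i))\<^sup>2)"
    unfolding quad by (rule norm)
  also have "\<dots> \<le> (\<Sum>i<n. q\<^sup>2 * (cmod (c i))\<^sup>2)"
    by (intro sum_mono) (auto simp: norm_mult power_mult_distrib intro!: mult_right_mono power_mono p)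
  also have "\<dots> = q\<^sup>2 * (\<Sum>r\<in>reps G. (cmod (\<phi> r))\<^sup>2)"
    unfolding \<phi>e norm sum_distrib_left ..
  finally show ?thesis .
qed

section \<open>Parseval on a finite grid of admissible quasimomenta\<close>

lemma finite_fourier_grid:
  assumes A: "finite A" "A \<subseteq> colattice"
  obtains I :: "(int ^ 'd \<Rightarrow> nat) set" and \<kappa> where "finite I" "I \<noteq> {}" "\<And>i. i \<in> I \<Longrightarrow> \<kappa> i \<in> admissible T"
    "\<And>a b. a \<in> A \<Longrightarrow> b \<in> A \<Longrightarrow> (\<Sum>i\<in>I. chi (\<kappa> i) (a - b)) = (if a = b then of_nat (card I) else 0)"
proof -
  \<comment> \<open>Any common bound for the coordinate differences in \<open>A\<close> would do;
    summing them all gives one, and the successor makes it strict.\<close>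
  define m where "m = (\<Sum>(a, b)\<in>A \<times> A. \<Sum>s\<in>cobasis. nat \<bar>coord S (a - b) s\<bar>)"
  define N where "N = Suc m"
  have N: "\<bar>coord S (a - b) s\<bar> < int N" if "a \<in> A" "b \<in> A" "s \<in> cobasis" for a b s
  proof -
    have "nat \<bar>coord S (a - b) s\<bar> \<le> (\<Sum>s\<in>cobasis. nat \<bar>coord S (a - b) s\<bar>)"
      by (rule member_le_sum) (use that in auto)
    also have "\<dots> = (\<lambda>(a, b). \<Sum>s\<in>cobasis. nat \<bar>coord S (a - b) s\<bar>) (a, b)" by simp
    also have "\<dots> \<le> m"
      unfolding m_def by (rule member_le_sum) (use that A in auto)
    finally show ?thesis by (simp add: N_def)
  qed
  define I where "I = PiE cobasis (\<lambda>_. {..<N})"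
  \<comment> \<open>Multiples of \<open>2 * pi / N\<close> along the dual vectors of the cobasis:
    these are orthogonal to all rows, hence admissible, and a character at such a point only sees
    the cobasis coordinates.\<close>
  define \<kappa> where "\<kappa> = (\<lambda>\<theta>. \<Sum>s\<in>cobasis. (2 * pi * real (\<theta> s) / real N) *\<^sub>R ivec (dual S s))"
  have inner: "ivec a \<bullet> \<kappa> \<theta> = (\<Sum>s\<in>cobasis. 2 * pi * real (\<theta> s) * real_of_int (coord S a s) / real N)" for a \<theta>
    by (simp add: \<kappa>_def inner_sum_right inner_ivec_dual[OF S])
  have "\<kappa> \<theta> \<in> admissible T" for \<theta>
  proof -
    have "ivec (row i T) \<bullet> \<kappa> \<theta> = 0" for i
      unfolding inner by (rule sum.neutral) (auto simp: coord_basis[OF S row_in_S] cobasis_def rows_def)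
    then show ?thesis
      by (simp add: admissible_def in_two_pi_lattice_iff real_matrix_nth)
  qed
  moreover have "(\<Sum>\<theta>\<in>I. chi (\<kappa> \<theta>) (a - b)) = (if a = b then of_nat (card I) else 0)" if ab: "a \<in> A" "b \<in> A" for a b
  proof (cases "a = b")
    case False
    have "\<exists>s\<in>cobasis. coord S (a - b) s \<noteq> 0"
    proof (rule ccontr)
      assume "\<not> (\<exists>s\<in>cobasis. coord S (a - b) s \<noteq> 0)"
      then have "a - b \<in> row_lattice T" by (simp add: row_lattice_eq)
      moreover have "a - b \<in> colattice"
        using subgroup_closed(2)[OF lattice_subgroups(2)] ab A by blast
      ultimately have "a - b = 0" using lattices_disjoint by blast
      with False show False by simp
    qed
    then obtain s where s: "s \<in> cobasis" "coord S (a - b) s \<noteq> 0" by blast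
    \<comment> \<open>The character is a product over the cobasis and the grid is a full product
      set, so the sum factors; one factor with a nonzero coordinate difference vanishes.\<close>
    have "(\<Sum>\<theta>\<in>I. chi (\<kappa> \<theta>) (a - b))
        = (\<Sum>\<theta>\<in>I. \<Prod>s\<in>cobasis. exp (\<i> * of_real (2 * pi * real (\<theta> s) * real_of_int (coord S (a - b) s) / real N)))"
      unfolding chi_def inner of_real_sum sum_distrib_left by (simp add: exp_sum)
    also have "\<dots> = (\<Prod>s\<in>cobasis. \<Sum>m<N. exp (\<i> * of_real (2 * pi * real m * real_of_int (coord S (a - b) s) / real N)))"
      unfolding I_def by (rule prod_sum_PiE[symmetric]) auto
    also have "\<dots> = 0"
    proof (rule prod_zero)
      show "\<exists>s\<in>cobasis. (\<Sum>m<N. exp (\<i> * of_real (2 * pi * real m * real_of_int (coord S (a - b) s) / real N))) = 0"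
        using sum_roots_of_unity[OF N[OF ab s(1)]] s by (intro bexI[of _ s]) auto
    qed simp
    finally show ?thesis using False by simp
  qed simp
  moreover have "finite I" by (simp add: I_def finite_PiE)
  moreover have "I \<noteq> {}" by (auto simp: I_def PiE_eq_empty_iff N_def)
  ultimately show ?thesis by (intro that)
qed

lemma finite_parseval:
  fixes I :: "'i set"
  assumes A: "finite A"
    and I: "\<And>a b. a \<in> A \<Longrightarrow> b \<in> A \<Longrightarrow> (\<Sum>i\<in>I. chi (\<kappa> i) (a - b)) = (if a = b then of_nat (card I) else 0)"
  shows "(\<Sum>i\<in>I. (cmod (\<Sum>a\<in>A. chi (\<kappa> i) (- a) * \<phi> a))\<^sup>2) = card I * (\<Sum>a\<in>A. (cmod (\<phi> a))\<^sup>2)"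
proof -
  have "complex_of_real (\<Sum>i\<in>I. (cmod (\<Sum>a\<in>A. chi (\<kappa> i) (- a) * \<phi> a))\<^sup>2)
      = (\<Sum>i\<in>I. (\<Sum>a\<in>A. chi (\<kappa> i) (- a) * \<phi> a) * (\<Sum>b\<in>A. chi (\<kappa> i) b * cnj (\<phi> b)))"
    unfolding of_real_sum
    by (intro sum.cong refl) (simp add: complex_norm_square cnj_chi cnj_sum del: of_real_power)
  also have "\<dots> = (\<Sum>i\<in>I. \<Sum>a\<in>A. \<Sum>b\<in>A. chi (\<kappa> i) (b - a) * (\<phi> a * cnj (\<phi> b)))"
  proof (intro sum.cong refl)
    fix i
    have "chi (\<kappa> i) (b - a) = chi (\<kappa> i) (- a) * chi (\<kappa> i) b" for a b
      by (simp add: chi_add[symmetric])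
    then show "(\<Sum>a\<in>A. chi (\<kappa> i) (- a) * \<phi> a) * (\<Sum>b\<in>A. chi (\<kappa> i) b * cnj (\<phi> b))
        = (\<Sum>a\<in>A. \<Sum>b\<in>A. chi (\<kappa> i) (b - a) * (\<phi> a * cnj (\<phi> b)))"
      by (simp add: sum_product mult_ac)
  qed
  also have "\<dots> = (\<Sum>a\<in>A. \<Sum>b\<in>A. (\<Sum>i\<in>I. chi (\<kappa> i) (b - a)) * (\<phi> a * cnj (\<phi> b)))"
    unfolding sum_distrib_right by (subst sum.swap, intro sum.cong refl sum.swap)
  also have "\<dots> = (\<Sum>a\<in>A. \<Sum>b\<in>A. if a = b then of_nat (card I) * (\<phi> a * cnj (\<phi> b)) else 0)"
    by (intro sum.cong refl) (simp add: I)
  also have "\<dots> = (\<Sum>a\<in>A. of_nat (card I) * (\<phi> a * cnj (\<phi> a)))"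
    using A by simp
  also have "\<dots> = complex_of_real (card I * (\<Sum>a\<in>A. (cmod (\<phi> a))\<^sup>2))"
    by (simp add: sum_distrib_left complex_norm_square del: of_real_power)
  finally show ?thesis unfolding of_real_eq_iff .
qed

lemma sum_pt:
  assumes "finite A" "A \<subseteq> colattice"
  shows "(\<Sum>r\<in>reps G. \<Sum>a\<in>A. g (lift_fun (row_lattice T) f (r + ivec a))) = (\<Sum>x\<in>pt ` (reps G \<times> A). g (f x))"
proof -
  have "inj_on pt (reps G \<times> A)"
    by (rule inj_on_subset[OF inj_pt]) (use assms(2) in auto)
  then have "(\<Sum>x\<in>pt ` (reps G \<times> A). g (f x)) = (\<Sum>x\<in>reps G \<times> A. g (f (pt x)))"
    by (rule sum.reindex_cong) auto
  also have "\<dots> = (\<Sum>r\<in>reps G. \<Sum>a\<in>A. g (f (pt (r, a))))"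
    unfolding sum.cartesian_product by (simp add: case_prod_unfold)
  finally show ?thesis by (simp add: pt_def lift_fun_def)
qed

lemma fin_supp_box:
  assumes "fin_supp f"
  obtains A where "finite A" "A \<subseteq> colattice" "{x. f x \<noteq> 0} \<subseteq> pt ` (reps G \<times> A)"
proof -
  have "{x. f x \<noteq> 0} \<subseteq> pt ` (reps G \<times> colattice)"
    using bij_betw_pt assms unfolding bij_betw_def fin_supp_def by auto
  then obtain B where B: "B \<subseteq> reps G \<times> colattice" "finite B" "{x. f x \<noteq> 0} = pt ` B"
    using finite_subset_image[of "{x. f x \<noteq> 0}" pt "reps G \<times> colattice"] assms
    unfolding fin_supp_def by metis
  have "B \<subseteq> reps G \<times> snd ` B" using B(1) by force
  then have "{x. f x \<noteq> 0} \<subseteq> pt ` (reps G \<times> snd ` B)"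
    unfolding B(3) by (rule image_mono)
  moreover have "finite (snd ` B)" "snd ` B \<subseteq> colattice" using B(1,2) by auto
  ultimately show ?thesis by (intro that)
qed

text \<open>The box \<open>A\<close> is large enough for \<open>f\<close> and for its image, so one
  grid gives Parseval for both; between the two identities the estimate is made separately in each
  fibre.\<close>

lemma op_bound_quad:
  assumes q0: "0 \<le> q"
    and q: "\<And>k i. k \<in> admissible T \<Longrightarrow> i < nbands \<Longrightarrow>
      cmod (\<alpha> + \<beta> * of_real (band G (Suc i) k) + \<delta> * (of_real (band G (Suc i) k))\<^sup>2) \<le> q"
  shows "op_bound subverts (quad_op subop \<alpha> \<beta> \<delta>) q"
  unfolding op_bound_def
proof (intro conjI q0 allI impI)
  fix f :: "(real ^ 'd) set \<Rightarrow> complex" and F H assume F: "finite F" "F \<subseteq> subverts" "\<forall>x. x \<notin> F \<longrightarrow> f x = 0" and H: "finite H" "H \<subseteq> subverts"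
  have f: "fin_supp f"
    unfolding fin_supp_def using F by (auto intro: rev_finite_subset)
  define g where "g = quad_op subop \<alpha> \<beta> \<delta> f"
  have g: "fin_supp g" unfolding g_def by (rule fin_supp_quad[OF f])
  obtain A1 where A1: "finite A1" "A1 \<subseteq> colattice" "{x. f x \<noteq> 0} \<subseteq> pt ` (reps G \<times> A1)"
    using fin_supp_box[OF f] .
  obtain A2 where A2: "finite A2" "A2 \<subseteq> colattice" "{x. g x \<noteq> 0} \<subseteq> pt ` (reps G \<times> A2)"
    using fin_supp_box[OF g] .
  define A where "A = A1 \<union> A2"
  have A: "finite A" "A \<subseteq> colattice" using A1 A2 by (auto simp: A_def)
  let ?Y = "pt ` (reps G \<times> A)"
  have fA: "{x. f x \<noteq> 0} \<subseteq> ?Y" "{x. g x \<noteq> 0} \<subseteq> ?Y"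
    using A1(3) A2(3) unfolding A_def by blast+
  have tr: "bloch k h r = (\<Sum>a\<in>A. chi k (- a) * lft h (r + ivec a))"
    if h: "{x. h x \<noteq> 0} \<subseteq> ?Y" and r: "r \<in> reps G" for h r k
  proof (rule bloch_eq_sum[OF A])
    fix a assume a: "a \<in> colattice - A"
    show "lft h (r + ivec a) = 0"
    proof (rule ccontr)
      assume "lft h (r + ivec a) \<noteq> 0"
      then have "pt (r, a) \<in> ?Y"
        using h by (auto simp: pt_def lift_fun_def)
      then obtain y where y: "y \<in> reps G \<times> A" "pt (r, a) = pt y" by auto
      have "(r, a) = y"
        by (rule inj_onD[OF inj_pt]) (use y r a A in auto)
      then show False using y a by auto
    qed
  qed
  obtain I :: "(int ^ 'd \<Rightarrow> nat) set" and \<kappa> where I: "finite I" "I \<noteq> {}" "\<And>i. i \<in> I \<Longrightarrow> \<kappa> i \<in> admissible T"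
    "\<And>a b. a \<in> A \<Longrightarrow> b \<in> A \<Longrightarrow> (\<Sum>i\<in>I. chi (\<kappa> i) (a - b)) = (if a = b then of_nat (card I) else 0)"
    using finite_fourier_grid[OF A] by blast
  have pars: "(\<Sum>i\<in>I. \<Sum>r\<in>reps G. (cmod (bloch (\<kappa> i) h r))\<^sup>2)
      = card I * (\<Sum>x\<in>?Y. (cmod (h x))\<^sup>2)"
    if h: "{x. h x \<noteq> 0} \<subseteq> ?Y" for h
  proof -
    have "(\<Sum>i\<in>I. \<Sum>r\<in>reps G. (cmod (bloch (\<kappa> i) h r))\<^sup>2)
        = (\<Sum>r\<in>reps G. \<Sum>i\<in>I. (cmod (\<Sum>a\<in>A. chi (\<kappa> i) (- a) * lft h (r + ivec a)))\<^sup>2)"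
      by (subst sum.swap) (intro sum.cong refl, simp add: tr[OF h])
    also have "\<dots> = (\<Sum>r\<in>reps G. card I * (\<Sum>a\<in>A. (cmod (lft h (r + ivec a)))\<^sup>2))"
      by (intro sum.cong refl finite_parseval[OF A(1) I(4)])
    finally show ?thesis
      unfolding sum_distrib_left[symmetric] sum_pt[OF A, of "\<lambda>w. (cmod w)\<^sup>2"] .
  qed
  have "card I * (\<Sum>x\<in>?Y. (cmod (g x))\<^sup>2)
      = (\<Sum>i\<in>I. \<Sum>r\<in>reps G. (cmod (quad_op (schroedinger G) \<alpha> \<beta> \<delta> (bloch (\<kappa> i) f) r))\<^sup>2)"
    unfolding pars[OF fA(2), symmetric] by (intro sum.cong refl) (simp add: g_def bloch_quad[OF f I(3)])
  also have "\<dots> \<le> (\<Sum>i\<in>I. q\<^sup>2 * (\<Sum>r\<in>reps G. (cmod (bloch (\<kappa> i) f r))\<^sup>2))"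
    by (intro sum_mono quad_op_floquet_bound[OF bloch_floquet_space[OF f I(3)] q[OF I(3)]])
  also have "\<dots> = q\<^sup>2 * (card I * (\<Sum>x\<in>?Y. (cmod (f x))\<^sup>2))"
    unfolding sum_distrib_left[symmetric] pars[OF fA(1)] ..
  finally have "real (card I) * (\<Sum>x\<in>?Y. (cmod (g x))\<^sup>2)
      \<le> real (card I) * (q\<^sup>2 * (\<Sum>x\<in>?Y. (cmod (f x))\<^sup>2))"
    by (simp add: mult_ac)
  moreover have "real (card I) > 0" using I by (simp add: card_gt_0_iff)
  ultimately have main: "(\<Sum>x\<in>?Y. (cmod (g x))\<^sup>2) \<le> q\<^sup>2 * (\<Sum>x\<in>?Y. (cmod (f x))\<^sup>2)"
    by simp
  have finY: "finite (?Y)" using A by simp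
  have "(\<Sum>x\<in>H. (cmod (g x))\<^sup>2) = (\<Sum>x\<in>H \<inter> ?Y. (cmod (g x))\<^sup>2)"
    by (rule sum.mono_neutral_right) (use H fA(2) in auto)
  also have "\<dots> \<le> (\<Sum>x\<in>?Y. (cmod (g x))\<^sup>2)"
    by (rule sum_mono2) (use finY in auto)
  also have "\<dots> \<le> q\<^sup>2 * (\<Sum>x\<in>?Y. (cmod (f x))\<^sup>2)" by (rule main)
  also have "(\<Sum>x\<in>?Y. (cmod (f x))\<^sup>2) = (\<Sum>x\<in>?Y \<inter> F. (cmod (f x))\<^sup>2)"
    by (rule sum.mono_neutral_right) (use finY F in auto)
  also have "q\<^sup>2 * \<dots> \<le> q\<^sup>2 * (\<Sum>x\<in>F. (cmod (f x))\<^sup>2)"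
    by (intro mult_left_mono sum_mono2) (use F in auto)
  finally have "sqrt (\<Sum>x\<in>H. (cmod (g x))\<^sup>2) \<le> sqrt (q\<^sup>2 * (\<Sum>x\<in>F. (cmod (f x))\<^sup>2))"
    by (rule real_sqrt_le_mono)
  also have "\<dots> = q * sqrt (\<Sum>x\<in>F. (cmod (f x))\<^sup>2)"
    using q0 by (simp add: real_sqrt_mult)
  finally show "L2_set (\<lambda>x. cmod (quad_op subop \<alpha> \<beta> \<delta> f x)) H \<le> q * l2 f F"
    by (simp add: L2_set_def g_def)
qed

end

section \<open>The spectrum of a subcovering\<close>

context periodic_subcovering
begin

lemma band_admissible_in_image:
  "k \<in> admissible T \<Longrightarrow> band G j k \<in> band G j ` brillouin_sub T"
  unfolding brillouin_sub_eq band_image_brillouin[OF periodic_set_admissible] by simp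

lemma spectrum_subset_bands:
  "spectrum_ell2 subverts subop \<subseteq> (\<Union>j\<in>{1..nbands}. complex_of_real ` (band G j ` brillouin_sub T))"
proof
  fix z assume z: "z \<in> spectrum_ell2 subverts subop"
  define C where "C = (\<Union>j\<in>{1..nbands}. complex_of_real ` (band G j ` brillouin_sub T))"
  have "compact C"
    unfolding C_def
    by (intro compact_UN ballI compact_continuous_image compact_band_image_sub continuous_intros) auto
  have CI: "of_real (band G (Suc i) k) \<in> C" if "k \<in> admissible T" "i < nbands" for i k
    unfolding C_def using that by (intro UN_I[of "Suc i"] imageI band_admissible_in_image) auto
  show "z \<in> C"
  proof (rule ccontr)
    assume "z \<notin> C"
    then obtain e where e: "e > 0" "ball z e \<subseteq> - C"
      using \<open>compact C\<close> by (metis ComplI compact_imp_closed openE open_Compl)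
    have e: "e > 0" "\<And>c. c \<in> C \<Longrightarrow> e \<le> cmod (c - z)"
      using e by (auto simp: subset_iff dist_norm norm_minus_commute not_less[symmetric])
    obtain a where a: "\<And>c. c \<in> C \<Longrightarrow> cmod c \<le> a"
      using compact_imp_bounded[OF \<open>compact C\<close>] by (auto simp: bounded_iff)
    \<comment> \<open>The summand \<open>e\<close> ensures \<open>0 < M\<close> and
      \<open>e \<le> M\<close>, and hence \<open>0 \<le> q\<close>.\<close>
    define M where "M = \<bar>a\<bar> + cmod z + e"
    have M: "M > 0" "e \<le> M" using e(1) by (auto simp: M_def intro: add_nonneg_pos)
    have MC: "cmod (c - z) \<le> M" if "c \<in> C" for c
      using norm_triangle_ineq4[of c z] a[OF that] e(1) by (simp add: M_def)
    \<comment> \<open>With \<open>|c - z|\<close> between \<open>e\<close> and \<open>M\<close> on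
      the bands, this scaling places \<open>1 - s * |c - z|^2\<close> between 0 and
      \<open>q\<close>.\<close>
    define s where "s = 1 / M\<^sup>2"
    define q where "q = 1 - e\<^sup>2 / M\<^sup>2"
    have q: "0 \<le> q" "q < 1" using M e(1) by (simp_all add: q_def power_mono)
    have shift: "op_bound subverts (shift_op subop w) M"
      if w: "\<And>x. of_real x \<in> C \<Longrightarrow> cmod (of_real x - w) \<le> M" for w
    proof -
      have "shift_op subop w = quad_op subop (- w) 1 0"
        by (simp add: shift_op_def quad_op_def fun_eq_iff)
      moreover have "op_bound subverts (quad_op subop (- w) 1 0) M"
        by (rule op_bound_quad) (use M(1) w CI in \<open>auto simp: algebra_simps\<close>)
      ultimately show ?thesis by simp
    qed
    have conj: "cmod (of_real x - cnj z) = cmod (of_real x - z)" for x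
      by (metis complex_cnj_complex_of_real complex_cnj_diff complex_mod_cnj)
    have "(\<lambda>f x. f x - of_real s * shift_op subop z (shift_op subop (cnj z) f) x)
        = quad_op subop (1 - of_real s * (z * cnj z)) (of_real s * (z + cnj z)) (- of_real s)"
      by (simp add: fun_eq_iff quad_op_def shift_op_commute[OF lin_op_schroedinger] algebra_simps)
    moreover have "op_bound subverts (quad_op subop (1 - of_real s * (z * cnj z)) (of_real s * (z + cnj z)) (- of_real s)) q"
    proof (rule op_bound_quad[OF q(1)])
      fix k i assume ki: "k \<in> admissible T" "i < nbands"
      define x where "x = band G (Suc i) k"
      have x: "of_real x \<in> C" using CI[OF ki] by (simp add: x_def)
      have "1 - of_real s * (z * cnj z) + of_real s * (z + cnj z) * of_real x + - of_real s * (of_real x)\<^sup>2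
          = 1 - of_real s * ((of_real x - z) * cnj (of_real x - z))"
        by (simp add: algebra_simps power2_eq_square)
      also have "\<dots> = of_real (1 - s * (cmod (of_real x - z))\<^sup>2)"
        by (simp only: complex_norm_square[symmetric]) simp
      finally have eq: "cmod (1 - of_real s * (z * cnj z) + of_real s * (z + cnj z) * of_real x + - of_real s * (of_real x)\<^sup>2)
          = \<bar>1 - s * (cmod (of_real x - z))\<^sup>2\<bar>"
        by (simp only: norm_of_real)
      have "s * e\<^sup>2 \<le> s * (cmod (of_real x - z))\<^sup>2"
        using e x by (intro mult_left_mono power_mono) (auto simp: s_def)
      moreover have "s * (cmod (of_real x - z))\<^sup>2 \<le> s * M\<^sup>2"
        using MC[OF x] by (intro mult_left_mono power_mono) (auto simp: s_def)
      moreover have "s * M\<^sup>2 = 1" "s * e\<^sup>2 = e\<^sup>2 / M\<^sup>2" using M by (simp_all add: s_def)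
      ultimately show "cmod (1 - of_real s * (z * cnj z) + of_real s * (z + cnj z) * of_real (band G (Suc i) k)
          + - of_real s * (of_real (band G (Suc i) k))\<^sup>2) \<le> q"
        unfolding x_def[symmetric] eq q_def by simp
    qed
    ultimately have Dq: "op_bound subverts (\<lambda>f x. f x - of_real s * shift_op subop z (shift_op subop (cnj z) f) x) q"
      by simp
    have "bij_betw (\<lambda>f x. subop f x - z * f x) (ell2 subverts) (ell2 subverts) \<and>
       (\<exists>C. \<forall>f\<in>ell2 subverts. ell2_norm subverts f \<le> C * ell2_norm subverts (\<lambda>x. subop f x - z * f x))"
      by (rule bounded_inverse_ell2[OF lin_op_schroedinger local_op_schroedinger
            preserves_support_subop shift[OF MC] shift Dq q(2)])
        (simp_all add: MC conj s_def)
    then show False using z unfolding spectrum_ell2_def by blast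
  qed
qed

section \<open>Truncated Bloch waves and the boundary of boxes\<close>

lemma subverts_cases:
  assumes "x \<in> subverts"
  obtains r a where "r \<in> reps G" "a \<in> colattice" "x = pt (r, a)"
proof -
  have "x \<in> pt ` (reps G \<times> colattice)"
    unfolding surj_pt by (rule assms)
  then show ?thesis using that by auto
qed

text \<open>Inverse of the lift on functions that are invariant under the row lattice and vanish off
  the vertices.\<close>

definition descend :: "(real ^ 'd \<Rightarrow> complex) \<Rightarrow> (real ^ 'd) set \<Rightarrow> complex" where
  "descend F x = (if x \<in> subverts then F (SOME v. v \<in> verts G \<and> x = orb v) else 0)"

lemma lft_descend:
  assumes F: "\<And>v a. v \<in> verts G \<Longrightarrow> a \<in> row_lattice T \<Longrightarrow> F (v + ivec a) = F v" "\<And>v. v \<notin> verts G \<Longrightarrow> F v = 0"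
  shows "lft (descend F) v = F v"
proof (cases "v \<in> verts G")
  case True
  define w where "w = (SOME w. w \<in> verts G \<and> orb v = orb w)"
  have w: "w \<in> verts G \<and> orb v = orb w"
    unfolding w_def by (rule someI[of _ v]) (use True in simp)
  then obtain c where "c \<in> row_lattice T" "v = w + ivec c"
    using orb_eq_iff by blast
  then have "F v = F w" using F(1)[of w c] w by blast
  moreover have "lft (descend F) v = F w"
    unfolding lift_fun_def descend_def w_def
    using True by (simp only: orb_in_subverts if_True)
  ultimately show ?thesis by simp
next
  case False
  then show ?thesis
    by (simp add: lift_fun_def descend_def orb_in_subverts F(2))
qed

definition coord_box :: "nat \<Rightarrow> (int ^ 'd) set" where
  "coord_box L = {a \<in> colattice. \<forall>s\<in>cobasis. \<bar>coord S a s\<bar> \<le> int L}"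

lemma bij_betw_box: "bij_betw (\<lambda>a. restrict (coord S a) cobasis) (coord_box L) (PiE cobasis (\<lambda>_. {- int L..int L}))"
  unfolding bij_betw_def
proof
  show "inj_on (\<lambda>a. restrict (coord S a) cobasis) (coord_box L)"
  proof (rule inj_onI)
    fix a b assume ab: "a \<in> coord_box L" "b \<in> coord_box L" "restrict (coord S a) cobasis = restrict (coord S b) cobasis"
    have "coord S a s = coord S b s" for s
    proof (cases "s \<in> cobasis")
      case True
      then show ?thesis using fun_cong[OF ab(3), of s] by simp
    next
      case False
      then have "s \<notin> S \<or> s \<in> rows T" by (simp add: cobasis_def)
      then show ?thesis using ab by (auto simp: coord_box_def colattice_def coord_outside[OF S])
    qed
    then show "a = b" by (intro coord_inject[OF S] ext)
  qed
  show "(\<lambda>a. restrict (coord S a) cobasis) ` coord_box L = PiE cobasis (\<lambda>_. {- int L..int L})"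
  proof (intro subset_antisym subsetI)
    fix m assume m: "m \<in> PiE cobasis (\<lambda>_. {- int L..int L})"
    define a where "a = (\<Sum>s\<in>S. (if s \<in> cobasis then m s else 0) *s s)"
    have a: "coord S a t = (if t \<in> cobasis then m t else 0)" for t
      unfolding a_def by (rule coord_lincomb_cobasis)
    have "\<bar>m s\<bar> \<le> int L" if "s \<in> cobasis" for s
      using PiE_mem[OF m that] by auto
    then have "a \<in> coord_box L" by (auto simp: coord_box_def colattice_def a) (simp add: cobasis_def)
    moreover have "m = restrict (coord S a) cobasis"
    proof
      fix t
      show "m t = restrict (coord S a) cobasis t"
        using PiE_arb[OF m, of t] by (cases "t \<in> cobasis") (simp_all add: a)
    qed
    ultimately show "m \<in> (\<lambda>a. restrict (coord S a) cobasis) ` coord_box L" by blast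
  next
    fix m assume "m \<in> (\<lambda>a. restrict (coord S a) cobasis) ` coord_box L"
    then obtain a where a: "a \<in> coord_box L" "m = restrict (coord S a) cobasis" by auto
    show "m \<in> PiE cobasis (\<lambda>_. {- int L..int L})"
      unfolding a(2)
    proof (rule restrict_PiE_iff[THEN iffD2], rule ballI)
      fix s assume "s \<in> cobasis"
      then have "\<bar>coord S a s\<bar> \<le> int L" using a(1) by (simp add: coord_box_def)
      then show "coord S a s \<in> {- int L..int L}" by (simp add: abs_le_iff)
    qed
  qed
qed

lemma finite_box: "finite (coord_box L)"
  using bij_betw_finite[OF bij_betw_box] by (simp add: finite_PiE)

lemma card_box: "card (coord_box L) = (2 * L + 1) ^ card cobasis"
proof -
  have "nat (2 * int L + 1) = 2 * L + 1" by simp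
  then show ?thesis
    using bij_betw_same_card[OF bij_betw_box, of L] by (simp add: card_PiE)
qed

lemma box_subset: "coord_box L \<subseteq> colattice"
  by (auto simp: coord_box_def)

lemma fin_supp_in_ell2: "fin_supp f \<Longrightarrow> f \<in> ell2 subverts"
  unfolding fin_supp_def ell2_def
  by (auto intro!: finite_nonzero_values_imp_summable_on elim!: rev_finite_subset)

text \<open>Truncating a Bloch eigenfunction to a box creates an error only in a neighbourhood of the
  boundary of the box, whose size is negligible against that of the box.\<close>

lemma box_boundary_bound:
  assumes k: "k \<in> admissible T" and i: "i < nbands"
    and C: "\<And>f. f \<in> ell2 subverts \<Longrightarrow>
      ell2_norm subverts f \<le> C * ell2_norm subverts (\<lambda>x. subop f x - of_real (band G (Suc i) k) * f x)"
  shows "\<exists>D K. \<forall>L\<ge>D. real (card (coord_box L)) \<le> K * (real (card (coord_box (L + D))) - real (card (coord_box (L - D))))"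
proof -
  obtain U \<mu> where b: "bloch_system k U \<mu>" using bloch_system_exists .
  define z where "z = complex_of_real (band G (Suc i) k)"
  define \<phi> where "\<phi> = U i"
  have \<phi>: "\<phi> \<in> floquet_space G k" and eig: "schroedinger G \<phi> = (\<lambda>v. z * \<phi> v)"
    and "ip \<phi> \<phi> = 1"
    using b i band_bloch[OF b i] by (simp_all add: bloch_system_def \<phi>_def z_def)
  then have norm1: "(\<Sum>r\<in>reps G. (cmod (\<phi> r))\<^sup>2) = 1"
    unfolding finner_self by (metis of_real_eq_1_iff)
  have \<phi>_shift: "\<phi> (v + ivec a) = chi k a * \<phi> v" for v a
    using \<phi> verts_shift_iff by (cases "v \<in> verts G") (auto simp: floquet_space_def chi_def)
  have \<phi>_out: "\<phi> v = 0" if "v \<notin> verts G" for v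
    using \<phi> that by (simp add: floquet_space_def)
  have \<phi>_le: "cmod (\<phi> v) \<le> 1" for v
  proof (cases "v \<in> verts G")
    case True
    have "(cmod (\<phi> (rep v)))\<^sup>2 \<le> (\<Sum>r\<in>reps G. (cmod (\<phi> r))\<^sup>2)"
      by (rule member_le_sum) (use True in auto)
    then have "cmod (\<phi> (rep v)) \<le> 1" unfolding norm1 by (simp add: abs_square_le_1)
    moreover have "cmod (\<phi> (rep v + ivec (off v))) = cmod (\<phi> (rep v))"
      unfolding \<phi>_shift by (simp add: norm_mult)
    ultimately show ?thesis using rep_off[of v] by simp
  qed (simp add: \<phi>_out)
  \<comment> \<open>\<open>N\<close> collects the distances over which \<open>ker\<close> couples,
    in cobasis coordinates. It is finite, since there are finitely many representatives and each has
    a finite row; its bound \<open>D\<close> is the range of the operator.\<close>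
  define N where "N = (\<Union>r\<in>reps G. \<Union>u\<in>{u. ker r u \<noteq> 0}. (\<lambda>s. nat \<bar>coord S (off u) s\<bar>) ` cobasis)"
  have "finite N" using finite_ker by (auto simp: N_def)
  then obtain D where "\<forall>n\<in>N. n \<le> D" using finite_nat_set_iff_bounded_le by blast
  then have D: "\<bar>coord S (off u) s\<bar> \<le> int D" if "r \<in> reps G" "ker r u \<noteq> 0" "s \<in> cobasis" for r u s
  proof -
    have "nat \<bar>coord S (off u) s\<bar> \<in> N" unfolding N_def using that by blast
    with \<open>\<forall>n\<in>N. n \<le> D\<close> have "nat \<bar>coord S (off u) s\<bar> \<le> D" by blast
    then show ?thesis by simp
  qed
  define W where "W = (\<Sum>r\<in>reps G. \<Sum>u | ker r u \<noteq> 0. cmod (ker r u))"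
  have W: "(\<Sum>u | ker r u \<noteq> 0. cmod (ker r u)) \<le> W" if "r \<in> reps G" for r
    unfolding W_def by (rule member_le_sum) (use that in \<open>auto intro: sum_nonneg\<close>)
  have W0: "W \<ge> 0" by (simp add: W_def sum_nonneg)
  \<comment> \<open>The constants of the squared norm estimate: \<open>C\<close> from the bounded
    inverse, in absolute value because its sign is unknown, \<open>W\<close> bounding each value of
    the error, and \<open>nbands\<close> vertices per translation in the boundary shell.\<close>
  define K where "K = (\<bar>C\<bar> * W)\<^sup>2 * nbands"
  have "real (card (coord_box L)) \<le> K * (real (card (coord_box (L + D))) - real (card (coord_box (L - D))))" if L: "L \<ge> D" for L
  proof -
    \<comment> \<open>The cutoff tests cobasis coordinates only, so it is constant along the row
      lattice; since \<open>k\<close> is admissible, the product \<open>F\<close> with the Bloch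
      function descends to the subcovering.\<close>
    define c :: "real ^ 'd \<Rightarrow> complex" where
      "c = (\<lambda>v. if \<forall>s\<in>cobasis. \<bar>coord S (off v) s\<bar> \<le> int L then 1 else 0)"
    define F where "F = (\<lambda>v. c v * \<phi> v)"
    define f where "f = descend F"
    define g where "g = (\<lambda>x. subop f x - z * f x)"
    have c_shift: "c (v + ivec a) = c v" if "a \<in> row_lattice T" for v a
      using that by (simp add: c_def coord_add[OF S] row_lattice_eq)
    have lf: "lft f v = F v" for v
      unfolding f_def by (rule lft_descend)
        (simp_all add: F_def c_shift \<phi>_shift chi_row_lattice[OF k] \<phi>_out)
    have foff: "f x = 0" if "x \<notin> subverts" for x using that by (simp add: f_def descend_def)
    have "{x. f x \<noteq> 0} \<subseteq> pt ` (reps G \<times> coord_box L)"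
    proof
      fix x assume x: "x \<in> {x. f x \<noteq> 0}"
      then have "x \<in> subverts" using foff by auto
      then obtain r a where ra: "r \<in> reps G" "a \<in> colattice" "x = pt (r, a)"
        by (rule subverts_cases)
      have "F (r + ivec a) \<noteq> 0"
        using x lf[of "r + ivec a"] by (simp add: ra(3) pt_def lift_fun_def)
      then have "a \<in> coord_box L" using ra by (auto simp: F_def c_def coord_box_def split: if_splits)
      then show "x \<in> pt ` (reps G \<times> coord_box L)" using ra by auto
    qed
    then have fs: "fin_supp f"
      using finite_box foff unfolding fin_supp_def by (auto elim!: rev_finite_subset[rotated])
    have "(\<Sum>x\<in>pt ` (reps G \<times> coord_box L). (cmod (f x))\<^sup>2) = (\<Sum>r\<in>reps G. \<Sum>a\<in>coord_box L. (cmod (F (r + ivec a)))\<^sup>2)"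
      unfolding sum_pt[OF finite_box box_subset, of "\<lambda>w. (cmod w)\<^sup>2", symmetric] lf ..
    also have "\<dots> = (\<Sum>r\<in>reps G. \<Sum>a\<in>coord_box L. (cmod (\<phi> r))\<^sup>2)"
      by (intro sum.cong refl) (auto simp: F_def c_def \<phi>_shift norm_mult coord_box_def)
    also have "\<dots> = real (card (coord_box L))"
      by (simp add: sum_distrib_left[symmetric] norm1)
    finally have "sqrt (real (card (coord_box L))) = l2 f (pt ` (reps G \<times> coord_box L))"
      by (simp add: L2_set_def)
    also have "\<dots> \<le> ell2_norm subverts f"
    proof (intro ell2_L2_set_le fin_supp_in_ell2 fs)
      show "pt ` (reps G \<times> coord_box L) \<subseteq> subverts"
        unfolding bij_betw_imp_surj_on[OF bij_betw_pt, symmetric]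
        by (intro image_mono Sigma_mono order.refl box_subset)
    qed (simp add: finite_box)
    finally have low: "sqrt (real (card (coord_box L))) \<le> ell2_norm subverts f" .
    \<comment> \<open>The commutator of the operator with the cutoff: by the eigenvalue equation for
      \<open>\<phi>\<close> only differences of cutoff values remain.\<close>
    have gpt: "g (pt (r, a)) = (\<Sum>u | ker r u \<noteq> 0. ker r u * ((c (u + ivec a) - c (r + ivec a)) * \<phi> (u + ivec a)))"
      if r: "r \<in> reps G" for r a
    proof -
      have rv: "r \<in> verts G" using r reps_subset by auto
      have sch: "schroedinger G h (r + ivec a) = (\<Sum>u | ker r u \<noteq> 0. ker r u * h (u + ivec a))" for h
        unfolding schroedinger_shift[OF rv] by (rule schroedinger_eq_sum_ker)
      have "g (pt (r, a)) = lft (subop f) (r + ivec a) - z * lft f (r + ivec a)"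
        by (simp add: g_def pt_def lift_fun_def)
      also have "lft (subop f) (r + ivec a) = schroedinger G F (r + ivec a)"
        using lft_subop[OF verts_shift[OF rv]] lf by presburger
      also have "z * lft f (r + ivec a) = c (r + ivec a) * schroedinger G \<phi> (r + ivec a)"
        by (simp add: lf F_def eig)
      finally show ?thesis
        unfolding sch by (simp add: F_def sum_distrib_left sum_subtractf[symmetric] algebra_simps)
    qed
    have gW: "cmod (g (pt (r, a))) \<le> W" if r: "r \<in> reps G" for r a
    proof -
      have "cmod (g (pt (r, a))) \<le> (\<Sum>u | ker r u \<noteq> 0. cmod (ker r u))"
        unfolding gpt[OF r]
      proof (rule sum_norm_le)
        fix u assume "u \<in> {u. ker r u \<noteq> 0}"
        have "cmod (c (u + ivec a) - c (r + ivec a)) \<le> 1" by (simp add: c_def)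
        then have "cmod (c (u + ivec a) - c (r + ivec a)) * cmod (\<phi> (u + ivec a)) \<le> 1 * 1"
          by (intro mult_mono \<phi>_le) auto
        then show "cmod (ker r u * ((c (u + ivec a) - c (r + ivec a)) * \<phi> (u + ivec a))) \<le> cmod (ker r u)"
          by (simp add: norm_mult mult_left_le)
      qed
      then show ?thesis using W[OF r] by linarith
    qed
    \<comment> \<open>Deep inside the box, or far outside it, the cutoff takes the same value at
      \<open>r + a\<close> and at every vertex within range \<open>D\<close>.\<close>
    have g0: "a \<in> coord_box (L + D) - coord_box (L - D)" if ra: "r \<in> reps G" "a \<in> colattice" "g (pt (r, a)) \<noteq> 0" for r a
    proof (rule ccontr)
      assume na: "a \<notin> coord_box (L + D) - coord_box (L - D)"
      have "c (u + ivec a) = c (r + ivec a)" if u: "ker r u \<noteq> 0" for u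
      proof (cases "a \<in> coord_box (L - D)")
        case True
        have "\<bar>coord S (off u + a) s\<bar> \<le> int L \<and> \<bar>coord S a s\<bar> \<le> int L" if "s \<in> cobasis" for s
        proof -
          have "\<bar>coord S a s\<bar> \<le> int (L - D)" using True that by (simp add: coord_box_def)
          then show ?thesis using D[OF ra(1) u that] L by (simp add: coord_add[OF S] of_nat_diff)
        qed
        then show ?thesis using ra by (simp add: c_def)
      next
        case False
        then have "a \<notin> coord_box (L + D)" using na by simp
        then obtain s where s: "s \<in> cobasis" "\<bar>coord S a s\<bar> > int (L + D)" using ra by (auto simp: coord_box_def not_le)
        then have "\<bar>coord S (off u + a) s\<bar> > int L" "\<bar>coord S a s\<bar> > int L"
          using D[OF ra(1) u s(1)] by (auto simp: coord_add[OF S])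
        then show ?thesis using ra s(1) by (auto simp: c_def not_le[symmetric])
      qed
      then have "g (pt (r, a)) = 0" unfolding gpt[OF ra(1)] by (intro sum.neutral) auto
      then show False using ra by simp
    qed
    have sub: "coord_box (L - D) \<subseteq> coord_box (L + D)" by (force simp: coord_box_def)
    define B where "B = coord_box (L + D) - coord_box (L - D)"
    have B: "finite B" "B \<subseteq> colattice" using finite_box box_subset by (auto simp: B_def)
    have cardB: "real (card B) = real (card (coord_box (L + D))) - real (card (coord_box (L - D)))"
      unfolding B_def using card_Diff_subset[OF finite_box sub] card_mono[OF finite_box sub] by (simp add: of_nat_diff)
    have goff: "g x = 0" if "x \<notin> subverts" for x
      using preserves_support_subop foff that
      unfolding preserves_support_def g_def by simp
    have gsup: "x \<in> pt ` (reps G \<times> B)" if x: "g x \<noteq> 0" for x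
    proof -
      have "x \<in> subverts" using goff x by auto
      then obtain r a where ra: "r \<in> reps G" "a \<in> colattice" "x = pt (r, a)"
        by (rule subverts_cases)
      then show ?thesis using g0[of r a] x by (auto simp: B_def)
    qed
    have "ell2_norm subverts g \<le> sqrt (W\<^sup>2 * nbands * card B)"
    proof (rule ell2_boundI(2)[OF goff])
      fix H assume H: "finite H" "H \<subseteq> subverts"
      have "(\<Sum>x\<in>H. (cmod (g x))\<^sup>2) = (\<Sum>x\<in>H \<inter> pt ` (reps G \<times> B). (cmod (g x))\<^sup>2)"
        by (rule sum.mono_neutral_right) (use H gsup in auto)
      also have "\<dots> \<le> (\<Sum>x\<in>pt ` (reps G \<times> B). (cmod (g x))\<^sup>2)"
        by (rule sum_mono2) (use B in auto)
      also have "\<dots> \<le> (\<Sum>x\<in>pt ` (reps G \<times> B). W\<^sup>2)"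
        by (rule sum_mono) (use gW in \<open>auto intro!: power_mono\<close>)
      also have "\<dots> = W\<^sup>2 * card (pt ` (reps G \<times> B))" by simp
      also have "\<dots> \<le> W\<^sup>2 * (nbands * card B)"
        using card_image_le[of "reps G \<times> B" pt] B(1)
        by (intro mult_left_mono) (auto simp: card_cartesian_product simp flip: of_nat_mult)
      finally show "l2 g H \<le> sqrt (W\<^sup>2 * nbands * card B)"
        unfolding L2_set_def by (intro real_sqrt_le_mono) (simp add: mult.assoc)
    qed
    moreover have "ell2_norm subverts f \<le> \<bar>C\<bar> * ell2_norm subverts g"
      using C[OF fin_supp_in_ell2[OF fs]] mult_right_mono[OF abs_ge_self[of C] ell2_norm_nonneg[of subverts g]]
      by (simp add: g_def z_def)
    ultimately have "sqrt (real (card (coord_box L))) \<le> \<bar>C\<bar> * sqrt (W\<^sup>2 * nbands * card B)"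
      using low mult_left_mono[of "ell2_norm subverts g" _ "\<bar>C\<bar>"] by fastforce
    then have "(sqrt (real (card (coord_box L))))\<^sup>2 \<le> (\<bar>C\<bar> * sqrt (W\<^sup>2 * nbands * card B))\<^sup>2"
      by (intro power_mono) auto
    then have "real (card (coord_box L)) \<le> K * card B"
      by (simp add: K_def power_mult_distrib mult_ac)
    then show ?thesis unfolding cardB .
  qed
  then show ?thesis by blast
qed

text \<open>Box sizes grow polynomially, so a shell of fixed thickness becomes negligible: relative
  to the box its size is \<open>(1 + t L) ^ n - (1 - t L) ^ n\<close> with
  \<open>t L = 2 * D / (2 * L + 1)\<close>, and \<open>t L\<close> tends to 0.\<close>

lemma box_growth:
  assumes "\<forall>L\<ge>D. real (card (coord_box L)) \<le> K * (real (card (coord_box (L + D))) - real (card (coord_box (L - D))))"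
  shows False
proof -
  define n where "n = card cobasis"
  define t where "t = (\<lambda>L. 2 * real D / (2 * real L + 1))"
  have "filterlim (\<lambda>L. 2 * real L + 1) at_top sequentially"
    by (rule filterlim_at_top_mono[OF filterlim_real_sequentially]) auto
  then have t: "t \<longlonglongrightarrow> 0"
    unfolding t_def by (rule real_tendsto_divide_at_top[OF tendsto_const])
  have "(\<lambda>L. K * ((1 + t L) ^ n - (1 - t L) ^ n)) \<longlonglongrightarrow> K * ((1 + 0) ^ n - (1 - 0) ^ n)"
    by (intro tendsto_intros t)
  then have lim: "(\<lambda>L. K * ((1 + t L) ^ n - (1 - t L) ^ n)) \<longlonglongrightarrow> 0" by simp
  have "1 \<le> K * ((1 + t L) ^ n - (1 - t L) ^ n)" if L: "L \<ge> D" for L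
  proof -
    define x where "x = 2 * real L + 1"
    have x: "x > 0" by (simp add: x_def)
    have xn: "x * (1 + t L) = 2 * real (L + D) + 1" "x * (1 - t L) = 2 * real (L - D) + 1"
      using x L unfolding t_def x_def[symmetric] by (simp_all add: ring_distribs) (simp_all add: x_def of_nat_diff)
    have "x ^ n \<le> K * ((2 * real (L + D) + 1) ^ n - (2 * real (L - D) + 1) ^ n)"
      using assms[rule_format, OF L] unfolding card_box n_def[symmetric] x_def
      by (simp only: of_nat_power of_nat_add of_nat_mult of_nat_numeral of_nat_1)
    also have "\<dots> = x ^ n * (K * ((1 + t L) ^ n - (1 - t L) ^ n))"
      unfolding xn[symmetric] power_mult_distrib by (simp add: algebra_simps)
    finally show ?thesis using x by simp
  qed
  then have "1 \<le> (0 :: real)"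
    by (intro LIMSEQ_le_const[OF lim]) blast
  then show False by simp
qed

text \<open>A band value outside the spectrum would supply the constant \<open>C\<close> for
  \<open>box_boundary_bound\<close>, whose conclusion \<open>box_growth\<close> refutes.\<close>

lemma bands_subset_spectrum:
  "(\<Union>j\<in>{1..nbands}. complex_of_real ` (band G j ` brillouin_sub T)) \<subseteq> spectrum_ell2 subverts subop"
proof
  fix z assume "z \<in> (\<Union>j\<in>{1..nbands}. complex_of_real ` (band G j ` brillouin_sub T))"
  then obtain j k where j: "j \<in> {1..nbands}" and k: "k \<in> brillouin_sub T" and z: "z = of_real (band G j k)"
    by auto
  obtain i where i: "j = Suc i" "i < nbands" using j by (cases j) auto
  show "z \<in> spectrum_ell2 subverts subop"
  proof (rule ccontr)
    assume "z \<notin> spectrum_ell2 subverts subop"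
    then obtain C where "\<forall>f\<in>ell2 subverts. ell2_norm subverts f \<le> C * ell2_norm subverts (\<lambda>x. subop f x - z * f x)"
      unfolding spectrum_ell2_def by blast
    moreover have "k \<in> admissible T" using k by (simp add: brillouin_sub_eq)
    ultimately show False
      using box_boundary_bound[of k i C] box_growth i by (auto simp: z)
  qed
qed

lemma spectrum_eq_bands:
  "spectrum_ell2 subverts subop = (\<Union>j\<in>{1..nbands}. complex_of_real ` (band G j ` brillouin_sub T))"
  using spectrum_subset_bands bands_subset_spectrum by (rule subset_antisym)

end

theorem proposition2p2:
  fixes G :: "(real ^ 'd, 'e) wgraph"
    and shift :: "int ^ 'd \<Rightarrow> 'e \<Rightarrow> 'e"
    and T :: "int ^ 'd ^ 'o"
    and \<nu> :: nat
  assumes periodic: "periodic_schroedinger G shift"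
    and nu: "\<nu> = card (verts (fundamental_graph G shift))"
    and primitive: "primitive T"
  shows
    "spectrum_ell2 (verts (subcovering G shift T)) (schroedinger (subcovering G shift T))
       = (\<Union>j\<in>{1..\<nu>}. complex_of_real ` (band G j ` brillouin_sub T))
     \<and> (\<forall>j\<in>{1..\<nu>}.
          band G j ` brillouin_sub T
            = {band_min G (brillouin_sub T) j .. band_max G (brillouin_sub T) j}
        \<and> {band_min G (brillouin_sub T) j .. band_max G (brillouin_sub T) j}
            \<subseteq> {band_min G brillouin j .. band_max G brillouin j})
     \<and> (\<forall>j\<in>{1..\<nu>}.
          (band_min G (brillouin_sub T) j = band_min G brillouin j
            \<longleftrightarrow> (\<exists>k\<in>min_points G j. real_matrix T *v k \<in> two_pi_lattice))
        \<and> (band_max G (brillouin_sub T) j = band_max G brillouin j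
            \<longleftrightarrow> (\<exists>k\<in>max_points G j. real_matrix T *v k \<in> two_pi_lattice))
        \<and> (0 \<in> min_points G j
            \<longrightarrow> band_min G (brillouin_sub T) j = band_min G brillouin j)
        \<and> (0 \<in> max_points G j
            \<longrightarrow> band_max G (brillouin_sub T) j = band_max G brillouin j)
        \<and> ((\<chi> i. pi) \<in> min_points G j \<and> (\<forall>i. even (\<Sum>l\<in>UNIV. T $ i $ l))
            \<longrightarrow> band_min G (brillouin_sub T) j = band_min G brillouin j)
        \<and> ((\<chi> i. pi) \<in> max_points G j \<and> (\<forall>i. even (\<Sum>l\<in>UNIV. T $ i $ l))
            \<longrightarrow> band_max G (brillouin_sub T) j = band_max G brillouin j))
     \<and> (\<forall>j\<in>{1..\<nu>}. \<forall>S :: nat \<Rightarrow> int ^ 'd ^ 'o.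
          (\<forall>n. primitive (S n)) \<and>
          filterlim (\<lambda>n. smallest_singular_value (S n)) at_top sequentially
          \<longrightarrow> (\<lambda>n. band_min G (brillouin_sub (S n)) j) \<longlonglongrightarrow> band_min G brillouin j
            \<and> (\<lambda>n. band_max G (brillouin_sub (S n)) j) \<longlonglongrightarrow> band_max G brillouin j)"
proof -
  \<comment> \<open>Primitivity supplies the auxiliary basis of the locale; the statement does not
    depend on which completion of the rows is taken.\<close>
  obtain B where B: "rows T \<subseteq> B" "lattice_basis B" using primitive by (auto simp: primitive_def)
  interpret periodic_subcovering G shift T B
    by (intro periodic_subcovering.intro periodic periodic_subcovering_axioms.intro primitive B)
  have \<nu>: "\<nu> = nbands" using nu card_reps by simp
  have zero: "real_matrix T *v 0 \<in> two_pi_lattice"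
    using zero_in_admissible[of T] by (simp add: admissible_def)
  show ?thesis
    unfolding \<nu>
  proof (intro conjI ballI allI impI; (elim conjE)?)
    show "spectrum_ell2 subverts subop = (\<Union>j\<in>{1..nbands}. complex_of_real ` (band G j ` brillouin_sub T))"
      by (rule spectrum_eq_bands)
    fix j assume j: "j \<in> {1..nbands}"
    show "band G j ` brillouin_sub T = {band_min G (brillouin_sub T) j .. band_max G (brillouin_sub T) j}"
      by (rule band_sub_interval[OF j primitive])
    show "{band_min G (brillouin_sub T) j .. band_max G (brillouin_sub T) j} \<subseteq> {band_min G brillouin j .. band_max G brillouin j}"
      using band_edges_sub_bounds[OF j] by (intro atLeastatMost_subset_iff[THEN iffD2]) blast
    show min: "band_min G (brillouin_sub T) j = band_min G brillouin j
        \<longleftrightarrow> (\<exists>k\<in>min_points G j. real_matrix T *v k \<in> two_pi_lattice)"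
      by (rule band_edges_sub_eq_iff(1)[OF j])
    show max: "band_max G (brillouin_sub T) j = band_max G brillouin j
        \<longleftrightarrow> (\<exists>k\<in>max_points G j. real_matrix T *v k \<in> two_pi_lattice)"
      by (rule band_edges_sub_eq_iff(2)[OF j])
    show "0 \<in> min_points G j \<Longrightarrow> band_min G (brillouin_sub T) j = band_min G brillouin j"
      "0 \<in> max_points G j \<Longrightarrow> band_max G (brillouin_sub T) j = band_max G brillouin j"
      using min max zero by blast+
    show "(\<chi> i. pi) \<in> min_points G j \<Longrightarrow> \<forall>i. even (\<Sum>l\<in>UNIV. T $ i $ l) \<Longrightarrow>
        band_min G (brillouin_sub T) j = band_min G brillouin j"
      "(\<chi> i. pi) \<in> max_points G j \<Longrightarrow> \<forall>i. even (\<Sum>l\<in>UNIV. T $ i $ l) \<Longrightarrow>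
        band_max G (brillouin_sub T) j = band_max G brillouin j"
      using min max pi_in_admissible[of T] by blast+
    fix S :: "nat \<Rightarrow> int ^ 'd ^ 'o"
    assume "filterlim (\<lambda>n. smallest_singular_value (S n)) at_top sequentially"
    from band_edges_sub_tendsto[OF j this]
    show "(\<lambda>n. band_min G (brillouin_sub (S n)) j) \<longlonglongrightarrow> band_min G brillouin j"
      "(\<lambda>n. band_max G (brillouin_sub (S n)) j) \<longlonglongrightarrow> band_max G brillouin j" .
  qed
qed

end
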